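(* Let $G$ be a finite group and let $\alpha\colon G\to \mathrm{Aut}(A)$ be a product-type action on an infinite dimensional UHF algebra $A=\bigotimes_{i=1}^{\infty}\mathrm{B}(H_i)$, given by unitary representations $\pi_i\colon G\to \mathrm{B}(H_i)$ on finite dimensional Hilbert spaces. Let $d_i=\dim H_i$ and let $\chi_i$ be the character of $\pi_i$; the same notation $H_i,\pi_i,d_i,\chi_i$ is used for the corresponding data after passing to a telescope of the action. Let $\chi\colon G\to\mathbb{C}$ be the characteristic function of $\{1_G\}$. Then: (i) $\alpha$ has the strict Rokhlin property if and only if there exists a telescope such that for every $n\in\mathbb{Z}_{>0}$, $$\frac{1}{d_n}\chi_n=\chi .$$ (ii) $\alpha$ has the tracial Rokhlin property if and only if there exists a telescope such that for every $n\in\mathbb{Z}_{>0}$, the infinite product satisfies $$\prod_{n\le i<\infty}\frac{1}{d_i}\chi_i=\chi .$$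
   Context: Product-type action: $A=\bigotimes_{i=1}^\infty \mathrm{B}(H_i)$ with each $H_i$ a finite dimensional Hilbert space, $\pi_i\colon G\to \mathrm{B}(H_i)$ unitary representations, and $\alpha=\bigotimes_{i=1}^\infty\alpha_i$, where $\alpha_i\colon g\mapsto \mathrm{Ad}(\pi_i(g))$. Telescope: a choice of integers $1=n_1<n_2<\cdots$ and the re-expression $A=\bigotimes_{i=1}^\infty \mathrm{B}(K_i)$ with $K_i=\bigotimes_{j=n_i}^{n_{i+1}-1}H_j$, with action $\bigotimes_{j=n_i}^{n_{i+1}-1}\alpha_j$ on $\mathrm{B}(K_i)$, implemented by the representation $\bigotimes_{j=n_i}^{n_{i+1}-1}\pi_j$ (whose dimension and character are the products of those of the factors). The character of $\pi_i$ is $\chi_i=\mathrm{Tr}\circ\pi_i$, $\mathrm{Tr}$ the unnormalized trace. The infinite product is the pointwise limit of the finite partial products. Blackadar comparison: for positive $a,b$ in a C*-algebra $A$, $\mathrm{Her}(a)=\overline{aAa}$. Write $a\sim_s b$ if there is $x\in A$ with $a=xx^*$ and $\mathrm{Her}(x^*x)=\mathrm{Her}(b)$; write $a\precapprox_s b$ if there is $a'\in\mathrm{Her}(b)$ with $a\sim_s a'$. Strict Rokhlin property: an action $\alpha$ of a finite group $G$ on an infinite dimensional unital C*-algebra $A$ has it if for every finite $F\subset A$ and $\varepsilon>0$ there are mutually orthogonal projections $e_g\in A$ ($g\in G$) with $\sum_g e_g=1$, $\|\alpha_g(e_h)-e_{gh}\|<\varepsilon$ for all $g,h\in G$, and $\|e_ga-ae_g\|<\varepsilon$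 for all $g\in G$, $a\in F$. Tracial Rokhlin property: an action $\alpha$ of a finite group $G$ on an infinite dimensional simple unital C*-algebra $A$ has it if for every finite $F\subset A$, $\varepsilon>0$ and positive $x\in A$ with $\|x\|=1$ there are mutually orthogonal projections $e_g\in A$ ($g\in G$) such that (1) $\|\alpha_g(e_h)-e_{gh}\|<\varepsilon$ for all $g,h$; (2) $\|e_ga-ae_g\|<\varepsilon$ for all $g\in G$, $a\in F$; (3) with $e=\sum_g e_g$, $1-e\precapprox_s x$; (4) $\|exe\|>1-\varepsilon$. *)

theory Defs
  imports
    "HOL-Analysis.Elementary_Normed_Spaces"
    "Jordan_Normal_Form.Schur_Decomposition"
    "HOL-Algebra.Group"
begin

section \<open>Unital C*-algebras\<close>

text \<open>
  A C*-algebra is a type: the whole type is the algebra.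
  The superclass \<open>real_normed_algebra_1\<close> requires \<open>norm 1 = 1\<close>, which in a unital C*-algebra
  just says that the algebra is nonzero.
\<close>

class unital_cstar_algebra = real_normed_algebra_1 + banach +
  fixes scaleC :: "complex \<Rightarrow> 'a \<Rightarrow> 'a" (infixr \<open>*\<^sub>C\<close> 75)
    and star :: "'a \<Rightarrow> 'a" (\<open>_\<^sup>\<star>\<close> [1000] 999)
  assumes scaleC_add_right: "c *\<^sub>C (a + b) = c *\<^sub>C a + c *\<^sub>C b"
    and scaleC_add_left: "(c + c') *\<^sub>C a = c *\<^sub>C a + c' *\<^sub>C a"
    and scaleC_scaleC: "c *\<^sub>C c' *\<^sub>C a = (c * c') *\<^sub>C a"
    and scaleR_scaleC: "r *\<^sub>R a = complex_of_real r *\<^sub>C a"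
    and mult_scaleC_left: "(c *\<^sub>C a) * b = c *\<^sub>C (a * b)"
    and mult_scaleC_right: "a * (c *\<^sub>C b) = c *\<^sub>C (a * b)"
    and norm_scaleC: "norm (c *\<^sub>C a) = cmod c * norm a"
    and star_star: "(a\<^sup>\<star>)\<^sup>\<star> = a"
    and star_add: "(a + b)\<^sup>\<star> = a\<^sup>\<star> + b\<^sup>\<star>"
    and star_scaleC: "(c *\<^sub>C a)\<^sup>\<star> = cnj c *\<^sub>C a\<^sup>\<star>"
    and star_mult: "(a * b)\<^sup>\<star> = b\<^sup>\<star> * a\<^sup>\<star>"
    and cstar_identity: "norm (a\<^sup>\<star> * a) = (norm a)\<^sup>2"

instantiation complex :: unital_cstar_algebra
begin

definition scaleC_complex :: "complex \<Rightarrow> complex \<Rightarrow> complex"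
  where "scaleC_complex c a = c * a"

definition star_complex :: "complex \<Rightarrow> complex"
  where "star_complex a = cnj a"

instance
  by standard
    (auto simp: scaleC_complex_def star_complex_def algebra_simps scaleR_conv_of_real
      norm_mult power2_eq_square)

end

definition infinite_dimensional :: "'a::unital_cstar_algebra itself \<Rightarrow> bool" where
  "infinite_dimensional _ \<longleftrightarrow> \<not> (\<exists>B::'a set. finite B \<and> Modules.module.span scaleC B = UNIV)"

definition projection :: "'a::unital_cstar_algebra \<Rightarrow> bool" where
  "projection p \<longleftrightarrow> p\<^sup>\<star> = p \<and> p * p = p"

definition cstar_positive :: "'a::unital_cstar_algebra \<Rightarrow> bool" where
  "cstar_positive a \<longleftrightarrow> (\<exists>y. a = y\<^sup>\<star> * y)"

definition star_automorphism :: "('a::unital_cstar_algebra \<Rightarrow> 'a) \<Rightarrow> bool" where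
  "star_automorphism f \<longleftrightarrow> bij f
     \<and> (\<forall>a b. f (a + b) = f a + f b) \<and> (\<forall>c a. f (c *\<^sub>C a) = c *\<^sub>C f a)
     \<and> (\<forall>a b. f (a * b) = f a * f b) \<and> (\<forall>a. f (a\<^sup>\<star>) = (f a)\<^sup>\<star>)"

definition cstar_action ::
  "('g, 'm) monoid_scheme \<Rightarrow> ('g \<Rightarrow> 'a::unital_cstar_algebra \<Rightarrow> 'a) \<Rightarrow> bool" where
  "cstar_action G \<alpha> \<longleftrightarrow>
     (\<forall>g\<in>carrier G. star_automorphism (\<alpha> g))
     \<and> (\<forall>g\<in>carrier G. \<forall>h\<in>carrier G. \<alpha> (g \<otimes>\<^bsub>G\<^esub> h) = \<alpha> g \<circ> \<alpha> h)"


section \<open>Blackadar comparison\<close>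

definition Her :: "'a::unital_cstar_algebra \<Rightarrow> 'a set" where
  "Her a = closure {a * y * a | y. True}"

definition blackadar_equiv ::
  "'a::unital_cstar_algebra \<Rightarrow> 'a \<Rightarrow> bool" (infix \<open>\<sim>\<^sub>s\<close> 50) where
  "a \<sim>\<^sub>s b \<longleftrightarrow> (\<exists>x. a = x * x\<^sup>\<star> \<and> Her (x\<^sup>\<star> * x) = Her b)"

text \<open>Since \<open>\<sim>\<^sub>s\<close> compares positive elements, the intermediate element is required to be positive.\<close>

definition blackadar_below ::
  "'a::unital_cstar_algebra \<Rightarrow> 'a \<Rightarrow> bool" (infix \<open>\<lesssim>\<^sub>s\<close> 50) where
  "a \<lesssim>\<^sub>s b \<longleftrightarrow> (\<exists>a'\<in>Her b. cstar_positive a' \<and> a \<sim>\<^sub>s a')"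


section \<open>Rokhlin properties\<close>

definition orthogonal_projections ::
  "'g set \<Rightarrow> ('g \<Rightarrow> 'a::unital_cstar_algebra) \<Rightarrow> bool" where
  "orthogonal_projections S e \<longleftrightarrow>
     (\<forall>g\<in>S. projection (e g)) \<and> (\<forall>g\<in>S. \<forall>h\<in>S. g \<noteq> h \<longrightarrow> e g * e h = 0)"

definition strict_Rokhlin ::
  "('g, 'm) monoid_scheme \<Rightarrow> ('g \<Rightarrow> 'a::unital_cstar_algebra \<Rightarrow> 'a) \<Rightarrow> bool" where
  "strict_Rokhlin G \<alpha> \<longleftrightarrow>
     (\<forall>F::'a set. \<forall>\<epsilon>::real. finite F \<and> \<epsilon> > 0 \<longrightarrow>
       (\<exists>e. orthogonal_projections (carrier G) e
          \<and> (\<Sum>g\<in>carrier G. e g) = 1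
          \<and> (\<forall>g\<in>carrier G. \<forall>h\<in>carrier G. norm (\<alpha> g (e h) - e (g \<otimes>\<^bsub>G\<^esub> h)) < \<epsilon>)
          \<and> (\<forall>g\<in>carrier G. \<forall>a\<in>F. norm (e g * a - a * e g) < \<epsilon>)))"

text \<open>To be used for infinite dimensional simple algebras only, like the UHF algebras below.\<close>

definition tracial_Rokhlin ::
  "('g, 'm) monoid_scheme \<Rightarrow> ('g \<Rightarrow> 'a::unital_cstar_algebra \<Rightarrow> 'a) \<Rightarrow> bool" where
  "tracial_Rokhlin G \<alpha> \<longleftrightarrow>
     (\<forall>F::'a set. \<forall>\<epsilon>::real. \<forall>x. finite F \<and> \<epsilon> > 0 \<and> cstar_positive x \<and> norm x = 1 \<longrightarrow>
       (\<exists>e. orthogonal_projections (carrier G) e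
          \<and> (\<forall>g\<in>carrier G. \<forall>h\<in>carrier G. norm (\<alpha> g (e h) - e (g \<otimes>\<^bsub>G\<^esub> h)) < \<epsilon>)
          \<and> (\<forall>g\<in>carrier G. \<forall>a\<in>F. norm (e g * a - a * e g) < \<epsilon>)
          \<and> 1 - (\<Sum>g\<in>carrier G. e g) \<lesssim>\<^sub>s x
          \<and> norm ((\<Sum>g\<in>carrier G. e g) * x * (\<Sum>g\<in>carrier G. e g)) > 1 - \<epsilon>))"


section \<open>Finite tensor products and unitary representations\<close>

text \<open>
  A Hilbert space of dimension \<open>k\<close> is identified with \<open>k\<close>-dimensional column space by an orthonormal
  basis, so that \<open>B(H)\<close> becomes the algebra of \<open>k \<times> k\<close> complex matrices. The tensor product of
  operators is then the Kronecker product, for the lexicographically ordered product basis.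
\<close>

definition mat_tensor :: "complex mat \<Rightarrow> complex mat \<Rightarrow> complex mat" where
  "mat_tensor A B = mat (dim_row A * dim_row B) (dim_col A * dim_col B)
     (\<lambda>(i, j). A $$ (i div dim_row B, j div dim_col B) * B $$ (i mod dim_row B, j mod dim_col B))"

text \<open>\<open>range_tensor f m n\<close> is the tensor product of \<open>f m, ..., f (n - 1)\<close>.\<close>

definition range_tensor :: "(nat \<Rightarrow> complex mat) \<Rightarrow> nat \<Rightarrow> nat \<Rightarrow> complex mat" where
  "range_tensor f m n = foldl mat_tensor (1\<^sub>m 1) (map f [m..<n])"

definition mat_trace :: "complex mat \<Rightarrow> complex" where
  "mat_trace A = (\<Sum>i<dim_row A. A $$ (i, i))"

definition unitary_rep ::
  "('g, 'm) monoid_scheme \<Rightarrow> nat \<Rightarrow> ('g \<Rightarrow> complex mat) \<Rightarrow> bool" where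
  "unitary_rep G k \<rho> \<longleftrightarrow>
     (\<forall>g\<in>carrier G. \<rho> g \<in> carrier_mat k k
        \<and> \<rho> g * mat_adjoint (\<rho> g) = 1\<^sub>m k \<and> mat_adjoint (\<rho> g) * \<rho> g = 1\<^sub>m k)
     \<and> (\<forall>g\<in>carrier G. \<forall>h\<in>carrier G. \<rho> (g \<otimes>\<^bsub>G\<^esub> h) = \<rho> g * \<rho> h)"

definition character :: "('g \<Rightarrow> complex mat) \<Rightarrow> 'g \<Rightarrow> complex" where
  "character \<rho> g = mat_trace (\<rho> g)"


section \<open>Infinite tensor products and product-type actions\<close>

definition mat_unital_star_hom ::
  "nat \<Rightarrow> (complex mat \<Rightarrow> 'a::unital_cstar_algebra) \<Rightarrow> bool" where
  "mat_unital_star_hom k f \<longleftrightarrow> f (1\<^sub>m k) = 1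
     \<and> (\<forall>x\<in>carrier_mat k k. \<forall>y\<in>carrier_mat k k. f (x + y) = f x + f y \<and> f (x * y) = f x * f y)
     \<and> (\<forall>x\<in>carrier_mat k k. f (mat_adjoint x) = (f x)\<^sup>\<star> \<and> (\<forall>c. f (c \<cdot>\<^sub>m x) = c *\<^sub>C f x))"

text \<open>
  The algebra is the C*-algebraic infinite tensor product of the \<open>B(H\<^sub>i)\<close> with \<open>dim H\<^sub>i = d i\<close>
  (indexed from 0), i.e. the direct limit of the finite tensor products
  \<open>B(H\<^sub>0) \<otimes> \<dots> \<otimes> B(H\<^sub>n\<^sub>-\<^sub>1)\<close> along \<open>x \<mapsto> x \<otimes> 1\<close>, with canonical maps \<open>\<phi> n\<close>. These maps are injective
  and isometric automatically, as unital *-homomorphisms from a full matrix algebra into a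
  nonzero C*-algebra.
\<close>

definition infinite_tensor_product ::
  "(nat \<Rightarrow> nat) \<Rightarrow> (nat \<Rightarrow> complex mat \<Rightarrow> 'a::unital_cstar_algebra) \<Rightarrow> bool" where
  "infinite_tensor_product d \<phi> \<longleftrightarrow>
     (\<forall>i. d i > 0)
     \<and> (\<forall>n. mat_unital_star_hom (\<Prod>i<n. d i) (\<phi> n))
     \<and> (\<forall>n. \<forall>x\<in>carrier_mat (\<Prod>i<n. d i) (\<Prod>i<n. d i).
           \<phi> (Suc n) (mat_tensor x (1\<^sub>m (d n))) = \<phi> n x)
     \<and> closure (\<Union>n. \<phi> n ` carrier_mat (\<Prod>i<n. d i) (\<Prod>i<n. d i)) = UNIV"

text \<open>
  \<open>\<alpha> g\<close> is the continuous extension of the maps \<open>Ad (\<pi> 0 g \<otimes> \<dots> \<otimes> \<pi> (n - 1) g)\<close> on the finite tensor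
  products.
\<close>

definition product_type_action ::
  "('g, 'm) monoid_scheme \<Rightarrow> (nat \<Rightarrow> nat) \<Rightarrow> (nat \<Rightarrow> complex mat \<Rightarrow> 'a::unital_cstar_algebra)
     \<Rightarrow> (nat \<Rightarrow> 'g \<Rightarrow> complex mat) \<Rightarrow> ('g \<Rightarrow> 'a \<Rightarrow> 'a) \<Rightarrow> bool" where
  "product_type_action G d \<phi> \<pi> \<alpha> \<longleftrightarrow>
     cstar_action G \<alpha>
     \<and> (\<forall>i. unitary_rep G (d i) (\<pi> i))
     \<and> (\<forall>g\<in>carrier G. continuous_on UNIV (\<alpha> g)
          \<and> (\<forall>n. \<forall>x\<in>carrier_mat (\<Prod>i<n. d i) (\<Prod>i<n. d i).
               \<alpha> g (\<phi> n x) =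
               \<phi> n (range_tensor (\<lambda>i. \<pi> i g) 0 n * x * mat_adjoint (range_tensor (\<lambda>i. \<pi> i g) 0 n))))"


section \<open>Telescopes\<close>

text \<open>
  With indices starting at 0, the breakpoints of a telescope are \<open>0 = \<nu> 0 < \<nu> 1 < \<dots>\<close>;
  its \<open>i\<close>-th Hilbert space is the tensor product of the \<open>H\<^sub>j\<close> with \<open>\<nu> i \<le> j < \<nu> (i + 1)\<close>.
\<close>

definition telescope :: "(nat \<Rightarrow> nat) \<Rightarrow> bool" where
  "telescope \<nu> \<longleftrightarrow> \<nu> 0 = 0 \<and> strict_mono \<nu>"

definition telescope_dim :: "(nat \<Rightarrow> nat) \<Rightarrow> (nat \<Rightarrow> nat) \<Rightarrow> nat \<Rightarrow> nat" where
  "telescope_dim \<nu> d i = (\<Prod>j\<in>{\<nu> i..<\<nu> (Suc i)}. d j)"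

definition telescope_rep ::
  "(nat \<Rightarrow> nat) \<Rightarrow> (nat \<Rightarrow> 'g \<Rightarrow> complex mat) \<Rightarrow> nat \<Rightarrow> 'g \<Rightarrow> complex mat" where
  "telescope_rep \<nu> \<pi> i g = range_tensor (\<lambda>j. \<pi> j g) (\<nu> i) (\<nu> (Suc i))"

end

theory Submission
  imports Defs "HOL-Computational_Algebra.Formal_Power_Series" "Jordan_Normal_Form.Spectral_Radius"
begin

text \<open>
  Both equivalences rest on the behaviour of the unitary \<open>V\<close> that implements a group
  element \<open>g\<close> on the tensor factors from \<open>m\<close> to \<open>n - 1\<close>. For
  the unique trace of the algebra, constructed as \<open>\<tau>\<close>, the trace of
  \<open>V\<close> is the normalized character \<open>chi m n g\<close>, the product of the
  normalized characters of these factors.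

  From projections to characters. If Rokhlin projections \<open>e h\<close> nearly commute with the
  first \<open>m\<close> factors, then \<open>V\<close> nearly permutes them without fixed points,
  so the parts \<open>e h * V * e h\<close> of its trace are small for \<open>g \<noteq> 1\<close>.
  In the tracial case the complement of \<open>\<Sum>h. e h\<close> is subequivalent to a projection
  of small trace and contributes little as well; this is tracial_Rokhlin_imp_chi_small. In the
  strict case the trace of \<open>V\<close> is even exactly 0 (strict_Rokhlin_imp_character_eq_0):
  averaging over the first \<open>m\<close> factors moves the projections into the later ones, and a
  perturbation makes them exact translates of one projection, which are nearly orthogonal and have
  nearly the sum 1. Their ranges then decompose the representation space into a direct sum permuted
  by the group (character_eq_0_if_near_tower).

  From characters to projections. A representation of dimension \<open>k\<close> whose character is
  small away from the unit element contains the regular representation with nearly the largest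
  multiplicity \<open>k / card G\<close>, and with exactly this multiplicity if the character
  vanishes there. This is shown without classifying representations: a maximal equivariant partial
  isometry from a multiple of the regular representation leaves over two representations with
  orthogonal characters (maximal_partial_intertwiner), and smallness of the characters forces its
  initial complement to be zero (equivariant_projections_exist). The copies of the regular
  representation yield projections that are permuted by the group and commute with all earlier
  factors. In the strict case their sum is 1. In the tracial case the remainder has small trace, and
  it must be compared with a given positive element \<open>x\<close> of norm 1: a matrix close to
  \<open>x\<close> has an eigenprojection \<open>f\<close> with an eigenvalue close to 1 in absolute
  value, the remainder is equivalent to a subprojection of \<open>f\<close> in a large matrix
  algebra, and \<open>f\<close> is equivalent to a projection in \<open>Her x\<close>
  (partial_isometry_into_Her).
\<close>

section \<open>Elementary facts on C*-algebras\<close>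

lemma scaleC_zero_left [simp]: "0 *\<^sub>C (a::'a::unital_cstar_algebra) = 0"
  using scaleC_add_left[of 0 0 a] by simp

lemma scaleC_zero_right [simp]: "c *\<^sub>C (0::'a::unital_cstar_algebra) = 0"
  using scaleC_add_right[of c 0 0] by simp

lemma scaleC_one [simp]: "1 *\<^sub>C (a::'a::unital_cstar_algebra) = a"
  using scaleR_scaleC[of 1 a] by simp

lemma scaleC_minus_left: "(- c) *\<^sub>C (a::'a::unital_cstar_algebra) = - (c *\<^sub>C a)"
  using scaleC_add_left[of "- c" c a] by (simp add: eq_neg_iff_add_eq_0)

lemma scaleC_minus_right: "c *\<^sub>C (- (a::'a::unital_cstar_algebra)) = - (c *\<^sub>C a)"
  using scaleC_add_right[of c "- a" a] by (simp add: eq_neg_iff_add_eq_0)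

lemma scaleC_diff_left: "(c - c') *\<^sub>C (a::'a::unital_cstar_algebra) = c *\<^sub>C a - c' *\<^sub>C a"
  using scaleC_add_left[of c "- c'" a] by (simp add: scaleC_minus_left)

lemma scaleC_diff_right: "c *\<^sub>C ((a::'a::unital_cstar_algebra) - b) = c *\<^sub>C a - c *\<^sub>C b"
  using scaleC_add_right[of c a "- b"] by (simp add: scaleC_minus_right)

lemma star_zero [simp]: "(0::'a::unital_cstar_algebra)\<^sup>\<star> = 0"
  using star_add[of "0::'a" 0] by simp

lemma star_minus: "(- (a::'a::unital_cstar_algebra))\<^sup>\<star> = - a\<^sup>\<star>"
  using star_add[of "- a" a] by (simp add: eq_neg_iff_add_eq_0)

lemma star_diff: "((a::'a::unital_cstar_algebra) - b)\<^sup>\<star> = a\<^sup>\<star> - b\<^sup>\<star>"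
  using star_add[of a "- b"] by (simp add: star_minus)

lemma star_one [simp]: "(1::'a::unital_cstar_algebra)\<^sup>\<star> = 1"
  using star_mult[of "1\<^sup>\<star>" "1::'a"] by (simp add: star_star)

lemma star_sum: "(\<Sum>i\<in>S. f i :: 'a::unital_cstar_algebra)\<^sup>\<star> = (\<Sum>i\<in>S. (f i)\<^sup>\<star>)"
  by (induction S rule: infinite_finite_induct) (auto simp: star_add)

lemma star_power: "((a::'a::unital_cstar_algebra) ^ n)\<^sup>\<star> = (a\<^sup>\<star>) ^ n"
  by (induction n) (auto simp: star_mult power_commutes)

lemma norm_star [simp]: "norm ((a::'a::unital_cstar_algebra)\<^sup>\<star>) = norm a"
proof -
  have *: "norm (a::'a) \<le> norm (a\<^sup>\<star>)" for a
  proof (cases "a = 0")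
    case False
    have "norm a * norm a \<le> norm (a\<^sup>\<star>) * norm a"
      using norm_mult_ineq[of "a\<^sup>\<star>" a] by (simp add: cstar_identity power2_eq_square)
    with False show ?thesis by simp
  qed simp
  from *[of a] *[of "a\<^sup>\<star>"] show ?thesis by (simp add: star_star)
qed

lemma norm_mult_star: "norm ((a::'a::unital_cstar_algebra) * a\<^sup>\<star>) = (norm a)\<^sup>2"
  using cstar_identity[of "a\<^sup>\<star>"] by (simp add: star_star)

lemma norm_le_1_if_isometry:
  assumes "(u::'a::unital_cstar_algebra)\<^sup>\<star> * u = 1"
  shows "norm u \<le> 1"
  using cstar_identity[of u] assms abs_square_eq_1[of "norm u"] by simp

lemma projection_star: "projection p \<Longrightarrow> p\<^sup>\<star> = p"
  and projection_mult: "projection p \<Longrightarrow> p * p = p"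
  by (auto simp: projection_def)

lemma projection_mult2: "projection p \<Longrightarrow> p * (p * a) = p * (a :: 'a::unital_cstar_algebra)"
  by (simp add: projection_mult flip: mult.assoc)

lemma norm_projection:
  assumes "projection (p::'a::unital_cstar_algebra)" "p \<noteq> 0"
  shows "norm p = 1"
  using cstar_identity[of p] assms by (simp add: projection_def power2_eq_square)

lemma norm_projection_le: "projection (p::'a::unital_cstar_algebra) \<Longrightarrow> norm p \<le> 1"
  by (cases "p = 0") (auto simp: norm_projection)

lemma norm_mult_le_left: "norm (u::'a::real_normed_algebra) \<le> 1 \<Longrightarrow> norm (u * a) \<le> norm a"
  and norm_mult_le_right: "norm u \<le> 1 \<Longrightarrow> norm (a * u) \<le> norm a"
  using norm_mult_ineq[of u a] norm_mult_ineq[of a u]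
    mult_left_le_one_le[of "norm a" "norm u"] mult_right_le_one_le[of "norm a" "norm u"]
  by (auto intro: order_trans)

lemma projection_sum:
  assumes "orthogonal_projections S e" "finite S"
  shows "projection (\<Sum>g\<in>S. e g)"
proof -
  have "(\<Sum>g\<in>S. e g) * (\<Sum>g\<in>S. e g) = (\<Sum>g\<in>S. \<Sum>h\<in>S. if h = g then e g else 0)"
    unfolding sum_product using assms
    by (intro sum.cong) (auto simp: orthogonal_projections_def projection_def)
  also have "\<dots> = (\<Sum>g\<in>S. e g)" using assms(2) by simp
  moreover have "(\<Sum>g\<in>S. e g)\<^sup>\<star> = (\<Sum>g\<in>S. e g)"
    unfolding star_sum using assms by (intro sum.cong) (auto simp: orthogonal_projections_def projection_def)
  ultimately show ?thesis by (simp add: projection_def)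
qed

lemma projection_one_minus: "projection p \<Longrightarrow> projection (1 - p)"
  by (auto simp: projection_def star_diff algebra_simps)

text \<open>
  The norm of a combination of orthogonal projections is found from high powers: for
  \<open>x = \<Sum> c\<^sub>i e\<^sub>i\<close> the C*-identity gives
  \<open>norm x ^ (2 ^ Suc n) = norm (\<Sum> \<bar>c\<^sub>i\<bar> ^ (2 ^ Suc n) e\<^sub>i) \<le> card S * C ^ (2 ^ Suc n)\<close>, and the factor
  \<open>card S\<close> disappears in the limit.
\<close>
lemma norm_sum_orthogonal_projections_le:
  fixes e :: "'i \<Rightarrow> 'a::unital_cstar_algebra"
  assumes e: "orthogonal_projections S e" and fin: "finite S"
    and c: "\<And>i. i \<in> S \<Longrightarrow> cmod (c i) \<le> C" and "0 \<le> C"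
  shows "norm (\<Sum>i\<in>S. c i *\<^sub>C e i) \<le> C"
proof -
  have mult: "(\<Sum>i\<in>S. a i *\<^sub>C e i) * (\<Sum>i\<in>S. b i *\<^sub>C e i) = (\<Sum>i\<in>S. (a i * b i) *\<^sub>C e i)" for a b
  proof -
    have "(\<Sum>i\<in>S. a i *\<^sub>C e i) * (\<Sum>i\<in>S. b i *\<^sub>C e i)
        = (\<Sum>i\<in>S. \<Sum>j\<in>S. if j = i then (a i * b i) *\<^sub>C e i else 0)"
      unfolding sum_product using e
      by (intro sum.cong)
        (auto simp: orthogonal_projections_def projection_def mult_scaleC_left mult_scaleC_right scaleC_scaleC
          mult.commute)
    then show ?thesis using fin by simp
  qed
  have star: "(\<Sum>i\<in>S. a i *\<^sub>C e i)\<^sup>\<star> = (\<Sum>i\<in>S. cnj (a i) *\<^sub>C e i)" for a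
    unfolding star_sum using e
    by (intro sum.cong) (auto simp: orthogonal_projections_def projection_def star_scaleC)
  define x where "x = (\<Sum>i\<in>S. c i *\<^sub>C e i)"
  have pow: "norm x ^ (2 ^ Suc n) = norm (\<Sum>i\<in>S. complex_of_real (cmod (c i) ^ (2 ^ Suc n)) *\<^sub>C e i)" for n
  proof (induction n)
    case 0
    have "norm x ^ 2 = norm (x\<^sup>\<star> * x)" by (simp add: cstar_identity)
    also have "x\<^sup>\<star> * x = (\<Sum>i\<in>S. complex_of_real (cmod (c i) ^ 2) *\<^sub>C e i)"
      unfolding x_def star mult by (intro sum.cong refl arg_cong2[of _ _ _ _ scaleC]) (metis complex_norm_square mult.commute of_real_power)
    finally show ?case by simp
  next
    case (Suc n)
    let ?y = "\<Sum>i\<in>S. complex_of_real (cmod (c i) ^ (2 ^ Suc n)) *\<^sub>C e i"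
    have "norm x ^ (2 ^ Suc (Suc n)) = (norm ?y)\<^sup>2"
      unfolding Suc[symmetric] by (simp flip: power_mult add: mult.commute)
    also have "\<dots> = norm (?y\<^sup>\<star> * ?y)" by (simp add: cstar_identity)
    also have "?y\<^sup>\<star> * ?y = (\<Sum>i\<in>S. complex_of_real (cmod (c i) ^ (2 ^ Suc (Suc n))) *\<^sub>C e i)"
      unfolding star mult by (intro sum.cong) (auto simp flip: power_add of_real_mult simp: mult_2)
    finally show ?case .
  qed
  have bound: "norm x ^ (2 ^ Suc n) \<le> card S * C ^ (2 ^ Suc n)" for n
  proof -
    have "norm x ^ (2 ^ Suc n) \<le> (\<Sum>i\<in>S. C ^ (2 ^ Suc n))"
      unfolding pow
    proof (rule sum_norm_le)
      fix i assume i: "i \<in> S"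
      have "norm (complex_of_real (cmod (c i) ^ (2 ^ Suc n)) *\<^sub>C e i) = cmod (c i) ^ (2 ^ Suc n) * norm (e i)"
        by (simp add: norm_scaleC norm_power)
      also have "\<dots> \<le> C ^ (2 ^ Suc n) * 1"
        using i c e by (intro mult_mono power_mono norm_projection_le) (auto simp: orthogonal_projections_def \<open>0 \<le> C\<close>)
      finally show "norm (complex_of_real (cmod (c i) ^ (2 ^ Suc n)) *\<^sub>C e i) \<le> C ^ (2 ^ Suc n)" by simp
    qed
    then show ?thesis by simp
  qed
  have "norm x \<le> C"
  proof (rule ccontr)
    assume "\<not> norm x \<le> C"
    then have less: "C < norm x" by simp
    show False
    proof (cases "C = 0")
      case True
      with bound[of 0] less show False by simp
    next
      case False
      with \<open>0 \<le> C\<close> have "0 < C" by simp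
      define q where "q = norm x / C"
      have q: "q > 1" using less \<open>0 < C\<close> by (simp add: q_def)
      have le: "q ^ (2 ^ Suc n) \<le> card S" for n
        using bound[of n] \<open>0 < C\<close> by (simp add: q_def power_divide divide_le_eq)
      obtain n where "q ^ n > card S" using real_arch_pow[OF q, of "real (card S)"] by auto
      moreover have "n \<le> 2 ^ Suc n" using less_exp[of "Suc n"] by simp
      ultimately show False
        using le[of n] power_increasing[of n "2 ^ Suc n" q] q by linarith
    qed
  qed
  then show ?thesis by (simp add: x_def)
qed

lemma norm_binomial_half_le: "\<bar>(- 1) ^ n * ((- 1 / 2 :: real) gchoose n)\<bar> \<le> 1"
proof (induction n)
  case (Suc n)
  have eq: "((- 1 / 2 :: real) gchoose Suc n) = ((- 1 / 2) gchoose n) * ((- 1 / 2 - n) / Suc n)"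
    using gbinomial_mult_1[of "- 1 / 2 :: real" n] by (simp add: field_simps)
  have "\<bar>(- 1 / 2 - real n) / Suc n\<bar> \<le> 1" by (simp add: field_simps abs_if)
  moreover have "\<bar>(- 1 / 2 :: real) gchoose n\<bar> \<le> 1" using Suc by (simp add: abs_mult)
  ultimately have "\<bar>(- 1 / 2 :: real) gchoose Suc n\<bar> \<le> 1"
    unfolding eq abs_mult by (intro mult_le_one) auto
  then show ?case by (simp add: abs_mult)
qed simp

text \<open>
  The inverse square root of \<open>1 - t\<close> is the binomial series
  \<open>\<Sum> (-1)\<^sup>n (-1/2 gchoose n) t\<^sup>n\<close>; that its square is the geometric series is the Vandermonde
  identity for the exponents \<open>- 1/2 - 1/2 = - 1\<close>.
\<close>
lemma inverse_sqrt_exists: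
  fixes t :: "'a::unital_cstar_algebra"
  assumes t: "norm t < 1" and self_adjoint: "t\<^sup>\<star> = t"
  obtains b where "b\<^sup>\<star> = b" "b * b * (1 - t) = 1" "\<And>z. z * t = t * z \<Longrightarrow> z * b = b * z"
proof -
  define a :: "nat \<Rightarrow> real" where "a n = (- 1) ^ n * ((- 1 / 2) gchoose n)" for n
  have a: "\<bar>a n\<bar> \<le> 1" for n unfolding a_def by (rule norm_binomial_half_le)
  have conv: "(\<Sum>i\<le>n. a i * a (n - i)) = 1" for n
  proof -
    have "(\<Sum>i\<le>n. a i * a (n - i)) = (\<Sum>i\<le>n. (- 1) ^ n * (((- 1 / 2) gchoose i) * ((- 1 / 2) gchoose (n - i))))"
      by (intro sum.cong) (auto simp: a_def power_add[symmetric] algebra_simps)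
    also have "\<dots> = (- 1) ^ n * ((- 1 / 2 + - 1 / 2) gchoose n)"
      unfolding sum_distrib_left[symmetric] by (simp add: gbinomial_Vandermonde atLeast0AtMost[symmetric])
    also have "((- 1 / 2 + - 1 / 2 :: real) gchoose n) = (- 1) ^ n"
      using gbinomial_minus[of "1::real" n] by (simp add: gbinomial_of_nat_symmetric flip: binomial_gbinomial)
    finally show ?thesis by (simp flip: power_add mult_2)
  qed
  define f where "f n = a n *\<^sub>R t ^ n" for n
  have sn: "summable (\<lambda>n. norm (f n))"
  proof (rule summable_comparison_test')
    show "summable (\<lambda>n. norm t ^ n)" using t by (simp add: summable_geometric)
    show "norm (norm (f n)) \<le> norm t ^ n" for n
      unfolding f_def using a[of n] norm_power_ineq[of t n] mult_mono[of "\<bar>a n\<bar>" 1 "norm (t ^ n)" "norm t ^ n"]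
      by simp
  qed
  then have sf: "summable f" by (rule summable_norm_cancel)
  define b where "b = (\<Sum>n. f n)"
  have bs: "f sums b" using sf by (simp add: b_def summable_sums)
  have "b * b = (\<Sum>k. \<Sum>i\<le>k. f i * f (k - i))"
    unfolding b_def by (rule Cauchy_product[OF sn sn])
  also have "(\<lambda>k. \<Sum>i\<le>k. f i * f (k - i)) = (\<lambda>k. t ^ k)"
  proof
    fix k
    have "(\<Sum>i\<le>k. f i * f (k - i)) = (\<Sum>i\<le>k. (a i * a (k - i)) *\<^sub>R t ^ k)"
      by (intro sum.cong) (auto simp: f_def power_add[symmetric])
    also have "\<dots> = t ^ k" by (simp flip: scaleR_left.sum add: conv)
    finally show "(\<Sum>i\<le>k. f i * f (k - i)) = t ^ k" .
  qed
  finally have bb: "b * b = (\<Sum>k. t ^ k)" .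
  have sg: "summable (\<lambda>k. t ^ k)"
    by (rule summable_norm_cancel, rule summable_comparison_test'[OF summable_geometric, of "norm t"])
      (use t in \<open>auto simp: norm_power_ineq\<close>)
  have "(\<Sum>k. t ^ k) * t = (\<Sum>k. t ^ Suc k)"
    using suminf_mult2[OF sg, of t] by (simp add: power_commutes)
  also have "\<dots> = (\<Sum>k. t ^ k) - 1" using suminf_split_head[OF sg] by simp
  finally have "b * b * (1 - t) = 1" unfolding bb by (simp add: algebra_simps)
  moreover have "b\<^sup>\<star> = b"
  proof -
    have bl: "bounded_linear (star :: 'a \<Rightarrow> 'a)"
      by (rule bounded_linear_intro[where K = 1]) (auto simp: star_add scaleR_scaleC star_scaleC)
    have "(\<lambda>n. star (f n)) sums star b" by (rule bounded_linear.sums[OF bl bs])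
    moreover have "star (f n) = f n" for n
      by (simp add: f_def scaleR_scaleC star_scaleC star_power self_adjoint)
    ultimately show ?thesis using bs by (simp add: sums_unique2)
  qed
  moreover have "z * b = b * z" if z: "z * t = t * z" for z
  proof -
    have zt: "z * t ^ n = t ^ n * z" for n
    proof (induction n)
      case (Suc n)
      have "z * t ^ Suc n = (z * t) * t ^ n" by (simp add: mult.assoc)
      also have "\<dots> = t * (z * t ^ n)" by (simp add: z mult.assoc)
      also have "\<dots> = t ^ Suc n * z" by (simp add: Suc mult.assoc)
      finally show ?case .
    qed simp
    have "(\<lambda>n. z * f n) sums (z * b)" "(\<lambda>n. f n * z) sums (b * z)"
      using bs by (auto intro: sums_mult sums_mult2)
    moreover have "z * f n = f n * z" for n by (simp add: f_def zt)
    ultimately show ?thesis by (simp add: sums_unique2)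
  qed
  ultimately show ?thesis using that by blast
qed

section \<open>Matrix algebra\<close>

lemma mat_adjoint_dim [simp]:
  "dim_row (mat_adjoint A) = dim_col A" "dim_col (mat_adjoint A) = dim_row A"
  by (simp_all add: mat_adjoint_def)

lemma mat_adjoint_index [simp]:
  "i < dim_col A \<Longrightarrow> j < dim_row A \<Longrightarrow> mat_adjoint A $$ (i, j) = cnj (A $$ (j, i))"
  by (simp add: mat_adjoint_def mat_of_rows_def)

lemma mat_mult_index:
  "i < dim_row A \<Longrightarrow> j < dim_col B \<Longrightarrow> dim_col A = dim_row B \<Longrightarrow>
    (A * B) $$ (i, j) = (\<Sum>l<dim_row B. A $$ (i, l) * B $$ (l, j))"
  by (simp add: scalar_prod_def atLeast0LessThan)

text \<open>
  The laws of matrix algebra, with hypotheses on dimensions that the simplifier can decide for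
  products of rectangular matrices of known size.
\<close>

lemma mat_assoc:
  "dim_col A = dim_row B \<Longrightarrow> dim_col B = dim_row C \<Longrightarrow> (A * B) * C = A * (B * (C :: 'a::semiring_0 mat))"
  by (rule assoc_mult_mat[of _ "dim_row A" "dim_row B" _ "dim_row C" _ "dim_col C"]) auto

lemma mat_distribs:
  fixes A B C :: "complex mat"
  shows "dim_col A = dim_row B \<Longrightarrow> dim_row B = dim_row C \<Longrightarrow> dim_col B = dim_col C \<Longrightarrow> A * (B + C) = A * B + A * C"
    and "dim_col A = dim_row B \<Longrightarrow> dim_row B = dim_row C \<Longrightarrow> dim_col B = dim_col C \<Longrightarrow> A * (B - C) = A * B - A * C"
    and "dim_col A = dim_row C \<Longrightarrow> dim_row A = dim_row B \<Longrightarrow> dim_col A = dim_col B \<Longrightarrow> (A + B) * C = A * C + B * C"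
    and "dim_col A = dim_row C \<Longrightarrow> dim_row A = dim_row B \<Longrightarrow> dim_col A = dim_col B \<Longrightarrow> (A - B) * C = A * C - B * C"
    and "dim_col A = dim_row B \<Longrightarrow> (c \<cdot>\<^sub>m A) * B = c \<cdot>\<^sub>m (A * B)"
    and "dim_col A = dim_row B \<Longrightarrow> A * (c \<cdot>\<^sub>m B) = c \<cdot>\<^sub>m (A * B)"
  by (auto intro!: eq_matI simp: mat_mult_index sum.distrib sum_subtractf algebra_simps sum_distrib_left
      simp del: index_mult_mat(1))

lemma mat_one_mult [simp]:
  fixes A :: "complex mat"
  shows "dim_row A = n \<Longrightarrow> 1\<^sub>m n * A = A" "dim_col A = n \<Longrightarrow> A * 1\<^sub>m n = A"
  by auto

lemma mat_zero_mult [simp]: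
  fixes A :: "complex mat"
  shows "dim_row A = m \<Longrightarrow> 0\<^sub>m n m * A = 0\<^sub>m n (dim_col A)" "dim_col A = n \<Longrightarrow> A * 0\<^sub>m n m = 0\<^sub>m (dim_row A) m"
  by auto

lemma mat_zero_add [simp]:
  fixes A :: "complex mat"
  shows "dim_row A = n \<Longrightarrow> dim_col A = m \<Longrightarrow> 0\<^sub>m n m + A = A" "dim_row A = n \<Longrightarrow> dim_col A = m \<Longrightarrow> A + 0\<^sub>m n m = A"
    "dim_row A = n \<Longrightarrow> dim_col A = m \<Longrightarrow> A - 0\<^sub>m n m = A"
  by auto

lemma mat_diff_self [simp]: "A - A = 0\<^sub>m (dim_row A) (dim_col (A :: complex mat))"
  by auto

lemma mat_adjoint_adjoint [simp]: "mat_adjoint (mat_adjoint A) = (A :: complex mat)"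
  by auto

lemma mat_adjoint_mult:
  "dim_col A = dim_row B \<Longrightarrow> mat_adjoint (A * B) = mat_adjoint B * mat_adjoint (A :: complex mat)"
  by (rule eq_matI) (auto simp: mat_mult_index mult.commute simp del: index_mult_mat(1))

lemma mat_adjoint_simps [simp]:
  fixes A B :: "complex mat"
  shows "mat_adjoint (1\<^sub>m n :: complex mat) = 1\<^sub>m n" "mat_adjoint (0\<^sub>m n m :: complex mat) = 0\<^sub>m m n"
    "mat_adjoint (c \<cdot>\<^sub>m A) = cnj c \<cdot>\<^sub>m mat_adjoint A"
    "dim_row A = dim_row B \<Longrightarrow> dim_col A = dim_col B \<Longrightarrow> mat_adjoint (A + B) = mat_adjoint A + mat_adjoint B"
    "dim_row A = dim_row B \<Longrightarrow> dim_col A = dim_col B \<Longrightarrow> mat_adjoint (A - B) = mat_adjoint A - mat_adjoint B"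
  by (rule eq_matI; auto)+

lemma mat_trace_simps [simp]:
  fixes A B :: "complex mat"
  shows "dim_row A = dim_row B \<Longrightarrow> dim_col B = dim_row B \<Longrightarrow> mat_trace (A + B) = mat_trace A + mat_trace B"
    "dim_row A = dim_row B \<Longrightarrow> dim_col B = dim_row B \<Longrightarrow> mat_trace (A - B) = mat_trace A - mat_trace B"
    "dim_col A = dim_row A \<Longrightarrow> mat_trace (c \<cdot>\<^sub>m A) = c * mat_trace A"
    "dim_col A = dim_row A \<Longrightarrow> mat_trace (mat_adjoint A) = cnj (mat_trace A)"
    "mat_trace (1\<^sub>m n) = of_nat n" "mat_trace (0\<^sub>m n n) = 0"
  by (auto simp: mat_trace_def sum.distrib sum_subtractf sum_distrib_left)

lemma mat_trace_commute:
  assumes "dim_col A = dim_row B" "dim_col B = dim_row A"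
  shows "mat_trace (A * B) = mat_trace (B * A)"
proof -
  have "mat_trace (A * B) = (\<Sum>i<dim_row A. \<Sum>j<dim_row B. A $$ (i, j) * B $$ (j, i))"
    using assms by (simp add: mat_trace_def mat_mult_index del: index_mult_mat(1))
  also have "\<dots> = (\<Sum>j<dim_row B. \<Sum>i<dim_row A. B $$ (j, i) * A $$ (i, j))"
    by (subst sum.swap) (simp add: mult.commute)
  also have "\<dots> = mat_trace (B * A)"
    using assms by (simp add: mat_trace_def mat_mult_index del: index_mult_mat(1))
  finally show ?thesis .
qed

lemma mat_trace_adjoint_mult:
  "mat_trace (mat_adjoint A * A) = complex_of_real (\<Sum>i<dim_col A. \<Sum>j<dim_row A. (cmod (A $$ (j, i)))\<^sup>2)"
  unfolding mat_trace_def of_real_sum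
  by (auto simp: mat_mult_index mult.commute[of "cnj _"] complex_norm_square[symmetric]
      simp del: index_mult_mat(1) intro!: sum.cong)

lemma mat_trace_adjoint_mult_nonneg:
  "0 \<le> Re (mat_trace (mat_adjoint A * A))" "Im (mat_trace (mat_adjoint A * A)) = 0"
  unfolding mat_trace_adjoint_mult by (auto intro!: sum_nonneg)

lemma mat_trace_adjoint_mult_eq_0:
  assumes "mat_trace (mat_adjoint A * A) = 0"
  shows "A = 0\<^sub>m (dim_row A) (dim_col A)"
proof -
  have "(\<Sum>i<dim_col A. \<Sum>j<dim_row A. (cmod (A $$ (j, i)))\<^sup>2) = 0"
    using assms unfolding mat_trace_adjoint_mult by (simp only: of_real_eq_0_iff)
  then have "\<forall>i<dim_col A. \<forall>j<dim_row A. A $$ (j, i) = 0"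
    by (simp add: sum_nonneg_eq_0_iff sum_nonneg)
  then show ?thesis by (intro eq_matI) auto
qed

lemma mat_adjoint_mult_eq_0:
  fixes A :: "complex mat"
  assumes "mat_adjoint A * A = 0\<^sub>m (dim_col A) (dim_col A)"
  shows "A = 0\<^sub>m (dim_row A) (dim_col A)"
  by (rule mat_trace_adjoint_mult_eq_0) (simp add: assms)

definition mat_projection :: "nat \<Rightarrow> complex mat \<Rightarrow> bool" where
  "mat_projection n P \<longleftrightarrow> P \<in> carrier_mat n n \<and> mat_adjoint P = P \<and> P * P = P"

lemma mat_projectionD:
  assumes "mat_projection n P"
  shows "P \<in> carrier_mat n n" "dim_row P = n" "dim_col P = n" "mat_adjoint P = P" "P * P = P"
    "dim_row B = n \<Longrightarrow> P * (P * B) = P * B"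
  using assms by (auto simp: mat_projection_def simp flip: mat_assoc)

lemma mat_projection_one_minus: "mat_projection n P \<Longrightarrow> mat_projection n (1\<^sub>m n - P)"
  by (auto simp: mat_projection_def mat_distribs)

lemma mat_projection_one [simp]: "mat_projection n (1\<^sub>m n)" "mat_projection n (0\<^sub>m n n)"
  by (auto simp: mat_projection_def)

lemma mat_projection_trace_nonneg:
  "mat_projection n P \<Longrightarrow> 0 \<le> Re (mat_trace P)" "mat_projection n P \<Longrightarrow> Im (mat_trace P) = 0"
  using mat_trace_adjoint_mult_nonneg[of P] by (auto simp: mat_projection_def)

lemma mat_projection_trace_eq_0:
  "mat_projection n P \<Longrightarrow> mat_trace P = 0 \<Longrightarrow> P = 0\<^sub>m n n"
  using mat_trace_adjoint_mult_eq_0[of P] by (auto simp: mat_projection_def)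

text \<open>
  For unitary \<open>v\<close> and a projection \<open>P\<close>, this is Cauchy-Schwarz; it is read off from the
  positivity of the trace of \<open>x\<^sup>* x\<close> for \<open>x = v P - c P\<close> with \<open>c\<close> the phase of the trace.
\<close>
lemma norm_mat_trace_unitary_projection_le:
  assumes P: "mat_projection n P" and v: "v \<in> carrier_mat n n" "mat_adjoint v * v = 1\<^sub>m n"
  shows "cmod (mat_trace (v * P)) \<le> Re (mat_trace P)"
proof -
  note [simp] = mat_projectionD[OF P] carrier_matD[OF v(1)] v(2)
  define z where "z = mat_trace (v * P)"
  obtain c where c: "cmod c = 1" "cnj c * z = complex_of_real (cmod z)"
  proof (cases "z = 0")
    case True then show ?thesis using that[of 1] by simp
  next
    case False
    have "cnj (sgn z) * z = complex_of_real (cmod z)"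
      using False by (simp add: sgn_div_norm scaleR_conv_of_real mult.assoc mult.commute[of "cnj z"]
          complex_norm_square[symmetric] power2_eq_square)
    then show ?thesis using that[of "sgn z"] False by (simp add: norm_sgn)
  qed
  let ?x = "v * P - c \<cdot>\<^sub>m P"
  have cc: "c * cnj c = 1" using c(1) by (simp add: complex_norm_square[symmetric])
  have vv: "mat_adjoint v * (v * P) = P" by (simp flip: mat_assoc)
  have "mat_adjoint ?x * ?x = P * (mat_adjoint v * (v * P)) - c \<cdot>\<^sub>m (P * (mat_adjoint v * P))
     - (cnj c \<cdot>\<^sub>m (P * (v * P)) - (cnj c * c) \<cdot>\<^sub>m (P * P))"
    by (simp add: mat_adjoint_mult mat_distribs mat_assoc, intro eq_matI) (auto simp: algebra_simps)
  moreover have "mat_trace (P * (v * P)) = z"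
    using mat_trace_commute[of "P" "v * P"] by (simp add: mat_assoc z_def)
  moreover have "mat_trace (P * (mat_adjoint v * P)) = cnj z"
  proof -
    have "mat_trace (P * (mat_adjoint v * P)) = mat_trace (mat_adjoint (P * (v * P)))"
      by (simp add: mat_adjoint_mult mat_assoc)
    also have "\<dots> = cnj (mat_trace (P * (v * P)))" by simp
    also have "mat_trace (P * (v * P)) = z" by fact
    finally show ?thesis .
  qed
  ultimately have "mat_trace (mat_adjoint ?x * ?x) = mat_trace P - c * cnj z - (cnj c * z - c * cnj c * mat_trace P)"
    by (simp add: vv mult.commute)
  moreover have "c * cnj z = complex_of_real (cmod z)"
    using arg_cong[OF c(2), of cnj] by simp
  ultimately have "mat_trace (mat_adjoint ?x * ?x) = 2 * mat_trace P - 2 * complex_of_real (cmod z)"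
    using c(2) cc by (simp add: algebra_simps)
  with mat_trace_adjoint_mult_nonneg(1)[of ?x] show ?thesis by (simp add: z_def)
qed

subsection \<open>Sums of matrices\<close>

text \<open>The type of matrices of all sizes has no zero, so a sum of matrices carries its dimensions.\<close>
definition mat_sum :: "nat \<Rightarrow> nat \<Rightarrow> ('i \<Rightarrow> complex mat) \<Rightarrow> 'i set \<Rightarrow> complex mat" where
  "mat_sum n m f S = mat n m (\<lambda>(i, j). \<Sum>s\<in>S. f s $$ (i, j))"

lemma mat_sum_dim [simp]: "dim_row (mat_sum n m f S) = n" "dim_col (mat_sum n m f S) = m"
  by (simp_all add: mat_sum_def)

lemma mat_sum_index [simp]: "i < n \<Longrightarrow> j < m \<Longrightarrow> mat_sum n m f S $$ (i, j) = (\<Sum>s\<in>S. f s $$ (i, j))"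
  by (simp add: mat_sum_def)

lemma mat_sum_cong:
  "S = S' \<Longrightarrow> (\<And>s. s \<in> S' \<Longrightarrow> f s = f' s) \<Longrightarrow> mat_sum n m f S = mat_sum n m f' S'"
  by (auto simp: mat_sum_def intro!: eq_matI sum.cong)

lemma mat_sum_mult_left:
  assumes "\<And>s. s \<in> S \<Longrightarrow> f s \<in> carrier_mat n m" "dim_col A = n"
  shows "A * mat_sum n m f S = mat_sum (dim_row A) m (\<lambda>s. A * f s) S"
proof (rule eq_matI)
  have d: "dim_row (f s) = n" "dim_col (f s) = m" if "s \<in> S" for s using assms(1)[OF that] by auto
  fix i j assume "i < dim_row (mat_sum (dim_row A) m (\<lambda>s. A * f s) S)" "j < dim_col (mat_sum (dim_row A) m (\<lambda>s. A * f s) S)"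
  then have ij: "i < dim_row A" "j < m" by auto
  then have "(A * mat_sum n m f S) $$ (i, j) = (\<Sum>l<n. \<Sum>s\<in>S. A $$ (i, l) * f s $$ (l, j))"
    using assms(2) by (simp add: mat_mult_index sum_distrib_left del: index_mult_mat(1))
  also have "\<dots> = (\<Sum>s\<in>S. \<Sum>l<n. A $$ (i, l) * f s $$ (l, j))" by (rule sum.swap)
  also have "\<dots> = (\<Sum>s\<in>S. (A * f s) $$ (i, j))"
    using d assms(2) ij by (intro sum.cong refl) (simp add: mat_mult_index del: index_mult_mat(1))
  finally show "(A * mat_sum n m f S) $$ (i, j) = mat_sum (dim_row A) m (\<lambda>s. A * f s) S $$ (i, j)"
    using ij by simp
qed auto

lemma mat_sum_adjoint:
  assumes "\<And>s. s \<in> S \<Longrightarrow> f s \<in> carrier_mat n m"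
  shows "mat_adjoint (mat_sum n m f S) = mat_sum m n (\<lambda>s. mat_adjoint (f s)) S"
proof -
  have d: "dim_row (f s) = n" "dim_col (f s) = m" if "s \<in> S" for s using assms[OF that] by auto
  show ?thesis by (intro eq_matI) (auto intro!: sum.cong simp: d)
qed

lemma mat_sum_mult_right:
  assumes "\<And>s. s \<in> S \<Longrightarrow> f s \<in> carrier_mat n m" "dim_row A = m"
  shows "mat_sum n m f S * A = mat_sum n (dim_col A) (\<lambda>s. f s * A) S"
proof -
  have d: "dim_row (f s) = n" "dim_col (f s) = m" if "s \<in> S" for s using assms(1)[OF that] by auto
  have "mat_adjoint (mat_sum n m f S * A) = mat_adjoint A * mat_sum m n (\<lambda>s. mat_adjoint (f s)) S"
    using assms by (simp add: mat_adjoint_mult mat_sum_adjoint)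
  also have "\<dots> = mat_sum (dim_col A) n (\<lambda>s. mat_adjoint A * mat_adjoint (f s)) S"
    using assms by (subst mat_sum_mult_left) (auto simp: d intro!: carrier_matI)
  also have "\<dots> = mat_sum (dim_col A) n (\<lambda>s. mat_adjoint (f s * A)) S"
    using assms by (intro mat_sum_cong refl mat_adjoint_mult[symmetric]) (auto simp: d intro!: carrier_matI)
  also have "\<dots> = mat_adjoint (mat_sum n (dim_col A) (\<lambda>s. f s * A) S)"
    using assms by (subst mat_sum_adjoint) (auto simp: d intro!: carrier_matI)
  finally show ?thesis by (metis mat_adjoint_adjoint)
qed

lemma mat_sum_trace:
  assumes "\<And>s. s \<in> S \<Longrightarrow> f s \<in> carrier_mat n n"
  shows "mat_trace (mat_sum n n f S) = (\<Sum>s\<in>S. mat_trace (f s))"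
proof -
  have "mat_trace (mat_sum n n f S) = (\<Sum>i<n. \<Sum>s\<in>S. f s $$ (i, i))" by (simp add: mat_trace_def)
  also have "\<dots> = (\<Sum>s\<in>S. \<Sum>i<n. f s $$ (i, i))" by (rule sum.swap)
  also have "\<dots> = (\<Sum>s\<in>S. mat_trace (f s))"
    using assms by (intro sum.cong) (auto simp: mat_trace_def dest: carrier_matD)
  finally show ?thesis .
qed

lemma mat_sum_reindex: "bij_betw t S' S \<Longrightarrow> mat_sum n m (\<lambda>s. f (t s)) S' = mat_sum n m f S"
  by (auto simp: mat_sum_def intro!: eq_matI sum.reindex_bij_betw)

lemma mat_sum_const: "A \<in> carrier_mat n m \<Longrightarrow> mat_sum n m (\<lambda>_. A) S = of_nat (card S) \<cdot>\<^sub>m A"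
  by (auto intro!: eq_matI)

lemma mat_sum_empty [simp]: "mat_sum n m f {} = 0\<^sub>m n m"
  by (auto intro!: eq_matI)

lemma mat_sum_insert:
  "finite S \<Longrightarrow> s \<notin> S \<Longrightarrow> f s \<in> carrier_mat n m \<Longrightarrow> mat_sum n m f (insert s S) = f s + mat_sum n m f S"
  by (auto intro!: eq_matI)

lemma mat_sum_projection:
  assumes P: "\<And>s. s \<in> S \<Longrightarrow> mat_projection n (f s)" and fin: "finite S"
    and orth: "\<And>s t. s \<in> S \<Longrightarrow> t \<in> S \<Longrightarrow> s \<noteq> t \<Longrightarrow> f s * f t = 0\<^sub>m n n"
  shows "mat_projection n (mat_sum n n f S)"
proof -
  note c = mat_projectionD[OF P]
  have absorb: "f s * mat_sum n n f S = f s" if s: "s \<in> S" for s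
  proof -
    have "f s * mat_sum n n f S = mat_sum n n (\<lambda>t. f s * f t) S"
      using c s by (subst mat_sum_mult_left) auto
    also have "\<dots> = mat_sum n n (\<lambda>t. if t = s then f s else 0\<^sub>m n n) S"
      using c orth s by (intro mat_sum_cong) auto
    also have "\<dots> = f s"
    proof (rule eq_matI)
      fix i j assume "i < dim_row (f s)" "j < dim_col (f s)"
      then have ij: "i < n" "j < n" using c s by auto
      then have "mat_sum n n (\<lambda>t. if t = s then f s else 0\<^sub>m n n) S $$ (i, j)
        = (\<Sum>t\<in>S. if t = s then f s $$ (i, j) else 0)" by (auto intro!: sum.cong)
      then show "mat_sum n n (\<lambda>t. if t = s then f s else 0\<^sub>m n n) S $$ (i, j) = f s $$ (i, j)"
        using s fin by simp
    qed (use c s in auto)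
    finally show ?thesis .
  qed
  have "mat_sum n n f S * mat_sum n n f S = mat_sum n n (\<lambda>s. f s * mat_sum n n f S) S"
    using c by (subst mat_sum_mult_right) auto
  also have "\<dots> = mat_sum n n f S" using absorb by (intro mat_sum_cong) auto
  moreover have "mat_adjoint (mat_sum n n f S) = mat_sum n n f S"
    using c by (subst mat_sum_adjoint) (auto intro: mat_sum_cong)
  ultimately show ?thesis by (auto simp: mat_projection_def)
qed

section \<open>The spectral theorem for Hermitian matrices\<close>

definition mat_unitary :: "nat \<Rightarrow> complex mat \<Rightarrow> bool" where
  "mat_unitary n U \<longleftrightarrow> U \<in> carrier_mat n n \<and> mat_adjoint U * U = 1\<^sub>m n \<and> U * mat_adjoint U = 1\<^sub>m n"

lemma mat_unitaryD:
  assumes "mat_unitary n U"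
  shows "U \<in> carrier_mat n n" "dim_row U = n" "dim_col U = n"
    "mat_adjoint U * U = 1\<^sub>m n" "U * mat_adjoint U = 1\<^sub>m n"
    "dim_row B = n \<Longrightarrow> U * (mat_adjoint U * B) = B" "dim_row B = n \<Longrightarrow> mat_adjoint U * (U * B) = B"
  using assms by (auto simp: mat_unitary_def simp flip: mat_assoc)

text \<open>
  Up to the phase \<open>w\<close> of \<open>v 0\<close> the unitary is the Householder reflection that exchanges \<open>v\<close> with the
  first basis vector.
\<close>
lemma unitary_with_first_column:
  assumes n: "0 < n" and v: "(\<Sum>i<n. (cmod (v i))\<^sup>2) = 1"
  obtains W where "mat_unitary n W" "\<And>i. i < n \<Longrightarrow> W $$ (i, 0) = v i"
proof -
  define w where "w = (if v 0 = 0 then 1 else sgn (v 0))"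
  have w: "cmod w = 1" by (simp add: w_def norm_sgn)
  then have ww: "cnj w * w = 1" by (simp add: complex_norm_square[symmetric] mult.commute[of "cnj w"])
  define r where "r = cmod (v 0)"
  define u where "u i = cnj w * v i" for i
  have wu: "w * u i = v i" for i using ww by (simp add: u_def mult.assoc[symmetric] mult.commute[of w])
  have u0: "u 0 = complex_of_real r"
    by (simp add: u_def w_def r_def sgn_div_norm scaleR_conv_of_real mult.assoc mult.commute[of "cnj (v 0)"]
          complex_norm_square[symmetric] power2_eq_square)
  have usum: "(\<Sum>i<n. u i * cnj (u i)) = 1"
  proof -
    have "u i * cnj (u i) = complex_of_real ((cmod (v i))\<^sup>2)" for i
      using w complex_norm_square[of "u i"] by (simp add: u_def norm_mult)
    then have "(\<Sum>i<n. u i * cnj (u i)) = complex_of_real (\<Sum>i<n. (cmod (v i))\<^sup>2)" by simp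
    then show ?thesis by (simp add: v)
  qed
  define x where "x i = u i - (if i = 0 then 1 else 0)" for i :: nat
  have xsum: "(\<Sum>i<n. x i * cnj (x i)) = 2 * (1 - complex_of_real r)"
  proof -
    have "(\<Sum>i<n. x i * cnj (x i)) = (\<Sum>i<n. u i * cnj (u i) - (if i = 0 then u i + cnj (u i) - 1 else 0))"
      by (intro sum.cong) (auto simp: x_def algebra_simps)
    also have "\<dots> = 1 - (2 * complex_of_real r - 1)"
      unfolding sum_subtractf usum using n by (simp add: u0)
    finally show ?thesis by simp
  qed
  define c where "c = (if r = 1 then 0 else 1 / (1 - complex_of_real r))"
  have c_real: "cnj c = c" by (simp add: c_def)
  define H where "H = mat n n (\<lambda>(i, j). (if i = j then 1 else 0) - c * x i * cnj (x j))"
  have H: "dim_row H = n" "dim_col H = n" by (auto simp: H_def)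
  have HH: "H * H = 1\<^sub>m n"
  proof (rule eq_matI)
    fix i j assume "i < dim_row (1\<^sub>m n :: complex mat)" "j < dim_col (1\<^sub>m n :: complex mat)"
    then have ij: "i < n" "j < n" by auto
    have "(H * H) $$ (i, j) = (\<Sum>l<n. H $$ (i, l) * H $$ (l, j))" using ij H by (simp add: mat_mult_index del: index_mult_mat(1))
    also have "\<dots> = (\<Sum>l<n. (if l = i then (if i = j then 1 else 0) - c * x i * cnj (x j) else 0)
        - (if l = j then c * x i * cnj (x j) else 0) + c * c * x i * cnj (x j) * (x l * cnj (x l)))"
      using ij by (intro sum.cong refl) (auto simp: H_def algebra_simps)
    also have "\<dots> = (if i = j then 1 else 0) - 2 * c * x i * cnj (x j) + c * c * x i * cnj (x j) * (2 * (1 - complex_of_real r))"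
      using ij unfolding sum.distrib sum_subtractf sum_distrib_left[symmetric] xsum by simp
    also have "c * c * x i * cnj (x j) * (2 * (1 - complex_of_real r)) = 2 * c * x i * cnj (x j)"
    proof (cases "r = 1")
      case False
      then have "c * (1 - complex_of_real r) = 1" by (simp add: c_def)
      then have "c * x i * cnj (x j) * 2 * (c * (1 - complex_of_real r)) = c * x i * cnj (x j) * 2" by simp
      then show ?thesis by (simp only: ac_simps)
    qed (simp add: c_def)
    finally show "(H * H) $$ (i, j) = 1\<^sub>m n $$ (i, j)" using ij by simp
  qed (auto simp: H)
  have Hadj: "mat_adjoint H = H" by (rule eq_matI) (auto simp: H_def c_real)
  define W where "W = w \<cdot>\<^sub>m H"
  have "mat_unitary n W"
    using ww by (auto simp: mat_unitary_def W_def H Hadj mat_distribs HH mult.commute[of w] intro!: eq_matI)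
  moreover have "W $$ (i, 0) = v i" if i: "i < n" for i
  proof (cases "r = 1")
    case True
    have "x i = 0"
    proof -
      have "complex_of_real (\<Sum>i<n. (cmod (x i))\<^sup>2) = 0" using xsum True by (simp add: complex_norm_square del: of_real_power)
      then have "(\<Sum>i<n. (cmod (x i))\<^sup>2) = 0" by (simp only: of_real_eq_0_iff)
      then show ?thesis using i by (simp add: sum_nonneg_eq_0_iff)
    qed
    then show ?thesis using i n wu[of i] by (auto simp: W_def H_def x_def)
  next
    case False
    then have "c * cnj (x 0) = - 1" by (simp add: c_def x_def u0 field_simps)
    then have "c * x i * cnj (x 0) = - x i" by (metis mult.assoc mult.commute mult_minus1)
    then have "H $$ (i, 0) = u i" using i n by (simp add: H_def x_def)
    then show ?thesis using i n wu[of i] H by (simp add: W_def)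
  qed
  ultimately show ?thesis using that by blast
qed

text \<open>
  Induction on the size: in an orthonormal basis that starts with an eigenvector, the first column
  is diagonal, and because the matrix is Hermitian so is the first row.
\<close>
lemma hermitian_diagonalization:
  assumes "A \<in> carrier_mat n n" "mat_adjoint A = A"
  shows "\<exists>U c. mat_unitary n U \<and> A * U = U * mat_diag n (\<lambda>i. complex_of_real (c i))"
  using assms
proof (induction n arbitrary: A)
  case 0
  then show ?case by (intro exI[of _ "1\<^sub>m 0"] exI[of _ "\<lambda>_. 0"]) (auto simp: mat_unitary_def mat_diag_def)
next
  case (Suc k)
  let ?n = "Suc k"
  note A [simp] = carrier_matD[OF Suc.prems(1)]
  from spectrum_non_empty[OF Suc.prems(1)] obtain e where "eigenvalue A e" by (auto simp: spectrum_def)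
  then obtain v0 where v0: "v0 \<in> carrier_vec ?n" "v0 \<noteq> 0\<^sub>v ?n" "A *\<^sub>v v0 = e \<cdot>\<^sub>v v0"
    by (auto simp: eigenvalue_def eigenvector_def)
  define s where "s = (\<Sum>i<?n. (cmod (v0 $ i))\<^sup>2)"
  have "s \<noteq> 0"
  proof
    assume "s = 0"
    then have "\<forall>i<?n. v0 $ i = 0" unfolding s_def by (subst (asm) sum_nonneg_eq_0_iff) auto
    then have "v0 = 0\<^sub>v ?n" using v0(1) by (intro eq_vecI) auto
    with v0(2) show False by simp
  qed
  then have s: "s > 0" by (simp add: s_def less_le sum_nonneg)
  define v where "v i = v0 $ i / complex_of_real (sqrt s)" for i
  have "(\<Sum>i<?n. (cmod (v i))\<^sup>2) = (\<Sum>i<?n. (cmod (v0 $ i))\<^sup>2) / s"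
    unfolding sum_divide_distrib using s by (intro sum.cong) (auto simp: v_def norm_divide power_divide)
  then have vsum: "(\<Sum>i<?n. (cmod (v i))\<^sup>2) = 1" using s by (simp add: s_def)
  have Av: "(\<Sum>l<?n. A $$ (i, l) * v l) = e * v i" if "i < ?n" for i
  proof -
    have "(A *\<^sub>v v0) $ i = (\<Sum>l<?n. A $$ (i, l) * v0 $ l)"
      using that v0(1) by (simp add: scalar_prod_def atLeast0LessThan del: sum.lessThan_Suc)
    then have "(\<Sum>l<?n. A $$ (i, l) * v0 $ l) = e * v0 $ i" using v0(1,3) that by simp
    then have "(\<Sum>l<?n. A $$ (i, l) * v0 $ l) / complex_of_real (sqrt s) = e * v0 $ i / complex_of_real (sqrt s)" by simp
    then show ?thesis by (simp add: v_def sum_divide_distrib del: sum.lessThan_Suc)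
  qed
  obtain W where W: "mat_unitary ?n W" and W0: "\<And>i. i < ?n \<Longrightarrow> W $$ (i, 0) = v i"
    using unitary_with_first_column[OF _ vsum] by blast
  note Wd [simp] = mat_unitaryD[OF W]
  define Z where "Z = mat_adjoint W * (A * W)"
  have Z [simp]: "dim_row Z = ?n" "dim_col Z = ?n" by (auto simp: Z_def)
  have Zadj: "mat_adjoint Z = Z" by (simp add: Z_def mat_adjoint_mult Suc.prems(2) mat_assoc)
  have Z0: "Z $$ (i, 0) = (if i = 0 then e else 0)" if i: "i < ?n" for i
  proof -
    have AW: "(A * W) $$ (l, 0) = e * W $$ (l, 0)" if "l < ?n" for l
      using that Av[of l] W0 by (simp add: mat_mult_index del: index_mult_mat(1) sum.lessThan_Suc)
    have "Z $$ (i, 0) = (\<Sum>l<?n. mat_adjoint W $$ (i, l) * (A * W) $$ (l, 0))"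
      unfolding Z_def using i by (subst mat_mult_index) auto
    also have "\<dots> = e * (\<Sum>l<?n. mat_adjoint W $$ (i, l) * W $$ (l, 0))"
      using AW by (simp add: sum_distrib_left mult.left_commute del: index_mult_mat(1) sum.lessThan_Suc cong: sum.cong_simp)
    also have "(\<Sum>l<?n. mat_adjoint W $$ (i, l) * W $$ (l, 0)) = (mat_adjoint W * W) $$ (i, 0)"
      using i by (subst mat_mult_index) auto
    finally show ?thesis using i by simp
  qed
  have e_real: "e = complex_of_real (Re e)"
  proof -
    have "cnj (Z $$ (0, 0)) = Z $$ (0, 0)" using mat_adjoint_index[of 0 Z 0] by (simp add: Zadj)
    then show ?thesis by (simp add: Z0 complex_eq_iff)
  qed
  have Z0': "Z $$ (0, j) = (if j = 0 then e else 0)" if "j < ?n" for j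
    using mat_adjoint_index[of 0 Z j] that Z0[of j] e_real by (auto simp: Zadj)
  define Z' where "Z' = mat k k (\<lambda>(i, j). Z $$ (Suc i, Suc j))"
  have "mat_adjoint Z' = Z'"
  proof (rule eq_matI)
    fix i j assume "i < dim_row Z'" "j < dim_col Z'"
    then show "mat_adjoint Z' $$ (i, j) = Z' $$ (i, j)"
      using mat_adjoint_index[of "Suc i" Z "Suc j"] by (auto simp: Zadj Z'_def)
  qed (auto simp: Z'_def)
  moreover have Z'c: "Z' \<in> carrier_mat k k" by (simp add: Z'_def)
  ultimately obtain U' c' where U': "mat_unitary k U'"
    and ZU: "Z' * U' = U' * mat_diag k (\<lambda>i. complex_of_real (c' i))" using Suc.IH by blast
  note Ud [simp] = mat_unitaryD(2,3)[OF U']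
  define U where "U = mat ?n ?n (\<lambda>(i, j). case i of 0 \<Rightarrow> (case j of 0 \<Rightarrow> 1 | Suc j' \<Rightarrow> 0)
     | Suc i' \<Rightarrow> (case j of 0 \<Rightarrow> 0 | Suc j' \<Rightarrow> U' $$ (i', j')))"
  have Udim [simp]: "dim_row U = ?n" "dim_col U = ?n" by (auto simp: U_def)
  have Ui: "U $$ (0, 0) = 1" "j < k \<Longrightarrow> U $$ (0, Suc j) = 0" "i < k \<Longrightarrow> U $$ (Suc i, 0) = 0"
    "i < k \<Longrightarrow> j < k \<Longrightarrow> U $$ (Suc i, Suc j) = U' $$ (i, j)" for i j by (auto simp: U_def)
  define c where "c = (\<lambda>i. case i of 0 \<Rightarrow> Re e | Suc i' \<Rightarrow> c' i')"
  have c: "complex_of_real (c 0) = e" "c (Suc i) = c' i" for i using e_real by (auto simp: c_def)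
  have U'sum: "(\<Sum>l<k. cnj (U' $$ (l, i)) * U' $$ (l, j)) = (if i = j then 1 else 0)"
    "(\<Sum>l<k. U' $$ (i, l) * cnj (U' $$ (j, l))) = (if i = j then 1 else 0)" if "i < k" "j < k" for i j
    using arg_cong[OF mat_unitaryD(4)[OF U'], of "\<lambda>M. M $$ (i, j)"] arg_cong[OF mat_unitaryD(5)[OF U'], of "\<lambda>M. M $$ (i, j)"] that
    by (auto simp: mat_mult_index simp del: index_mult_mat(1))
  have Uu: "mat_unitary ?n U"
    unfolding mat_unitary_def
  proof (intro conjI eq_matI)
    fix i j assume "i < dim_row (1\<^sub>m ?n :: complex mat)" "j < dim_col (1\<^sub>m ?n :: complex mat)"
    then have ij: "i < ?n" "j < ?n" by auto
    show "(mat_adjoint U * U) $$ (i, j) = 1\<^sub>m ?n $$ (i, j)"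
      using ij by (cases i; cases j)
        (auto simp: mat_mult_index Ui U'sum sum.lessThan_Suc_shift simp del: index_mult_mat(1) sum.lessThan_Suc cong: sum.cong_simp)
    show "(U * mat_adjoint U) $$ (i, j) = 1\<^sub>m ?n $$ (i, j)"
      using ij by (cases i; cases j)
        (auto simp: mat_mult_index Ui U'sum sum.lessThan_Suc_shift simp del: index_mult_mat(1) sum.lessThan_Suc cong: sum.cong_simp)
  qed auto
  have ZU2: "Z * U = U * mat_diag ?n (\<lambda>i. complex_of_real (c i))"
  proof (rule eq_matI)
    fix i j assume "i < dim_row (U * mat_diag ?n (\<lambda>i. complex_of_real (c i)))" "j < dim_col (U * mat_diag ?n (\<lambda>i. complex_of_real (c i)))"
    then have ij: "i < ?n" "j < ?n" by (auto simp: mat_diag_def)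
    have "(U * mat_diag ?n (\<lambda>i. complex_of_real (c i))) $$ (i, j) = U $$ (i, j) * complex_of_real (c j)"
      using ij by (subst mat_diag_mult_right[of _ "Suc k"]) auto
    moreover have "(\<Sum>l<k. Z $$ (Suc i', Suc l) * U' $$ (l, j')) = U' $$ (i', j') * complex_of_real (c' j')"
      if "i' < k" "j' < k" for i' j'
    proof -
      have "(\<Sum>l<k. Z $$ (Suc i', Suc l) * U' $$ (l, j')) = (Z' * U') $$ (i', j')"
        using that Z'c by (simp add: mat_mult_index Z'_def del: index_mult_mat(1) cong: sum.cong_simp)
      also have "\<dots> = U' $$ (i', j') * complex_of_real (c' j')"
        unfolding ZU using that by (subst mat_diag_mult_right[of _ k]) (auto simp: Ud)
      finally show ?thesis .
    qed
    ultimately show "(Z * U) $$ (i, j) = (U * mat_diag ?n (\<lambda>i. complex_of_real (c i))) $$ (i, j)"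
      using ij by (cases i; cases j)
        (auto simp: mat_mult_index Ui Z0 Z0' c sum.lessThan_Suc_shift simp del: index_mult_mat(1) sum.lessThan_Suc cong: sum.cong_simp)
  qed (auto simp: mat_diag_def)
  have "mat_unitary ?n (W * U)"
    unfolding mat_unitary_def
    by (intro conjI carrier_matI) (simp_all add: mat_adjoint_mult mat_assoc mat_unitaryD[OF Uu])
  moreover have "A * (W * U) = (W * U) * mat_diag ?n (\<lambda>i. complex_of_real (c i))"
  proof -
    have "A * (W * U) = W * (Z * U)" by (simp add: Z_def mat_assoc)
    then show ?thesis by (simp add: ZU2 mat_assoc mat_diag_def)
  qed
  ultimately show ?case by blast
qed

text \<open>
  The form of the spectral theorem that is used below: a resolution of the identity into
  projections of trace 1 onto eigenvectors.
\<close>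
definition spectral_family :: "nat \<Rightarrow> complex mat \<Rightarrow> (nat \<Rightarrow> complex mat) \<Rightarrow> (nat \<Rightarrow> real) \<Rightarrow> bool" where
  "spectral_family n A e c \<longleftrightarrow>
     (\<forall>i<n. mat_projection n (e i) \<and> mat_trace (e i) = 1 \<and> A * e i = complex_of_real (c i) \<cdot>\<^sub>m e i)
     \<and> (\<forall>i<n. \<forall>j<n. i \<noteq> j \<longrightarrow> e i * e j = 0\<^sub>m n n)
     \<and> mat_sum n n e {..<n} = 1\<^sub>m n"

lemma spectral_family_exists:
  assumes A: "A \<in> carrier_mat n n" "mat_adjoint A = A"
  obtains e c where "spectral_family n A e c"
proof -
  from hermitian_diagonalization[OF A] obtain U c where U: "mat_unitary n U"
    and AU: "A * U = U * mat_diag n (\<lambda>i. complex_of_real (c i))" by blast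
  note [simp] = mat_unitaryD[OF U] carrier_matD[OF A(1)] carrier_matD[OF mat_diag_dim]
  define d where "d i = mat_diag n (\<lambda>j. if j = i then 1 else 0 :: complex)" for i
  have d: "mat_adjoint (d i) = d i" "d i * d i = d i" "dim_row (d i) = n" "dim_col (d i) = n"
    and d_orth: "i \<noteq> j \<Longrightarrow> d i * d j = 0\<^sub>m n n"
    and d_tr: "i < n \<Longrightarrow> mat_trace (d i) = 1" for i j
    unfolding d_def mat_diag_diag by (auto simp: mat_diag_def mat_trace_def intro!: eq_matI)
  have d2: "d i * (d i * B) = d i * B" "i \<noteq> j \<Longrightarrow> d i * (d j * B) = 0\<^sub>m n (dim_col B)" if "dim_row B = n" for i j B
    using that d(2)[of i] d_orth[of i j] d(3,4) by (simp_all flip: mat_assoc)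
  define e where "e i = U * (d i * mat_adjoint U)" for i
  have e_dim: "dim_row (e i) = n" "dim_col (e i) = n" for i by (simp_all add: e_def)
  have tr: "mat_trace (e i) = 1" if "i < n" for i
  proof -
    have "mat_trace (e i) = mat_trace (d i * (mat_adjoint U * U))"
      unfolding e_def by (subst mat_trace_commute) (simp_all add: d mat_assoc)
    then show ?thesis using that by (simp add: d d_tr)
  qed
  have Ae: "A * e i = complex_of_real (c i) \<cdot>\<^sub>m e i" for i
  proof -
    have "A * e i = (A * U) * (d i * mat_adjoint U)" by (simp add: e_def d mat_assoc)
    also have "\<dots> = U * ((mat_diag n (\<lambda>i. complex_of_real (c i)) * d i) * mat_adjoint U)"
      unfolding AU by (simp add: d mat_assoc)
    also have "mat_diag n (\<lambda>i. complex_of_real (c i)) * d i = complex_of_real (c i) \<cdot>\<^sub>m d i"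
      unfolding d_def mat_diag_diag by (auto simp: mat_diag_def intro!: eq_matI)
    finally show ?thesis by (simp add: e_def d mat_distribs)
  qed
  have "mat_sum n n e {..<n} = U * (mat_sum n n d {..<n} * mat_adjoint U)"
    unfolding e_def by (subst mat_sum_mult_right, simp_all add: d carrier_matI,
        subst mat_sum_mult_left) (auto simp: d intro!: carrier_matI)
  also have "mat_sum n n d {..<n} = 1\<^sub>m n"
    by (rule eq_matI) (auto simp: d_def mat_diag_def)
  finally have "mat_sum n n e {..<n} = 1\<^sub>m n" by simp
  moreover have "mat_projection n (e i)" for i
    by (auto simp: mat_projection_def e_def mat_adjoint_mult d mat_assoc d2)
  moreover have "e i * e j = 0\<^sub>m n n" if "i \<noteq> j" for i j
    using that by (simp add: e_def mat_assoc d d2)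
  ultimately have "spectral_family n A e c" using tr Ae by (simp add: spectral_family_def)
  then show ?thesis using that by blast
qed

lemma spectral_familyD:
  assumes "spectral_family n A e c" "i < n"
  shows "mat_projection n (e i)" "mat_trace (e i) = 1" "A * e i = complex_of_real (c i) \<cdot>\<^sub>m e i"
    "j < n \<Longrightarrow> i \<noteq> j \<Longrightarrow> e i * e j = 0\<^sub>m n n"
    "dim_row (e i) = n" "dim_col (e i) = n"
  using assms by (auto simp: spectral_family_def mat_projection_def)

lemma spectral_family_sum:
  assumes e: "spectral_family n A e c" and A: "A \<in> carrier_mat n n"
  shows "A = mat_sum n n (\<lambda>i. complex_of_real (c i) \<cdot>\<^sub>m e i) {..<n}"
proof -
  have "A = A * mat_sum n n e {..<n}" using e A by (simp add: spectral_family_def)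
  also have "\<dots> = mat_sum n n (\<lambda>i. A * e i) {..<n}"
    using A spectral_familyD(5,6)[OF e] by (subst mat_sum_mult_left) auto
  also have "\<dots> = mat_sum n n (\<lambda>i. complex_of_real (c i) \<cdot>\<^sub>m e i) {..<n}"
    using spectral_familyD(3)[OF e] by (intro mat_sum_cong) auto
  finally show ?thesis .
qed

lemma spectral_family_projection:
  assumes e: "spectral_family n A e c" and "S \<subseteq> {..<n}"
  shows "mat_projection n (mat_sum n n e S)"
proof (rule mat_sum_projection)
  show "finite S" using assms(2) finite_subset by blast
qed (use assms(2) spectral_familyD(1,4)[OF e] in blast)+

text \<open>
  Eigenprojections belong to the bicommutant of \<open>A\<close>: if \<open>B\<close> commutes with \<open>A\<close>, it has no entries
  between eigenvectors with distinct eigenvalues.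
\<close>
lemma spectral_projection_commute:
  assumes e: "spectral_family n A e c" and A: "A \<in> carrier_mat n n" "mat_adjoint A = A"
    and B: "B \<in> carrier_mat n n" "A * B = B * A"
  shows "mat_sum n n e {i. i < n \<and> c i = l} * B = B * mat_sum n n e {i. i < n \<and> c i = l}"
proof -
  let ?S = "{i. i < n \<and> c i = l}" and ?T = "{i. i < n \<and> c i \<noteq> l}"
  let ?E = "mat_sum n n e ?S" and ?F = "mat_sum n n e ?T"
  note D [simp] = carrier_matD[OF A(1)] carrier_matD[OF B(1)]
  note ed = spectral_familyD[OF e]
  have zero: "e i * (B * e j) = 0\<^sub>m n n" if ij: "i < n" "j < n" "c i \<noteq> c j" for i j
  proof -
    note P = mat_projectionD[OF ed(1)[OF ij(1)]] mat_projectionD[OF ed(1)[OF ij(2)]]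
    have eA: "e i * A = complex_of_real (c i) \<cdot>\<^sub>m e i"
      using arg_cong[OF ed(3)[OF ij(1)], of mat_adjoint] P A by (simp add: mat_adjoint_mult)
    have "complex_of_real (c i) \<cdot>\<^sub>m (e i * (B * e j)) = (e i * A) * (B * e j)"
      using P by (simp add: eA mat_distribs)
    also have "\<dots> = e i * ((A * B) * e j)" using P by (simp add: mat_assoc)
    also have "\<dots> = e i * (B * (A * e j))" using P by (simp add: B(2) mat_assoc)
    also have "\<dots> = complex_of_real (c j) \<cdot>\<^sub>m (e i * (B * e j))"
      using P ed(3)[OF ij(2)] by (simp add: mat_distribs)
    finally have eq: "complex_of_real (c i) \<cdot>\<^sub>m (e i * (B * e j)) = complex_of_real (c j) \<cdot>\<^sub>m (e i * (B * e j))" .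
    show ?thesis
    proof (rule eq_matI)
      fix a b assume "a < dim_row (0\<^sub>m n n :: complex mat)" "b < dim_col (0\<^sub>m n n :: complex mat)"
      then have ab: "a < n" "b < n" by auto
      have "complex_of_real (c i) * (e i * (B * e j)) $$ (a, b) = complex_of_real (c j) * (e i * (B * e j)) $$ (a, b)"
        using arg_cong[OF eq, of "\<lambda>M. M $$ (a, b)"] ab P by (simp del: index_mult_mat(1))
      then show "(e i * (B * e j)) $$ (a, b) = 0\<^sub>m n n $$ (a, b)" using ij ab by (simp del: index_mult_mat(1))
    qed (use P in auto)
  qed
  have zero_sum: "mat_sum n n e I * (B * mat_sum n n e J) = 0\<^sub>m n n"
    if "\<And>i. i \<in> I \<Longrightarrow> i < n" "\<And>j. j \<in> J \<Longrightarrow> j < n" "\<And>i j. i \<in> I \<Longrightarrow> j \<in> J \<Longrightarrow> c i \<noteq> c j" for I J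
  proof -
    have "mat_sum n n e I * (B * mat_sum n n e J) = mat_sum n n (\<lambda>i. e i * (B * mat_sum n n e J)) I"
      using that ed by (subst mat_sum_mult_right) auto
    also have "\<dots> = mat_sum n n (\<lambda>i. 0\<^sub>m n n) I"
    proof (rule mat_sum_cong[OF refl])
      fix i assume i: "i \<in> I"
      have ej: "e j \<in> carrier_mat n n" if "j \<in> J" for j using ed(5,6) that(1) \<open>\<And>j. j \<in> J \<Longrightarrow> j < n\<close> by auto
      have "B * mat_sum n n e J = mat_sum n n (\<lambda>j. B * e j) J"
        using ej by (subst mat_sum_mult_left) auto
      then have "e i * (B * mat_sum n n e J) = mat_sum n n (\<lambda>j. e i * (B * e j)) J"
        using ed(5,6)[OF that(1)[OF i]] carrier_matD[OF ej]
        by (simp only:) (subst mat_sum_mult_left, auto intro!: carrier_matI)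
      also have "\<dots> = mat_sum n n (\<lambda>j. 0\<^sub>m n n) J"
        using that zero i by (intro mat_sum_cong) auto
      finally show "e i * (B * mat_sum n n e J) = 0\<^sub>m n n" by (auto intro!: eq_matI)
    qed
    also have "\<dots> = 0\<^sub>m n n" by (auto intro!: eq_matI)
    finally show ?thesis .
  qed
  have F: "1\<^sub>m n = ?E + ?F"
  proof -
    have "{..<n} = ?S \<union> ?T" by auto
    moreover have "mat_sum n n e (?S \<union> ?T) = ?E + ?F"
      by (intro eq_matI) (auto intro!: sum.union_disjoint)
    moreover have "mat_sum n n e {..<n} = 1\<^sub>m n" using e by (simp add: spectral_family_def)
    ultimately show ?thesis by simp
  qed
  have EF: "?E * (B * ?F) = 0\<^sub>m n n" "?F * (B * ?E) = 0\<^sub>m n n"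
    by (rule zero_sum; auto)+
  have "?E * B = ?E * (B * (?E + ?F))" by (simp flip: F)
  also have "\<dots> = ?E * (B * ?E)" by (simp add: mat_distribs EF)
  also have "\<dots> = (?E + ?F) * (B * ?E)" by (simp add: mat_distribs EF)
  also have "\<dots> = B * ?E" by (simp flip: F)
  finally show ?thesis .
qed

text \<open>
  An eigenprojection that commutes with everything \<open>A\<close> commutes with. Applied to \<open>A = Y\<^sup>* Y\<close> for an
  intertwiner \<open>Y\<close>, it is invariant, which makes a polar decomposition of \<open>Y\<close> unnecessary.
\<close>
lemma hermitian_eigenprojection:
  assumes A: "A \<in> carrier_mat n n" "mat_adjoint A = A" "A \<noteq> 0\<^sub>m n n"
  obtains l E where "l \<noteq> 0" "mat_projection n E" "E \<noteq> 0\<^sub>m n n" "A * E = complex_of_real l \<cdot>\<^sub>m E"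
    "\<And>B. B \<in> carrier_mat n n \<Longrightarrow> A * B = B * A \<Longrightarrow> E * B = B * E"
proof -
  obtain e c where e: "spectral_family n A e c" using spectral_family_exists[OF A(1,2)] .
  note ed = spectral_familyD[OF e]
  have "\<exists>i<n. c i \<noteq> 0"
  proof (rule ccontr)
    assume *: "\<not> (\<exists>i<n. c i \<noteq> 0)"
    have "A = mat_sum n n (\<lambda>i. complex_of_real (c i) \<cdot>\<^sub>m e i) {..<n}" by (rule spectral_family_sum[OF e A(1)])
    also have "\<dots> = mat_sum n n (\<lambda>i. 0\<^sub>m n n) {..<n}"
    proof (rule mat_sum_cong[OF refl])
      fix i assume "i \<in> {..<n}"
      then have i: "i < n" by simp
      with * have ci: "c i = 0" by blast
      show "complex_of_real (c i) \<cdot>\<^sub>m e i = 0\<^sub>m n n"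
        unfolding ci by (rule eq_matI) (simp_all add: ed(5,6)[OF i])
    qed
    also have "\<dots> = 0\<^sub>m n n" by (auto intro!: eq_matI)
    finally show False using A(3) by simp
  qed
  then obtain i where i: "i < n" "c i \<noteq> 0" by blast
  let ?S = "{j. j < n \<and> c j = c i}" let ?E = "mat_sum n n e ?S"
  have E: "mat_projection n ?E" by (rule spectral_family_projection[OF e]) auto
  have E0: "?E \<noteq> 0\<^sub>m n n"
  proof
    assume E_zero: "?E = 0\<^sub>m n n"
    have "of_nat (card ?S) = (\<Sum>j\<in>?S. mat_trace (e j))"
      by (simp add: ed(2))
    also have "\<dots> = mat_trace ?E"
      by (subst mat_sum_trace) (auto simp: ed(5,6) intro!: carrier_matI)
    also have "\<dots> = 0" unfolding E_zero by simp
    finally have "card ?S = 0" unfolding of_nat_eq_0_iff .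
    moreover have "i \<in> ?S" "finite ?S" using i(1) by simp_all
    ultimately show False by (metis card_eq_0_iff empty_iff)
  qed
  have AE: "A * ?E = complex_of_real (c i) \<cdot>\<^sub>m ?E"
  proof -
    have "A * ?E = mat_sum n n (\<lambda>j. A * e j) ?S"
      using A(1) ed(5,6) by (subst mat_sum_mult_left) auto
    also have "\<dots> = mat_sum n n (\<lambda>j. complex_of_real (c i) \<cdot>\<^sub>m e j) ?S"
      by (intro mat_sum_cong) (auto simp: ed(3))
    also have "\<dots> = complex_of_real (c i) \<cdot>\<^sub>m ?E"
      using ed(5,6) by (intro eq_matI) (auto simp: sum_distrib_left intro!: sum.cong)
    finally show ?thesis .
  qed
  show ?thesis
    by (rule that[OF i(2) E E0 AE]) (rule spectral_projection_commute[OF e A(1,2)])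
qed

text \<open>The eigenvalues of a projection are 0 and 1, so its trace counts the eigenvalues 1.\<close>
lemma mat_projection_trace_nat:
  assumes P: "mat_projection n P"
  obtains k where "mat_trace P = of_nat k"
proof -
  note Pd = mat_projectionD[OF P]
  obtain e c where e: "spectral_family n P e c" using spectral_family_exists[OF Pd(1,4)] .
  note ed = spectral_familyD[OF e]
  have c: "c i = 0 \<or> c i = 1" if i: "i < n" for i
  proof -
    have "P * e i = P * (P * e i)" using Pd(6)[OF ed(5)[OF i]] by (rule sym)
    also have "\<dots> = complex_of_real (c i) \<cdot>\<^sub>m (P * e i)"
      unfolding ed(3)[OF i] using Pd(3) ed(5)[OF i] by (simp add: mat_distribs ed(3)[OF i])
    finally have "complex_of_real (c i) \<cdot>\<^sub>m e i = complex_of_real (c i) \<cdot>\<^sub>m (complex_of_real (c i) \<cdot>\<^sub>m e i)"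
      unfolding ed(3)[OF i] .
    then have "mat_trace (complex_of_real (c i) \<cdot>\<^sub>m e i) = mat_trace (complex_of_real (c i) \<cdot>\<^sub>m (complex_of_real (c i) \<cdot>\<^sub>m e i))"
      by (rule arg_cong)
    moreover have "mat_trace (complex_of_real (c i) \<cdot>\<^sub>m e i) = complex_of_real (c i)"
      "mat_trace (complex_of_real (c i) \<cdot>\<^sub>m (complex_of_real (c i) \<cdot>\<^sub>m e i)) = complex_of_real (c i * c i)"
      using ed(2,5,6)[OF i] by simp_all
    ultimately have "c i = c i * c i" by (metis of_real_eq_iff)
    then show ?thesis by (metis mult_cancel_left1)
  qed
  have "mat_trace P = mat_trace (mat_sum n n (\<lambda>i. complex_of_real (c i) \<cdot>\<^sub>m e i) {..<n})"
    by (rule arg_cong[where f = mat_trace, OF spectral_family_sum[OF e Pd(1)]])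
  also have "\<dots> = (\<Sum>i<n. mat_trace (complex_of_real (c i) \<cdot>\<^sub>m e i))"
    by (subst mat_sum_trace) (auto simp: ed(5,6) intro!: carrier_matI)
  also have "\<dots> = (\<Sum>i<n. of_nat (if c i = 1 then 1 else 0))"
  proof (rule sum.cong[OF refl])
    fix i assume "i \<in> {..<n}"
    then have i: "i < n" by simp
    show "mat_trace (complex_of_real (c i) \<cdot>\<^sub>m e i) = of_nat (if c i = 1 then 1 else 0)"
      using c[OF i] ed(2,5,6)[OF i] by auto
  qed
  also have "\<dots> = of_nat (\<Sum>i<n. if c i = 1 then 1 else 0)" by (rule of_nat_sum[symmetric])
  finally show ?thesis using that by blast
qed

section \<open>Intertwiners of unitary representations\<close>

lemma mat_absorb:
  "A * B = C \<Longrightarrow> dim_col A = dim_row B \<Longrightarrow> dim_col B = dim_row D \<Longrightarrow> A * (B * D) = C * (D :: complex mat)"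
  by (simp flip: mat_assoc)

lemma unitary_repD:
  assumes "unitary_rep G k \<rho>" "g \<in> carrier G"
  shows "\<rho> g \<in> carrier_mat k k" "dim_row (\<rho> g) = k" "dim_col (\<rho> g) = k" "mat_unitary k (\<rho> g)"
    "h \<in> carrier G \<Longrightarrow> \<rho> (g \<otimes>\<^bsub>G\<^esub> h) = \<rho> g * \<rho> h"
  using assms by (auto simp: unitary_rep_def mat_unitary_def)

lemma unitary_rep_one:
  assumes G: "group G" and \<rho>: "unitary_rep G k \<rho>"
  shows "\<rho> \<one>\<^bsub>G\<^esub> = 1\<^sub>m k"
proof -
  interpret group G by (rule G)
  note r = unitary_repD[OF \<rho> one_closed]
  note u = mat_unitaryD[OF r(4)]
  have "\<rho> \<one>\<^bsub>G\<^esub> * \<rho> \<one>\<^bsub>G\<^esub> = \<rho> \<one>\<^bsub>G\<^esub>" using r(5)[OF one_closed] by simp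
  then have "mat_adjoint (\<rho> \<one>\<^bsub>G\<^esub>) * (\<rho> \<one>\<^bsub>G\<^esub> * \<rho> \<one>\<^bsub>G\<^esub>) = 1\<^sub>m k" using u by simp
  then show ?thesis using u(7)[OF u(2)] by simp
qed

lemma unitary_rep_inv:
  assumes G: "group G" and \<rho>: "unitary_rep G k \<rho>" and g: "g \<in> carrier G"
  shows "\<rho> (inv\<^bsub>G\<^esub> g) = mat_adjoint (\<rho> g)"
proof -
  interpret group G by (rule G)
  note r = unitary_repD[OF \<rho> g] unitary_repD[OF \<rho> inv_closed[OF g]]
  note u = mat_unitaryD[OF r(4)]
  have "\<rho> g * \<rho> (inv\<^bsub>G\<^esub> g) = 1\<^sub>m k"
    using r(5)[OF inv_closed[OF g]] g unitary_rep_one[OF G \<rho>] by simp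
  then have "mat_adjoint (\<rho> g) * (\<rho> g * \<rho> (inv\<^bsub>G\<^esub> g)) = mat_adjoint (\<rho> g)" using u by simp
  then show ?thesis using u(7)[OF r(7)] by simp
qed

definition mat_unit :: "nat \<Rightarrow> nat \<Rightarrow> nat \<Rightarrow> nat \<Rightarrow> complex mat" where
  "mat_unit n m a b = mat n m (\<lambda>(i, j). if i = a \<and> j = b then 1 else 0)"

lemma mat_unit_carrier [simp]:
  "mat_unit n m a b \<in> carrier_mat n m" "dim_row (mat_unit n m a b) = n" "dim_col (mat_unit n m a b) = m"
  by (simp_all add: mat_unit_def)

lemma mat_unit_index [simp]: "i < n \<Longrightarrow> j < m \<Longrightarrow> mat_unit n m a b $$ (i, j) = (if i = a \<and> j = b then 1 else 0)"
  by (simp add: mat_unit_def)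

lemma mat_unit_adjoint [simp]: "mat_adjoint (mat_unit n m a b) = mat_unit m n b a"
  by (rule eq_matI) auto

lemma mat_unit_mult_index:
  fixes V :: "complex mat"
  assumes "dim_row V = s" "i < k" "b < s" "j < dim_col V"
  shows "(mat_unit k s a b * V) $$ (i, j) = (if i = a then V $$ (b, j) else 0)"
proof -
  have "(mat_unit k s a b * V) $$ (i, j) = (\<Sum>l<s. mat_unit k s a b $$ (i, l) * V $$ (l, j))"
    using assms by (subst mat_mult_index) auto
  also have "\<dots> = (\<Sum>l<s. if l = b then (if i = a then V $$ (b, j) else 0) else 0)"
    using assms by (intro sum.cong) auto
  finally show ?thesis using assms by simp
qed

lemma mat_unit_mult: "b < m \<Longrightarrow> mat_unit n m a b * mat_unit m l b c = mat_unit n l a c"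
  by (rule eq_matI) (simp_all add: mat_unit_mult_index del: index_mult_mat(1))

lemma mat_unit_sandwich:
  fixes U V :: "complex mat"
  assumes "dim_col U = k" "dim_row V = s" "a < k" "b < s" "i < dim_row U" "j < dim_col V"
  shows "(U * (mat_unit k s a b * V)) $$ (i, j) = U $$ (i, a) * V $$ (b, j)"
proof -
  have "(U * (mat_unit k s a b * V)) $$ (i, j) = (\<Sum>l<k. U $$ (i, l) * (mat_unit k s a b * V) $$ (l, j))"
    using assms by (subst mat_mult_index) auto
  also have "\<dots> = (\<Sum>l<k. if l = a then U $$ (i, a) * V $$ (b, j) else 0)"
    using assms by (intro sum.cong refl) (simp add: mat_unit_mult_index del: index_mult_mat(1))
  finally show ?thesis using assms by simp
qed

lemma mat_unit_sum: "mat_sum n n (\<lambda>i. mat_unit n n i i) {..<n} = 1\<^sub>m n"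
  by (rule eq_matI) auto

lemma mat_projection_mat_unit: "a < n \<Longrightarrow> mat_projection n (mat_unit n n a a)"
  by (simp add: mat_projection_def mat_unit_mult)

text \<open>A partial isometry from \<open>S0\<close> to \<open>P0\<close> that intertwines the representations.\<close>
definition partial_intertwiner where
  "partial_intertwiner G k \<pi> P0 s \<sigma> S0 T \<longleftrightarrow> T \<in> carrier_mat k s
     \<and> (\<forall>g\<in>carrier G. \<pi> g * T = T * \<sigma> g) \<and> T * (mat_adjoint T * T) = T \<and> P0 * T = T \<and> T * S0 = T"

lemma partial_intertwiner_projection:
  assumes "partial_intertwiner G k \<pi> P0 s \<sigma> S0 T"
  shows "mat_projection s (mat_adjoint T * T)"
  using assms by (auto simp: partial_intertwiner_def mat_projection_def mat_adjoint_mult mat_assoc)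

lemma partial_intertwiner_adjoint:
  assumes G: "group G" and \<pi>: "unitary_rep G k \<pi>" and \<sigma>: "unitary_rep G s \<sigma>"
    and T: "T \<in> carrier_mat k s" "\<And>g. g \<in> carrier G \<Longrightarrow> \<pi> g * T = T * \<sigma> g" and g: "g \<in> carrier G"
  shows "mat_adjoint T * \<pi> g = \<sigma> g * mat_adjoint T"
proof -
  interpret group G by (rule G)
  note p = unitary_repD[OF \<pi> g] note s = unitary_repD[OF \<sigma> g]
  have "mat_adjoint (\<pi> (inv\<^bsub>G\<^esub> g) * T) = mat_adjoint (T * \<sigma> (inv\<^bsub>G\<^esub> g))"
    using T(2)[of "inv\<^bsub>G\<^esub> g"] g by simp
  then show ?thesis
    using T(1) p s by (simp add: mat_adjoint_mult unitary_rep_inv[OF G \<pi> g] unitary_rep_inv[OF G \<sigma> g])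
qed

text \<open>
  A partial intertwiner \<open>T\<close> can be enlarged by an intertwiner \<open>Y\<close> between the complements of its
  initial and final projections: a nonzero eigenprojection \<open>E\<close> of \<open>Y\<^sup>* Y\<close>, with eigenvalue \<open>l\<close>, is
  invariant, and \<open>Y E / sqrt l\<close> is a partial isometry with initial projection \<open>E\<close>.
\<close>
lemma partial_intertwiner_enlarge:
  assumes G: "group G" and \<pi>: "unitary_rep G k \<pi>" and \<sigma>: "unitary_rep G s \<sigma>"
    and P0: "mat_projection k P0" and S0: "mat_projection s S0"
    and T: "partial_intertwiner G k \<pi> P0 s \<sigma> S0 T"
    and Y: "Y \<in> carrier_mat k s" "\<And>g. g \<in> carrier G \<Longrightarrow> \<pi> g * Y = Y * \<sigma> g"
      "(P0 - T * mat_adjoint T) * Y = Y" "Y * (S0 - mat_adjoint T * T) = Y" "Y \<noteq> 0\<^sub>m k s"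
  obtains T' where "partial_intertwiner G k \<pi> P0 s \<sigma> S0 T'"
    "Re (mat_trace (mat_adjoint T * T)) < Re (mat_trace (mat_adjoint T' * T'))"
proof -
  have T: "T \<in> carrier_mat k s" "\<And>g. g \<in> carrier G \<Longrightarrow> \<pi> g * T = T * \<sigma> g"
    "T * (mat_adjoint T * T) = T" "P0 * T = T" "T * S0 = T"
    using T by (auto simp: partial_intertwiner_def)
  note d [simp] = carrier_matD[OF T(1)] carrier_matD[OF Y(1)] mat_projectionD(2,3)[OF P0] mat_projectionD(2,3)[OF S0]
  note P0' = mat_projectionD(4,5)[OF P0] note S0' = mat_projectionD(4,5)[OF S0]
  have Ta: "mat_adjoint T * P0 = mat_adjoint T" "S0 * mat_adjoint T = mat_adjoint T"
    "mat_adjoint T * (T * mat_adjoint T) = mat_adjoint T"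
    using arg_cong[OF T(4), of mat_adjoint] arg_cong[OF T(5), of mat_adjoint] arg_cong[OF T(3), of mat_adjoint]
    by (simp_all add: mat_adjoint_mult P0' S0' mat_assoc)
  define H where "H = mat_adjoint Y * Y"
  have H: "H \<in> carrier_mat s s" "mat_adjoint H = H" by (auto simp: H_def mat_adjoint_mult)
  note Hd [simp] = carrier_matD[OF H(1)]
  have "H \<noteq> 0\<^sub>m s s"
    using mat_adjoint_mult_eq_0[of Y] Y(5) by (auto simp: H_def)
  from hermitian_eigenprojection[OF H this] obtain l E where l: "l \<noteq> 0" and E: "mat_projection s E" "E \<noteq> 0\<^sub>m s s"
    "H * E = complex_of_real l \<cdot>\<^sub>m E" and comm: "\<And>B. B \<in> carrier_mat s s \<Longrightarrow> H * B = B * H \<Longrightarrow> E * B = B * E"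
    by blast
  note Ed [simp] = mat_projectionD(2-5)[OF E(1)]
  have trE: "Re (mat_trace E) > 0"
    using mat_projection_trace_nonneg[OF E(1)] mat_projection_trace_eq_0[OF E(1)] E(2)
    by (force simp: complex_eq_iff)
  have YE: "mat_adjoint (Y * E) * (Y * E) = complex_of_real l \<cdot>\<^sub>m E"
  proof -
    have "mat_adjoint (Y * E) * (Y * E) = E * (H * E)" by (simp add: mat_adjoint_mult mat_assoc H_def)
    then show ?thesis by (simp add: E(3) mat_distribs)
  qed
  have "l * Re (mat_trace E) \<ge> 0"
    using mat_trace_adjoint_mult_nonneg(1)[of "Y * E"] unfolding YE by simp
  with trE l have l0: "l > 0" by (simp add: zero_le_mult_iff)
  define r where "r = complex_of_real (1 / sqrt l)"
  have r: "cnj r = r" "r * r * complex_of_real l = 1" "r * r = 1 / complex_of_real l"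
    using l0 by (auto simp: r_def simp flip: of_real_mult)
  define Z where "Z = r \<cdot>\<^sub>m (Y * E)"
  have Zd [simp]: "dim_row Z = k" "dim_col Z = s" by (simp_all add: Z_def)
  have ZZ: "mat_adjoint Z * Z = E"
  proof -
    have "mat_adjoint Z * Z = r \<cdot>\<^sub>m (r \<cdot>\<^sub>m (mat_adjoint (Y * E) * (Y * E)))" by (simp add: Z_def r mat_distribs)
    also have "\<dots> = (r * r * complex_of_real l) \<cdot>\<^sub>m E" unfolding YE by (intro eq_matI) (auto simp: algebra_simps)
    also have "\<dots> = E" using r by (auto intro!: eq_matI)
    finally show ?thesis .
  qed
  have ZE: "Z * E = Z" by (simp add: Z_def mat_assoc mat_distribs)
  have PY: "P0 * Y = Y" and TY: "mat_adjoint T * Y = 0\<^sub>m s s"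
  proof -
    have "P0 * Y = P0 * ((P0 - T * mat_adjoint T) * Y)" by (simp add: Y(3))
    also have "\<dots> = (P0 - T * mat_adjoint T) * Y"
      by (simp add: mat_distribs mat_assoc mat_absorb[OF P0'(2)] mat_absorb[OF T(4)])
    finally show "P0 * Y = Y" by (simp add: Y(3))
    have "mat_adjoint T * Y = mat_adjoint T * ((P0 - T * mat_adjoint T) * Y)" by (simp add: Y(3))
    also have "\<dots> = mat_adjoint T * Y - (mat_adjoint T * (T * mat_adjoint T)) * Y"
      by (simp add: mat_distribs mat_assoc mat_absorb[OF Ta(1)])
    finally show "mat_adjoint T * Y = 0\<^sub>m s s" by (simp add: Ta)
  qed
  have YS: "Y * S0 = Y" and YT: "Y * (mat_adjoint T * T) = 0\<^sub>m k s"
  proof -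
    have "(Y * (S0 - mat_adjoint T * T)) * S0 = Y * (S0 - mat_adjoint T * T)"
      by (simp add: mat_distribs mat_assoc S0' T(5))
    then show "Y * S0 = Y" by (simp add: Y(4))
    have "Y * (mat_adjoint T * T) = (Y * (S0 - mat_adjoint T * T)) * (mat_adjoint T * T)" by (simp add: Y(4))
    also have "\<dots> = Y * (mat_adjoint T * T) - Y * (mat_adjoint T * (T * (mat_adjoint T * T)))"
      by (simp add: mat_distribs mat_assoc mat_absorb[OF Ta(2)])
    finally show "Y * (mat_adjoint T * T) = 0\<^sub>m k s" by (simp add: T)
  qed
  have E_eq: "E = complex_of_real (1 / l) \<cdot>\<^sub>m (H * E)" using l unfolding E(3) by (auto intro!: eq_matI)
  have TE: "T * E = 0\<^sub>m k s"
  proof -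
    have "mat_adjoint (Y * (mat_adjoint T * T)) = 0\<^sub>m s k" by (simp add: YT)
    then have "mat_adjoint T * (T * mat_adjoint Y) = 0\<^sub>m s k" by (simp add: mat_adjoint_mult mat_assoc)
    then have "T * (mat_adjoint T * (T * mat_adjoint Y)) = 0\<^sub>m k k" by simp
    then have "T * mat_adjoint Y = 0\<^sub>m k k" using mat_absorb[OF T(3), of "mat_adjoint Y"] by (simp add: mat_assoc)
    from mat_absorb[OF this, of "Y * E"] have "T * (H * E) = 0\<^sub>m k s" by (simp add: H_def mat_assoc)
    then show ?thesis by (subst E_eq) (simp add: mat_distribs smult_zero_mat)
  qed
  have ES: "E * S0 = E"
  proof -
    have SY: "S0 * mat_adjoint Y = mat_adjoint Y"
      using arg_cong[OF YS, of mat_adjoint] by (simp add: mat_adjoint_mult S0')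
    have "S0 * (H * E) = H * E" by (simp add: H_def mat_assoc mat_absorb[OF SY])
    moreover have "S0 * E = complex_of_real (1 / l) \<cdot>\<^sub>m (S0 * (H * E))"
      using arg_cong[OF E_eq, of "\<lambda>M. S0 * M"] by (simp add: mat_distribs)
    ultimately have "S0 * E = E" by (simp only: E_eq[symmetric])
    from arg_cong[OF this, of mat_adjoint] show ?thesis by (simp add: mat_adjoint_mult S0')
  qed
  have TZ: "mat_adjoint T * Z = 0\<^sub>m s s" by (simp add: Z_def mat_distribs mat_absorb[OF TY] smult_zero_mat)
  have ZT: "mat_adjoint Z * T = 0\<^sub>m s s"
    using arg_cong[OF TZ, of mat_adjoint] by (simp add: mat_adjoint_mult)
  let ?T' = "T + Z"
  have init: "mat_adjoint ?T' * ?T' = mat_adjoint T * T + E"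
    by (simp add: mat_distribs ZZ ZT TZ)
  have "partial_intertwiner G k \<pi> P0 s \<sigma> S0 ?T'"
    unfolding partial_intertwiner_def
  proof (intro conjI ballI)
    fix g assume g: "g \<in> carrier G"
    note p = unitary_repD[OF \<pi> g] note sg = unitary_repD[OF \<sigma> g]
    have adjY: "mat_adjoint Y * \<pi> g = \<sigma> g * mat_adjoint Y"
      by (rule partial_intertwiner_adjoint[OF G \<pi> \<sigma> Y(1) Y(2) g])
    have "H * \<sigma> g = mat_adjoint Y * (\<pi> g * Y)" using sg(2) by (simp add: H_def mat_assoc Y(2)[OF g])
    also have "\<dots> = (mat_adjoint Y * \<pi> g) * Y" using p(2,3) by (simp add: mat_assoc)
    also have "\<dots> = \<sigma> g * H"
      using sg(3) by (simp add: adjY H_def mat_assoc)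
    finally have "E * \<sigma> g = \<sigma> g * E" using comm sg(1) by blast
    then have "\<pi> g * Z = Z * \<sigma> g"
      using p sg by (simp add: Z_def mat_distribs mat_assoc mat_absorb[OF Y(2)[OF g]])
    then show "\<pi> g * ?T' = ?T' * \<sigma> g" using T(2)[OF g] p sg by (simp add: mat_distribs)
  next
    have "Z * (mat_adjoint T * T) = 0\<^sub>m k s"
    proof -
      have "mat_adjoint T * (T * E) = 0\<^sub>m s s" by (simp add: TE)
      from arg_cong[OF this, of mat_adjoint] have "E * (mat_adjoint T * T) = 0\<^sub>m s s"
        by (simp add: mat_adjoint_mult mat_assoc)
      then show ?thesis using mat_absorb[OF ZE, of "mat_adjoint T * T"] by simp
    qed
    then show "?T' * (mat_adjoint ?T' * ?T') = ?T'"
      unfolding init by (simp add: mat_distribs T(3) TE ZE)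
    show "P0 * ?T' = ?T'" by (simp add: mat_distribs T(4) Z_def mat_absorb[OF PY])
    show "?T' * S0 = ?T'" by (simp add: mat_distribs T(5) Z_def mat_assoc ES)
  qed auto
  moreover have "Re (mat_trace (mat_adjoint T * T)) < Re (mat_trace (mat_adjoint ?T' * ?T'))"
    unfolding init using trE by simp
  ultimately show ?thesis using that by blast
qed

text \<open>
  Two representations are compared by a maximal partial intertwiner \<open>T\<close>. By maximality there is no
  nonzero intertwiner between the complements of its initial and final projections. In particular
  the averages \<open>\<Sum> \<pi> g X (\<sigma> g)\<^sup>*\<close> of the matrix units \<open>X\<close>, cut down to these complements, vanish;
  summing their entries gives the orthogonality of the characters of the complements.
\<close>
lemma maximal_partial_intertwiner:
  assumes G: "group G" "finite (carrier G)" and \<pi>: "unitary_rep G k \<pi>" and \<sigma>: "unitary_rep G s \<sigma>"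
    and P0: "mat_projection k P0" "\<And>g. g \<in> carrier G \<Longrightarrow> \<pi> g * P0 = P0 * \<pi> g"
    and S0: "mat_projection s S0" "\<And>g. g \<in> carrier G \<Longrightarrow> \<sigma> g * S0 = S0 * \<sigma> g"
  obtains T where "partial_intertwiner G k \<pi> P0 s \<sigma> S0 T"
    "(\<Sum>g\<in>carrier G. mat_trace (\<pi> g * (P0 - T * mat_adjoint T)) * cnj (mat_trace (\<sigma> g * (S0 - mat_adjoint T * T)))) = 0"
proof -
  let ?good = "partial_intertwiner G k \<pi> P0 s \<sigma> S0"
  let ?m = "\<lambda>T. nat \<lfloor>Re (mat_trace (mat_adjoint T * T))\<rfloor>"
  have m: "Re (mat_trace (mat_adjoint T * T)) = real (?m T) \<and> ?m T < Suc s" if T: "?good T" for T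
  proof -
    note P = partial_intertwiner_projection[OF T]
    have d: "dim_row (mat_adjoint T * T) = s" "dim_col (mat_adjoint T * T) = s" using mat_projectionD[OF P] by auto
    obtain n where n: "mat_trace (mat_adjoint T * T) = of_nat n" using mat_projection_trace_nat[OF P] .
    have "0 \<le> Re (mat_trace (1\<^sub>m s - mat_adjoint T * T))"
      by (rule mat_projection_trace_nonneg[OF mat_projection_one_minus[OF P]])
    then have "n \<le> s" using d n by simp
    then show ?thesis by (simp add: n)
  qed
  have "?good (0\<^sub>m k s)"
    using mat_projectionD[OF P0(1)] mat_projectionD[OF S0(1)] unitary_repD(2,3)[OF \<pi>] unitary_repD(2,3)[OF \<sigma>]
    by (auto simp: partial_intertwiner_def)
  from ex_has_greatest_nat[of ?good, OF this, of ?m "Suc s"] m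
  obtain T where T: "?good T" and max: "\<And>T'. ?good T' \<Longrightarrow> ?m T' \<le> ?m T" by auto
  have Td [simp]: "dim_row T = k" "dim_col T = s"
    and Ti: "\<And>g. g \<in> carrier G \<Longrightarrow> \<pi> g * T = T * \<sigma> g" and Tc: "T \<in> carrier_mat k s"
    and T': "T * (mat_adjoint T * T) = T" "P0 * T = T" "T * S0 = T"
    using T by (auto simp: partial_intertwiner_def)
  note d [simp] = mat_projectionD(2,3)[OF P0(1)] mat_projectionD(2,3)[OF S0(1)]
  have Ta: "mat_adjoint T * P0 = mat_adjoint T" "S0 * mat_adjoint T = mat_adjoint T"
    "mat_adjoint T * (T * mat_adjoint T) = mat_adjoint T"
    using arg_cong[OF T'(2), of mat_adjoint] arg_cong[OF T'(3), of mat_adjoint] arg_cong[OF T'(1), of mat_adjoint]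
    by (simp_all add: mat_adjoint_mult mat_projectionD(4)[OF P0(1)] mat_projectionD(4)[OF S0(1)] mat_assoc)
  define Q where "Q = P0 - T * mat_adjoint T"
  define P where "P = S0 - mat_adjoint T * T"
  have Qd [simp]: "dim_row Q = k" "dim_col Q = k" and Pd [simp]: "dim_row P = s" "dim_col P = s" by (simp_all add: Q_def P_def)
  have QQ: "Q * Q = Q" and PP: "P * P = P" and Padj: "mat_adjoint P = P"
    by (simp_all add: Q_def P_def mat_distribs mat_assoc mat_adjoint_mult mat_projectionD(4,5)[OF P0(1)]
        mat_projectionD(4,5)[OF S0(1)] T' Ta mat_absorb[OF T'(2)] mat_absorb[OF T'(3)] mat_absorb[OF Ta(1)] mat_absorb[OF Ta(2)])
  have Qcomm: "\<pi> g * Q = Q * \<pi> g" and Pcomm: "\<sigma> g * P = P * \<sigma> g" if g: "g \<in> carrier G" for g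
  proof -
    note p = unitary_repD[OF \<pi> g] note sg = unitary_repD[OF \<sigma> g]
    have adjT: "mat_adjoint T * \<pi> g = \<sigma> g * mat_adjoint T"
      by (rule partial_intertwiner_adjoint[OF G(1) \<pi> \<sigma> Tc Ti g])
    show "\<pi> g * Q = Q * \<pi> g"
      using p sg by (simp add: Q_def mat_distribs P0(2)[OF g] mat_assoc adjT mat_absorb[OF Ti[OF g]])
    show "\<sigma> g * P = P * \<sigma> g"
      using p sg by (simp add: P_def mat_distribs S0(2)[OF g] mat_assoc Ti[OF g, symmetric] mat_absorb[OF adjT])
  qed
  have zero: "(\<Sum>g\<in>carrier G. (Q * \<pi> g) $$ (i, a) * (mat_adjoint (\<sigma> g) * P) $$ (b, j)) = 0"
    if ij: "i < k" "a < k" "b < s" "j < s" for i a b j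
  proof (rule ccontr)
    assume nonzero: "(\<Sum>g\<in>carrier G. (Q * \<pi> g) $$ (i, a) * (mat_adjoint (\<sigma> g) * P) $$ (b, j)) \<noteq> 0"
    define X where "X = mat_unit k s a b"
    have Xd [simp]: "dim_row X = k" "dim_col X = s" by (simp_all add: X_def)
    define f where "f g = (Q * \<pi> g) * (X * (mat_adjoint (\<sigma> g) * P))" for g
    define Y where "Y = mat_sum k s f (carrier G)"
    have fd: "dim_row (f g) = k" "dim_col (f g) = s" for g by (simp_all add: f_def)
    have fc: "f g \<in> carrier_mat k s" for g using fd by (intro carrier_matI)
    have "Y $$ (i, j) = (\<Sum>g\<in>carrier G. f g $$ (i, j))" using ij by (simp add: Y_def)
    also have "\<dots> = (\<Sum>g\<in>carrier G. (Q * \<pi> g) $$ (i, a) * (mat_adjoint (\<sigma> g) * P) $$ (b, j))"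
    proof (rule sum.cong[OF refl])
      fix g assume g: "g \<in> carrier G"
      note p = unitary_repD[OF \<pi> g] note sg = unitary_repD[OF \<sigma> g]
      show "f g $$ (i, j) = (Q * \<pi> g) $$ (i, a) * (mat_adjoint (\<sigma> g) * P) $$ (b, j)"
        unfolding f_def X_def using ij p sg by (intro mat_unit_sandwich) auto
    qed
    finally have "Y \<noteq> 0\<^sub>m k s" using nonzero ij by (metis index_zero_mat(1))
    moreover have "Y \<in> carrier_mat k s" by (auto simp: Y_def)
    moreover have "Q * Y = Y"
    proof -
      have "Q * Y = mat_sum k s (\<lambda>g. Q * f g) (carrier G)"
        unfolding Y_def using fc by (subst mat_sum_mult_left) auto
      also have "\<dots> = Y" unfolding Y_def
      proof (rule mat_sum_cong[OF refl])
        fix g assume g: "g \<in> carrier G"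
        note p = unitary_repD[OF \<pi> g] note sg = unitary_repD[OF \<sigma> g]
        show "Q * f g = f g" unfolding f_def using p sg by (simp add: mat_assoc mat_absorb[OF QQ])
      qed
      finally show ?thesis .
    qed
    moreover have "Y * P = Y"
    proof -
      have "Y * P = mat_sum k s (\<lambda>g. f g * P) (carrier G)"
        unfolding Y_def using fc by (subst mat_sum_mult_right) auto
      also have "\<dots> = Y" unfolding Y_def
      proof (rule mat_sum_cong[OF refl])
        fix g assume g: "g \<in> carrier G"
        note p = unitary_repD[OF \<pi> g] note sg = unitary_repD[OF \<sigma> g]
        show "f g * P = f g" unfolding f_def using p sg by (simp add: mat_assoc PP)
      qed
      finally show ?thesis .
    qed
    moreover have "\<pi> h * Y = Y * \<sigma> h" if h: "h \<in> carrier G" for h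
    proof -
      interpret group G by (rule G(1))
      note ph = unitary_repD[OF \<pi> h] note sh = unitary_repD[OF \<sigma> h]
      have bij: "bij_betw (\<lambda>g. h \<otimes>\<^bsub>G\<^esub> g) (carrier G) (carrier G)"
        by (rule bij_betwI[where g = "\<lambda>g. inv\<^bsub>G\<^esub> h \<otimes>\<^bsub>G\<^esub> g"]) (use h in \<open>auto simp flip: m_assoc\<close>)
      have "Y * \<sigma> h = mat_sum k s (\<lambda>g. f g * \<sigma> h) (carrier G)"
        unfolding Y_def using fc sh by (subst mat_sum_mult_right) auto
      also have "\<dots> = mat_sum k s (\<lambda>g. f (h \<otimes>\<^bsub>G\<^esub> g) * \<sigma> h) (carrier G)"
        by (rule mat_sum_reindex[OF bij, symmetric])
      also have "\<dots> = mat_sum k s (\<lambda>g. \<pi> h * f g) (carrier G)"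
      proof (rule mat_sum_cong[OF refl])
        fix g assume g: "g \<in> carrier G"
        note p = unitary_repD[OF \<pi> g] note sg = unitary_repD[OF \<sigma> g]
        show "f (h \<otimes>\<^bsub>G\<^esub> g) * \<sigma> h = \<pi> h * f g"
          unfolding f_def ph(5)[OF g] sh(5)[OF g] using p(2,3) sg(2,3) ph(2,3) sh(2,3)
          by (simp add: mat_assoc mat_adjoint_mult Pcomm[OF h, symmetric] mat_absorb[OF Qcomm[OF h]]
              mat_unitaryD(7)[OF sh(4)])
      qed
      also have "\<dots> = \<pi> h * Y" unfolding Y_def using fc ph by (subst mat_sum_mult_left) auto
      finally show ?thesis by simp
    qed
    ultimately obtain T2 where "?good T2" "Re (mat_trace (mat_adjoint T * T)) < Re (mat_trace (mat_adjoint T2 * T2))"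
      using partial_intertwiner_enlarge[OF G(1) \<pi> \<sigma> P0(1) S0(1) T, of Y] by (auto simp: Q_def P_def)
    with max[of T2] m[of T2] m[OF T] show False by (metis leD of_nat_less_iff)
  qed
  have "(\<Sum>g\<in>carrier G. mat_trace (\<pi> g * Q) * cnj (mat_trace (\<sigma> g * P)))
    = (\<Sum>g\<in>carrier G. \<Sum>i<k. \<Sum>b<s. (Q * \<pi> g) $$ (i, i) * (mat_adjoint (\<sigma> g) * P) $$ (b, b))"
  proof (rule sum.cong[OF refl])
    fix g assume g: "g \<in> carrier G"
    note p = unitary_repD[OF \<pi> g] note sg = unitary_repD[OF \<sigma> g]
    have "mat_trace (\<pi> g * Q) = (\<Sum>i<k. (Q * \<pi> g) $$ (i, i))"
      unfolding Qcomm[OF g] by (simp add: mat_trace_def)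
    moreover have "cnj (mat_trace (\<sigma> g * P)) = mat_trace (mat_adjoint (\<sigma> g) * P)"
    proof -
      have "cnj (mat_trace (\<sigma> g * P)) = mat_trace (mat_adjoint (P * \<sigma> g))"
        unfolding Pcomm[OF g] using sg by simp
      then show ?thesis using sg by (simp add: mat_adjoint_mult Padj)
    qed
    moreover have "mat_trace (mat_adjoint (\<sigma> g) * P) = (\<Sum>b<s. (mat_adjoint (\<sigma> g) * P) $$ (b, b))"
      using sg by (simp add: mat_trace_def)
    ultimately show "mat_trace (\<pi> g * Q) * cnj (mat_trace (\<sigma> g * P))
      = (\<Sum>i<k. \<Sum>b<s. (Q * \<pi> g) $$ (i, i) * (mat_adjoint (\<sigma> g) * P) $$ (b, b))"
      by (simp only: sum_product)
  qed
  also have "\<dots> = (\<Sum>i<k. \<Sum>b<s. \<Sum>g\<in>carrier G. (Q * \<pi> g) $$ (i, i) * (mat_adjoint (\<sigma> g) * P) $$ (b, b))"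
    by (subst sum.swap, intro sum.cong refl, rule sum.swap)
  also have "\<dots> = 0" by (intro sum.neutral ballI zero) auto
  finally show ?thesis using that[OF T] by (simp add: Q_def P_def)
qed

text \<open>
  For the trivial representations of a one-element group, the orthogonality of the characters says
  that one of the two complements has trace 0; this is the comparison of projections.
\<close>
lemma mat_projection_compare:
  assumes P: "mat_projection n P" and S: "mat_projection n S" and le: "Re (mat_trace S) \<le> Re (mat_trace P)"
  obtains s where "s \<in> carrier_mat n n" "s * mat_adjoint s = S" "s * P = s"
proof -
  define G :: "unit monoid" where "G = \<lparr>carrier = UNIV, monoid.mult = (\<lambda>_ _. ()), one = ()\<rparr>"
  have G: "group G" by (rule groupI) (auto simp: G_def)
  have rep: "unitary_rep G n (\<lambda>_. 1\<^sub>m n)" by (auto simp: unitary_rep_def)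
  note Pd = mat_projectionD[OF P] note Sd = mat_projectionD[OF S]
  obtain T where T: "partial_intertwiner G n (\<lambda>_. 1\<^sub>m n) P n (\<lambda>_. 1\<^sub>m n) S T"
    and sum: "(\<Sum>g\<in>carrier G. mat_trace (1\<^sub>m n * (P - T * mat_adjoint T)) * cnj (mat_trace (1\<^sub>m n * (S - mat_adjoint T * T)))) = 0"
    using maximal_partial_intertwiner[OF G _ rep rep P _ S] Pd Sd by (auto simp: G_def)
  have T': "T \<in> carrier_mat n n" "T * (mat_adjoint T * T) = T" "P * T = T" "T * S = T"
    using T by (auto simp: partial_intertwiner_def)
  note d [simp] = carrier_matD[OF T'(1)] Pd(2,3) Sd(2,3)
  have ST: "S * mat_adjoint T = mat_adjoint T" and TP: "mat_adjoint T * P = mat_adjoint T"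
    using arg_cong[OF T'(4), of mat_adjoint] arg_cong[OF T'(3), of mat_adjoint] by (simp_all add: mat_adjoint_mult Pd(4) Sd(4))
  have proj: "mat_projection n (S - mat_adjoint T * T)"
    by (auto simp: mat_projection_def mat_adjoint_mult mat_distribs mat_assoc Sd(4,5) T' mat_absorb[OF ST])
  have tr: "mat_trace (T * mat_adjoint T) = mat_trace (mat_adjoint T * T)" by (rule mat_trace_commute) simp_all
  have "mat_trace (P - T * mat_adjoint T) = 0 \<or> mat_trace (S - mat_adjoint T * T) = 0"
    using sum by (simp add: G_def)
  then have "mat_trace (S - mat_adjoint T * T) = 0"
  proof
    assume "mat_trace (P - T * mat_adjoint T) = 0"
    then have "Re (mat_trace (S - mat_adjoint T * T)) \<le> 0" using le by (simp add: tr complex_eq_iff)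
    then show ?thesis using mat_projection_trace_nonneg[OF proj] by (simp add: complex_eq_iff)
  qed
  then have "S - mat_adjoint T * T = 0\<^sub>m n n" by (rule mat_projection_trace_eq_0[OF proj])
  then have eq: "(S - mat_adjoint T * T) $$ (i, j) = 0" if "i < n" "j < n" for i j using that by simp
  have "S = mat_adjoint T * T"
    by (rule eq_matI) (use eq in \<open>auto simp del: index_mult_mat(1)\<close>)
  then show ?thesis using that[of "mat_adjoint T"] TP d by (metis carrier_matI mat_adjoint_adjoint mat_adjoint_dim)
qed

section \<open>Tensor products of matrices\<close>

lemma mat_tensor_dim [simp]:
  "dim_row (mat_tensor A B) = dim_row A * dim_row B" "dim_col (mat_tensor A B) = dim_col A * dim_col B"
  by (simp_all add: mat_tensor_def)

lemma mat_tensor_index: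
  "i < dim_row A * dim_row B \<Longrightarrow> j < dim_col A * dim_col B \<Longrightarrow>
    mat_tensor A B $$ (i, j) = A $$ (i div dim_row B, j div dim_col B) * B $$ (i mod dim_row B, j mod dim_col B)"
  by (simp add: mat_tensor_def)

lemma div_mod_bounds:
  assumes "(i::nat) < n * m"
  shows "i div m < n" "i mod m < m"
  using assms by (auto simp: less_mult_imp_div_less intro!: mod_less_divisor) (cases m; simp)

lemma sum_div_mod:
  fixes f :: "nat \<Rightarrow> nat \<Rightarrow> 'a::comm_monoid_add"
  shows "(\<Sum>l<n * m. f (l div m) (l mod m)) = (\<Sum>i<n. \<Sum>j<m. f i j)"
proof -
  have "(\<Sum>l<n * m. f (l div m) (l mod m)) = (\<Sum>i<n. \<Sum>l\<in>{i * m..<i * m + m}. f (l div m) (l mod m))"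
    by (rule sum.nat_group[symmetric])
  also have "\<dots> = (\<Sum>i<n. \<Sum>j<m. f i j)"
  proof (rule sum.cong[OF refl])
    fix i
    have "(\<Sum>l\<in>{i * m..<i * m + m}. f (l div m) (l mod m)) = (\<Sum>j\<in>{0..<m}. f ((j + i * m) div m) ((j + i * m) mod m))"
      using sum.shift_bounds_nat_ivl[of "\<lambda>l. f (l div m) (l mod m)" 0 "i * m" m] by (simp add: add.commute)
    also have "\<dots> = (\<Sum>j<m. f i j)" by (intro sum.cong) auto
    finally show "(\<Sum>l\<in>{i * m..<i * m + m}. f (l div m) (l mod m)) = (\<Sum>j<m. f i j)" .
  qed
  finally show ?thesis .
qed

lemma mat_tensor_mult:
  assumes "dim_col A = dim_row C" "dim_col B = dim_row D"
  shows "mat_tensor A B * mat_tensor C D = mat_tensor (A * C) (B * D)"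
proof (rule eq_matI)
  fix i j assume ij: "i < dim_row (mat_tensor (A * C) (B * D))" "j < dim_col (mat_tensor (A * C) (B * D))"
  then have i: "i div dim_row B < dim_row A" "i mod dim_row B < dim_row B" and j: "j div dim_col D < dim_col C" "j mod dim_col D < dim_col D"
    using div_mod_bounds by auto
  have "(mat_tensor A B * mat_tensor C D) $$ (i, j)
    = (\<Sum>l<dim_row C * dim_row D. mat_tensor A B $$ (i, l) * mat_tensor C D $$ (l, j))"
    using ij assms by (subst mat_mult_index) auto
  also have "\<dots> = (\<Sum>l<dim_row C * dim_row D. (A $$ (i div dim_row B, l div dim_row D) * C $$ (l div dim_row D, j div dim_col D))
        * (B $$ (i mod dim_row B, l mod dim_row D) * D $$ (l mod dim_row D, j mod dim_col D)))"
    using ij assms by (intro sum.cong) (auto simp: mat_tensor_index)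
  also have "\<dots> = (\<Sum>a<dim_row C. \<Sum>b<dim_row D. (A $$ (i div dim_row B, a) * C $$ (a, j div dim_col D))
        * (B $$ (i mod dim_row B, b) * D $$ (b, j mod dim_col D)))"
    by (rule sum_div_mod)
  also have "\<dots> = (A * C) $$ (i div dim_row B, j div dim_col D) * (B * D) $$ (i mod dim_row B, j mod dim_col D)"
    using i j assms by (simp add: mat_mult_index sum_product del: index_mult_mat(1))
  also have "\<dots> = mat_tensor (A * C) (B * D) $$ (i, j)"
    using ij by (simp add: mat_tensor_index)
  finally show "(mat_tensor A B * mat_tensor C D) $$ (i, j) = mat_tensor (A * C) (B * D) $$ (i, j)" .
qed auto

lemma mat_tensor_adjoint [simp]: "mat_adjoint (mat_tensor A B) = mat_tensor (mat_adjoint A) (mat_adjoint B)"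
  by (rule eq_matI) (auto simp: mat_tensor_index div_mod_bounds)

lemma mat_tensor_one [simp]: "mat_tensor (1\<^sub>m n) (1\<^sub>m m) = 1\<^sub>m (n * m)"
proof (rule eq_matI)
  fix i j assume "i < dim_row (1\<^sub>m (n * m) :: complex mat)" "j < dim_col (1\<^sub>m (n * m) :: complex mat)"
  then have ij: "i < n * m" "j < n * m" by auto
  have "i div m = j div m \<and> i mod m = j mod m \<longleftrightarrow> i = j" by (metis div_mult_mod_eq)
  then show "mat_tensor (1\<^sub>m n) (1\<^sub>m m) $$ (i, j) = 1\<^sub>m (n * m) $$ (i, j)"
    using ij div_mod_bounds[OF ij(1)] div_mod_bounds[OF ij(2)] by (auto simp: mat_tensor_index)
qed auto

lemma mat_tensor_trace:
  assumes "dim_col A = dim_row A" "dim_col B = dim_row B"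
  shows "mat_trace (mat_tensor A B) = mat_trace A * mat_trace B"
proof -
  have "mat_trace (mat_tensor A B) = (\<Sum>i<dim_row A * dim_row B. A $$ (i div dim_row B, i div dim_row B) * B $$ (i mod dim_row B, i mod dim_row B))"
    unfolding mat_trace_def using assms by (intro sum.cong) (auto simp: mat_tensor_index)
  also have "\<dots> = (\<Sum>i<dim_row A. \<Sum>j<dim_row B. A $$ (i, i) * B $$ (j, j))" by (rule sum_div_mod)
  finally show ?thesis by (simp add: mat_trace_def sum_product)
qed

lemma mat_tensor_assoc: "mat_tensor (mat_tensor A B) C = mat_tensor A (mat_tensor B C)"
proof (rule eq_matI)
  fix i j assume "i < dim_row (mat_tensor A (mat_tensor B C))" "j < dim_col (mat_tensor A (mat_tensor B C))"
  then have ij: "i < dim_row A * dim_row B * dim_row C" "j < dim_col A * dim_col B * dim_col C" by (simp_all add: mult.assoc)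
  have *: "i div c div b = i div (b * c)" "i div c mod b = i mod (b * c) div c" for i b c :: nat
    by (auto simp: div_mult2_eq mult.commute[of b] mod_mult2_eq) (cases "c = 0"; simp)
  have b: "i mod (dim_row B * dim_row C) < dim_row B * dim_row C" "j mod (dim_col B * dim_col C) < dim_col B * dim_col C"
    using ij div_mod_bounds(2)[of i "dim_row A" "dim_row B * dim_row C"] div_mod_bounds(2)[of j "dim_col A" "dim_col B * dim_col C"]
    by (auto simp: mult.assoc)
  show "mat_tensor (mat_tensor A B) C $$ (i, j) = mat_tensor A (mat_tensor B C) $$ (i, j)"
    using ij b div_mod_bounds[OF ij(1)] div_mod_bounds[OF ij(2)]
    by (simp add: mat_tensor_index mult.assoc * mod_mod_cancel)
qed (simp_all add: mult.assoc)

lemma mat_tensor_unit_left [simp]: "mat_tensor (1\<^sub>m 1) A = A" "mat_tensor (1\<^sub>m (Suc 0)) A = A"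
  by (rule eq_matI; simp add: mat_tensor_index)+

lemma mat_tensor_linear:
  "dim_row B = dim_row C \<Longrightarrow> dim_col B = dim_col C \<Longrightarrow> mat_tensor A (B + C) = mat_tensor A B + mat_tensor A C"
  "dim_row A = dim_row C \<Longrightarrow> dim_col A = dim_col C \<Longrightarrow> mat_tensor (A + C) B = mat_tensor A B + mat_tensor C B"
  "mat_tensor A (c \<cdot>\<^sub>m B) = c \<cdot>\<^sub>m mat_tensor A B"
  "mat_tensor (c \<cdot>\<^sub>m A) B = c \<cdot>\<^sub>m mat_tensor A B"
  by (rule eq_matI; simp add: mat_tensor_index div_mod_bounds algebra_simps)+

lemma mat_tensor_projection:
  "mat_projection n P \<Longrightarrow> mat_projection m Q \<Longrightarrow> mat_projection (n * m) (mat_tensor P Q)"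
  by (auto simp: mat_projection_def mat_tensor_mult intro!: carrier_matI)

section \<open>Towers of projections in a representation\<close>

text \<open>
  The regular representation with multiplicity \<open>M\<close>; the range of \<open>E h\<close> is spanned by the \<open>M\<close> copies of
  the basis vector that belongs to \<open>h\<close>.
\<close>

lemma regular_representation:
  assumes G: "group G" "finite (carrier G)"
  defines "N \<equiv> card (carrier G)"
  obtains \<sigma> E where "unitary_rep G (N * M) \<sigma>"
    "\<And>g. g \<in> carrier G \<Longrightarrow> mat_trace (\<sigma> g) = (if g = \<one>\<^bsub>G\<^esub> then of_nat (N * M) else 0)"
    "\<And>g. g \<in> carrier G \<Longrightarrow> mat_projection (N * M) (E g)"
    "\<And>g h. g \<in> carrier G \<Longrightarrow> h \<in> carrier G \<Longrightarrow> g \<noteq> h \<Longrightarrow> E g * E h = 0\<^sub>m (N * M) (N * M)"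
    "\<And>g h. g \<in> carrier G \<Longrightarrow> h \<in> carrier G \<Longrightarrow> \<sigma> g * E h = E (g \<otimes>\<^bsub>G\<^esub> h) * \<sigma> g"
    "\<And>g. g \<in> carrier G \<Longrightarrow> mat_trace (E g) = of_nat M"
proof -
  interpret group G by (rule G(1))
  obtain el where el: "bij_betw el {..<N} (carrier G)"
    using ex_bij_betw_nat_finite[OF G(2)] unfolding N_def atLeast0LessThan by blast
  have elc: "el i \<in> carrier G" if "i < N" for i using el that by (auto simp: bij_betw_def)
  have el_inj: "el i = el j \<longleftrightarrow> i = j" if "i < N" "j < N" for i j
    using el that by (auto simp: bij_betw_def inj_on_def)
  have sum_el: "(\<Sum>i<N. f (el i)) = (\<Sum>h\<in>carrier G. f h)" for f :: "'a \<Rightarrow> complex"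
    by (rule sum.reindex_bij_betw[OF el])
  define L where "L g = mat N N (\<lambda>(i, j). if el i = g \<otimes>\<^bsub>G\<^esub> el j then 1 else 0 :: complex)" for g
  define F where "F h = mat N N (\<lambda>(i, j). if i = j \<and> el i = h then 1 else 0 :: complex)" for h
  have Ld [simp]: "dim_row (L g) = N" "dim_col (L g) = N" and Fd [simp]: "dim_row (F g) = N" "dim_col (F g) = N" for g
    by (simp_all add: L_def F_def)
  have Lmult: "L (g \<otimes>\<^bsub>G\<^esub> h) = L g * L h" if g: "g \<in> carrier G" and h: "h \<in> carrier G" for g h
  proof (rule eq_matI)
    fix i j assume "i < dim_row (L g * L h)" "j < dim_col (L g * L h)"
    then have ij: "i < N" "j < N" by auto
    have "(L g * L h) $$ (i, j) = (\<Sum>l<N. L g $$ (i, l) * L h $$ (l, j))" using ij by (subst mat_mult_index) auto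
    also have "\<dots> = (\<Sum>l<N. if el l = h \<otimes>\<^bsub>G\<^esub> el j then (if el i = g \<otimes>\<^bsub>G\<^esub> el l then 1 else 0) else 0)"
      using ij by (intro sum.cong) (auto simp: L_def)
    also have "\<dots> = (\<Sum>l\<in>carrier G. if l = h \<otimes>\<^bsub>G\<^esub> el j then (if el i = g \<otimes>\<^bsub>G\<^esub> l then 1 else 0) else 0)"
      by (rule sum_el)
    also have "\<dots> = (if el i = g \<otimes>\<^bsub>G\<^esub> (h \<otimes>\<^bsub>G\<^esub> el j) then 1 else 0)"
      using G(2) h elc[OF ij(2)] by simp
    finally show "L (g \<otimes>\<^bsub>G\<^esub> h) $$ (i, j) = (L g * L h) $$ (i, j)"
      using ij g h elc[OF ij(2)] by (simp add: L_def m_assoc)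
  qed auto
  have L_one: "L \<one>\<^bsub>G\<^esub> = 1\<^sub>m N"
    by (rule eq_matI) (auto simp: L_def elc el_inj)
  have L_inv: "L (inv\<^bsub>G\<^esub> g) = mat_adjoint (L g)" if g: "g \<in> carrier G" for g
  proof (rule eq_matI)
    fix i j assume "i < dim_row (mat_adjoint (L g))" "j < dim_col (mat_adjoint (L g))"
    then have ij: "i < N" "j < N" by auto
    have "el i = inv\<^bsub>G\<^esub> g \<otimes>\<^bsub>G\<^esub> el j \<longleftrightarrow> el j = g \<otimes>\<^bsub>G\<^esub> el i"
      using g elc[OF ij(1)] elc[OF ij(2)] inv_solve_left by metis
    then show "L (inv\<^bsub>G\<^esub> g) $$ (i, j) = mat_adjoint (L g) $$ (i, j)"
      using ij by (simp add: L_def)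
  qed auto
  have L_unit: "L g * mat_adjoint (L g) = 1\<^sub>m N" "mat_adjoint (L g) * L g = 1\<^sub>m N" if g: "g \<in> carrier G" for g
    using Lmult[OF g inv_closed[OF g]] Lmult[OF inv_closed[OF g] g] g by (auto simp: L_inv L_one)
  have L_trace: "mat_trace (L g) = (if g = \<one>\<^bsub>G\<^esub> then of_nat N else 0)" if g: "g \<in> carrier G" for g
  proof -
    have "mat_trace (L g) = (\<Sum>i<N. if el i = g \<otimes>\<^bsub>G\<^esub> el i then 1 else 0)"
      by (simp add: mat_trace_def L_def)
    also have "\<dots> = (\<Sum>i<N. if g = \<one>\<^bsub>G\<^esub> then 1 else 0)"
      using g elc by (intro sum.cong) (auto simp: l_cancel_one')
    finally show ?thesis by simp
  qed
  have FF: "F g * F h = (if g = h then F g else 0\<^sub>m N N)" if g: "g \<in> carrier G" for g h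
  proof (rule eq_matI)
    fix i j assume "i < dim_row (if g = h then F g else 0\<^sub>m N N)" "j < dim_col (if g = h then F g else 0\<^sub>m N N)"
    then have ij: "i < N" "j < N" by (auto split: if_splits)
    have "(F g * F h) $$ (i, j) = (\<Sum>l<N. F g $$ (i, l) * F h $$ (l, j))" using ij by (subst mat_mult_index) auto
    also have "\<dots> = (\<Sum>l<N. if l = i then (if i = j \<and> el i = g \<and> el i = h then 1 else 0) else 0)"
      using ij by (intro sum.cong) (auto simp: F_def)
    finally show "(F g * F h) $$ (i, j) = (if g = h then F g else 0\<^sub>m N N) $$ (i, j)"
      using ij by (auto simp: F_def)
  qed auto
  have F_adj: "mat_adjoint (F g) = F g" for g by (rule eq_matI) (auto simp: F_def)
  have F_trace: "mat_trace (F g) = 1" if g: "g \<in> carrier G" for g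
  proof -
    have "mat_trace (F g) = (\<Sum>i<N. if el i = g then 1 else 0)" by (simp add: mat_trace_def F_def)
    also have "\<dots> = (\<Sum>h\<in>carrier G. if h = g then 1 else 0)" by (rule sum_el)
    finally show ?thesis using G(2) g by simp
  qed
  have LF: "L g * F h = F (g \<otimes>\<^bsub>G\<^esub> h) * L g" if g: "g \<in> carrier G" and h: "h \<in> carrier G" for g h
  proof (rule eq_matI)
    fix i j assume "i < dim_row (F (g \<otimes>\<^bsub>G\<^esub> h) * L g)" "j < dim_col (F (g \<otimes>\<^bsub>G\<^esub> h) * L g)"
    then have ij: "i < N" "j < N" by auto
    have "(L g * F h) $$ (i, j) = (\<Sum>l<N. L g $$ (i, l) * F h $$ (l, j))" using ij by (subst mat_mult_index) auto
    also have "\<dots> = (\<Sum>l<N. if l = j then (if el i = g \<otimes>\<^bsub>G\<^esub> el j \<and> el j = h then 1 else 0) else 0)"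
      using ij by (intro sum.cong) (auto simp: F_def L_def)
    also have "\<dots> = (if el i = g \<otimes>\<^bsub>G\<^esub> el j \<and> el j = h then 1 else 0)" using ij by simp
    also have "\<dots> = (if el i = g \<otimes>\<^bsub>G\<^esub> el j \<and> el i = g \<otimes>\<^bsub>G\<^esub> h then 1 else 0)"
      using g h elc[OF ij(2)] by auto
    also have "\<dots> = (\<Sum>l<N. if l = i then (if el i = g \<otimes>\<^bsub>G\<^esub> el j \<and> el i = g \<otimes>\<^bsub>G\<^esub> h then 1 else 0) else 0)"
      using ij by simp
    also have "\<dots> = (\<Sum>l<N. F (g \<otimes>\<^bsub>G\<^esub> h) $$ (i, l) * L g $$ (l, j))"
      using ij by (intro sum.cong) (auto simp: F_def L_def)
    also have "\<dots> = (F (g \<otimes>\<^bsub>G\<^esub> h) * L g) $$ (i, j)" using ij by (subst mat_mult_index) auto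
    finally show "(L g * F h) $$ (i, j) = (F (g \<otimes>\<^bsub>G\<^esub> h) * L g) $$ (i, j)" .
  qed auto
  have rep: "unitary_rep G (N * M) (\<lambda>g. mat_tensor (L g) (1\<^sub>m M))"
    unfolding unitary_rep_def by (auto simp: mat_tensor_mult L_unit Lmult intro!: carrier_matI)
  have tr: "mat_trace (mat_tensor (L g) (1\<^sub>m M)) = (if g = \<one>\<^bsub>G\<^esub> then of_nat (N * M) else 0)" if "g \<in> carrier G" for g
    using that by (simp add: mat_tensor_trace L_trace)
  have proj: "mat_projection (N * M) (mat_tensor (F g) (1\<^sub>m M))" if "g \<in> carrier G" for g
    using that by (auto simp: mat_projection_def mat_tensor_mult FF F_adj intro!: carrier_matI)
  have orth: "mat_tensor (F g) (1\<^sub>m M) * mat_tensor (F h) (1\<^sub>m M) = 0\<^sub>m (N * M) (N * M)"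
    if "g \<in> carrier G" "h \<in> carrier G" "g \<noteq> h" for g h
    using that by (auto simp: mat_tensor_mult FF mat_tensor_index div_mod_bounds intro!: eq_matI)
  show ?thesis
    by (rule that[OF rep tr proj orth]) (auto simp: mat_tensor_mult LF mat_tensor_trace F_trace)
qed

definition equivariant_projections where
  "equivariant_projections G k \<pi> e \<longleftrightarrow> (\<forall>g\<in>carrier G. mat_projection k (e g))
     \<and> (\<forall>g\<in>carrier G. \<forall>h\<in>carrier G. g \<noteq> h \<longrightarrow> e g * e h = 0\<^sub>m k k)
     \<and> (\<forall>g\<in>carrier G. \<forall>h\<in>carrier G. \<pi> g * e h * mat_adjoint (\<pi> g) = e (g \<otimes>\<^bsub>G\<^esub> h))"

lemma equivariant_projections_sum:
  assumes "equivariant_projections G k \<pi> e" "finite (carrier G)"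
  shows "mat_projection k (mat_sum k k e (carrier G))"
  using assms by (intro mat_sum_projection) (auto simp: equivariant_projections_def)

text \<open>
  A representation whose character is small away from the identity contains \<open>M\<close> copies of the
  regular representation, hence \<open>card G\<close> projections permuted by \<open>G\<close> that leave only a small part
  uncovered. For a maximal partial intertwiner \<open>T\<close> from the \<open>M\<close>-fold regular representation let \<open>X\<close> be
  the character of the complement of its initial space. The orthogonality in
  maximal_partial_intertwiner bounds \<open>(X 1)\<^sup>2\<close> from above by a nonpositive number, so \<open>X 1 = 0\<close> and
  \<open>T\<close> is an isometry.
\<close>
lemma equivariant_projections_exist:
  assumes G: "group G" "finite (carrier G)" and \<pi>: "unitary_rep G k \<pi>"
    and small: "real (card (carrier G) * M) + (\<Sum>g\<in>carrier G - {\<one>\<^bsub>G\<^esub>}. cmod (mat_trace (\<pi> g))) \<le> real k"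
  obtains e where "equivariant_projections G k \<pi> e"
    "mat_trace (mat_sum k k e (carrier G)) = of_nat (card (carrier G) * M)"
proof -
  interpret group G by (rule G(1))
  let ?G = "carrier G - {\<one>\<^bsub>G\<^esub>}"
  define s where "s = card (carrier G) * M"
  obtain \<sigma> E where \<sigma>: "unitary_rep G s \<sigma>"
    and \<sigma>_trace: "\<And>g. g \<in> carrier G \<Longrightarrow> mat_trace (\<sigma> g) = (if g = \<one>\<^bsub>G\<^esub> then of_nat s else 0)"
    and E: "\<And>g. g \<in> carrier G \<Longrightarrow> mat_projection s (E g)"
    and E_orth: "\<And>g h. g \<in> carrier G \<Longrightarrow> h \<in> carrier G \<Longrightarrow> g \<noteq> h \<Longrightarrow> E g * E h = 0\<^sub>m s s"
    and \<sigma>E: "\<And>g h. g \<in> carrier G \<Longrightarrow> h \<in> carrier G \<Longrightarrow> \<sigma> g * E h = E (g \<otimes>\<^bsub>G\<^esub> h) * \<sigma> g"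
    and E_trace: "\<And>g. g \<in> carrier G \<Longrightarrow> mat_trace (E g) = of_nat M"
    unfolding s_def by (rule regular_representation[OF G, of M]) blast
  have "\<pi> g * 1\<^sub>m k = 1\<^sub>m k * \<pi> g" "\<sigma> g * 1\<^sub>m s = 1\<^sub>m s * \<sigma> g" if "g \<in> carrier G" for g
    using unitary_repD[OF \<pi> that] unitary_repD[OF \<sigma> that] by auto
  then obtain T where T: "partial_intertwiner G k \<pi> (1\<^sub>m k) s \<sigma> (1\<^sub>m s) T"
    and sum0: "(\<Sum>g\<in>carrier G. mat_trace (\<pi> g * (1\<^sub>m k - T * mat_adjoint T)) * cnj (mat_trace (\<sigma> g * (1\<^sub>m s - mat_adjoint T * T)))) = 0"
    using maximal_partial_intertwiner[OF G \<pi> \<sigma>, of "1\<^sub>m k" "1\<^sub>m s"] by auto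
  have Tc: "T \<in> carrier_mat k s" and Ti: "\<And>g. g \<in> carrier G \<Longrightarrow> \<pi> g * T = T * \<sigma> g"
    using T by (auto simp: partial_intertwiner_def)
  note Td [simp] = carrier_matD[OF Tc]
  define P where "P = 1\<^sub>m s - mat_adjoint T * T"
  have P: "mat_projection s P" unfolding P_def by (rule mat_projection_one_minus[OF partial_intertwiner_projection[OF T]])
  note Pd [simp] = mat_projectionD(2,3)[OF P]
  define p where "p = Re (mat_trace P)"
  have p: "p \<ge> 0" "mat_trace P = complex_of_real p"
    using mat_projection_trace_nonneg[OF P] by (auto simp: p_def complex_eq_iff)
  define X where "X g = mat_trace (\<sigma> g * P)" for g
  have X_le: "cmod (X g) \<le> p" if g: "g \<in> carrier G" for g
    unfolding X_def p_def using unitary_repD[OF \<sigma> g] mat_unitaryD[OF unitary_repD(4)[OF \<sigma> g]]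
    by (intro norm_mat_trace_unitary_projection_le[OF P]) auto
  have X_one: "X \<one>\<^bsub>G\<^esub> = complex_of_real p"
    unfolding X_def unitary_rep_one[OF G(1) \<sigma>] by (simp add: p)
  have comp: "mat_trace (\<pi> g * (1\<^sub>m k - T * mat_adjoint T)) = mat_trace (\<pi> g) - mat_trace (\<sigma> g) + X g" if g: "g \<in> carrier G" for g
  proof -
    note [simp] = unitary_repD(2,3)[OF \<pi> g] unitary_repD(2,3)[OF \<sigma> g]
    have "mat_trace (\<pi> g * (T * mat_adjoint T)) = mat_trace ((T * \<sigma> g) * mat_adjoint T)"
      by (simp add: Ti[OF g] flip: mat_assoc)
    also have "\<dots> = mat_trace (\<sigma> g * (mat_adjoint T * T))"
      using mat_trace_commute[of "T * \<sigma> g" "mat_adjoint T"] mat_trace_commute[of "mat_adjoint T * T" "\<sigma> g"]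
      by (simp add: mat_assoc)
    also have "\<dots> = mat_trace (\<sigma> g) - X g"
      by (simp add: X_def P_def mat_distribs)
    finally show ?thesis by (simp add: mat_distribs)
  qed
  have "0 = Re (\<Sum>g\<in>carrier G. (mat_trace (\<pi> g) - mat_trace (\<sigma> g) + X g) * cnj (X g))"
    using sum0 comp by (simp add: X_def P_def cong: sum.cong)
  also have "\<dots> = Re ((mat_trace (\<pi> \<one>\<^bsub>G\<^esub>) - mat_trace (\<sigma> \<one>\<^bsub>G\<^esub>) + X \<one>\<^bsub>G\<^esub>) * cnj (X \<one>\<^bsub>G\<^esub>))
     + (\<Sum>g\<in>?G. Re ((mat_trace (\<pi> g) - mat_trace (\<sigma> g) + X g) * cnj (X g)))"
    by (subst sum.remove[OF G(2) one_closed]) simp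
  also have "Re ((mat_trace (\<pi> \<one>\<^bsub>G\<^esub>) - mat_trace (\<sigma> \<one>\<^bsub>G\<^esub>) + X \<one>\<^bsub>G\<^esub>) * cnj (X \<one>\<^bsub>G\<^esub>)) = (real k - real s + p) * p"
    by (simp add: X_one unitary_rep_one[OF G(1) \<pi>] unitary_rep_one[OF G(1) \<sigma>])
  finally have eq: "0 = (real k - real s + p) * p + (\<Sum>g\<in>?G. Re ((mat_trace (\<pi> g) - mat_trace (\<sigma> g) + X g) * cnj (X g)))" .
  have "(\<Sum>g\<in>?G. Re ((mat_trace (\<pi> g) - mat_trace (\<sigma> g) + X g) * cnj (X g))) \<ge> (\<Sum>g\<in>?G. - (cmod (mat_trace (\<pi> g)) * p))"
  proof (rule sum_mono)
    fix g assume g: "g \<in> ?G"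
    have "- Re (mat_trace (\<pi> g) * cnj (X g)) \<le> cmod (mat_trace (\<pi> g) * cnj (X g))"
      using abs_Re_le_cmod[of "mat_trace (\<pi> g) * cnj (X g)"] by linarith
    also have "\<dots> \<le> cmod (mat_trace (\<pi> g)) * p" using X_le[of g] g by (simp add: norm_mult mult_left_mono)
    finally have "- (cmod (mat_trace (\<pi> g)) * p) \<le> Re (mat_trace (\<pi> g) * cnj (X g))" by linarith
    moreover have "0 \<le> Re (X g * cnj (X g))" by (simp flip: complex_norm_square of_real_power)
    moreover have "mat_trace (\<sigma> g) = 0" using \<sigma>_trace[of g] g by simp
    ultimately show "- (cmod (mat_trace (\<pi> g)) * p) \<le> Re ((mat_trace (\<pi> g) - mat_trace (\<sigma> g) + X g) * cnj (X g))"
      by (simp only: diff_zero distrib_right Re_sum plus_complex.sel)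
  qed
  also have "(\<Sum>g\<in>?G. - (cmod (mat_trace (\<pi> g)) * p)) = - ((\<Sum>g\<in>?G. cmod (mat_trace (\<pi> g))) * p)"
    by (simp add: sum_negf sum_distrib_right)
  finally have "(real k - real s - (\<Sum>g\<in>?G. cmod (mat_trace (\<pi> g)))) * p + p * p \<le> 0"
    using eq by (simp add: algebra_simps)
  moreover have "(real k - real s - (\<Sum>g\<in>?G. cmod (mat_trace (\<pi> g)))) * p \<ge> 0"
    using small p(1) by (simp add: s_def)
  ultimately have "p * p \<le> 0" by linarith
  then have "p = 0" using p(1) by (simp add: mult_le_0_iff)
  then have P0: "P = 0\<^sub>m s s" using mat_projection_trace_eq_0[OF P] p(2) by simp
  have iso: "mat_adjoint T * T = 1\<^sub>m s"
  proof (rule eq_matI)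
    fix i j assume "i < dim_row (1\<^sub>m s :: complex mat)" "j < dim_col (1\<^sub>m s :: complex mat)"
    then show "(mat_adjoint T * T) $$ (i, j) = 1\<^sub>m s $$ (i, j)"
      using arg_cong[OF P0, of "\<lambda>M. M $$ (i, j)"] by (simp add: P_def del: index_mult_mat(1))
  qed auto
  note absorb = mat_absorb[OF iso]
  define e where "e g = T * (E g * mat_adjoint T)" for g
  have ed: "dim_row (e g) = k" "dim_col (e g) = k" for g by (simp_all add: e_def)
  have proj: "mat_projection k (e g)" if g: "g \<in> carrier G" for g
  proof -
    note Eg = mat_projectionD[OF E[OF g]]
    show ?thesis
      unfolding mat_projection_def using Eg(2,3)
      by (auto simp: e_def mat_adjoint_mult Eg(4) mat_assoc absorb mat_absorb[OF Eg(5)] intro!: carrier_matI)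
  qed
  have orth: "e g * e h = 0\<^sub>m k k" if gh: "g \<in> carrier G" "h \<in> carrier G" "g \<noteq> h" for g h
    using mat_projectionD(2,3)[OF E[OF gh(1)]] mat_projectionD(2,3)[OF E[OF gh(2)]]
    by (simp add: e_def mat_assoc absorb mat_absorb[OF E_orth[OF gh]])
  have equi: "\<pi> g * e h * mat_adjoint (\<pi> g) = e (g \<otimes>\<^bsub>G\<^esub> h)" if g: "g \<in> carrier G" and h: "h \<in> carrier G" for g h
  proof -
    note [simp] = unitary_repD(2,3)[OF \<pi> g] unitary_repD(2,3)[OF \<sigma> g]
      mat_projectionD(2,3)[OF E[OF h]] mat_projectionD(2,3)[OF E[OF m_closed[OF g h]]]
    have adj: "mat_adjoint T * mat_adjoint (\<pi> g) = mat_adjoint (\<sigma> g) * mat_adjoint T"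
      using arg_cong[OF Ti[OF g], of mat_adjoint] by (simp add: mat_adjoint_mult)
    show ?thesis
      by (simp add: e_def mat_assoc mat_absorb[OF Ti[OF g]] mat_absorb[OF \<sigma>E[OF g h]] adj
          mat_unitaryD(6)[OF unitary_repD(4)[OF \<sigma> g]])
  qed
  have "mat_trace (mat_sum k k e (carrier G)) = (\<Sum>g\<in>carrier G. mat_trace (e g))"
    using ed by (subst mat_sum_trace) auto
  also have "\<dots> = (\<Sum>g\<in>carrier G. of_nat M)"
  proof (rule sum.cong[OF refl])
    fix g assume g: "g \<in> carrier G"
    have "mat_trace (e g) = mat_trace (E g * (mat_adjoint T * T))"
      unfolding e_def using mat_projectionD(2,3)[OF E[OF g]] by (subst mat_trace_commute) (auto simp: mat_assoc)
    then show "mat_trace (e g) = of_nat M" using mat_projectionD(2,3)[OF E[OF g]] by (simp add: iso E_trace[OF g])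
  qed
  finally have "mat_trace (mat_sum k k e (carrier G)) = of_nat (card (carrier G) * M)" by simp
  moreover have "equivariant_projections G k \<pi> e" using proj orth equi by (simp add: equivariant_projections_def)
  ultimately show ?thesis using that by blast
qed

section \<open>Matrix algebras in a C*-algebra\<close>

locale mat_hom =
  fixes k :: nat and \<psi> :: "complex mat \<Rightarrow> 'a::unital_cstar_algebra"
  assumes hom: "mat_unital_star_hom k \<psi>"
begin

lemma hom_simps:
  "\<psi> (1\<^sub>m k) = 1"
  "x \<in> carrier_mat k k \<Longrightarrow> y \<in> carrier_mat k k \<Longrightarrow> \<psi> (x + y) = \<psi> x + \<psi> y"
  "x \<in> carrier_mat k k \<Longrightarrow> y \<in> carrier_mat k k \<Longrightarrow> \<psi> (x * y) = \<psi> x * \<psi> y"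
  "x \<in> carrier_mat k k \<Longrightarrow> \<psi> (mat_adjoint x) = (\<psi> x)\<^sup>\<star>"
  "x \<in> carrier_mat k k \<Longrightarrow> \<psi> (c \<cdot>\<^sub>m x) = c *\<^sub>C \<psi> x"
  using hom by (auto simp: mat_unital_star_hom_def)

lemma hom_zero: "\<psi> (0\<^sub>m k k) = 0"
proof -
  have "0\<^sub>m k k = 0 \<cdot>\<^sub>m (0\<^sub>m k k :: complex mat)" by auto
  then have "\<psi> (0\<^sub>m k k) = 0 *\<^sub>C \<psi> (0\<^sub>m k k)" using hom_simps(5)[of "0\<^sub>m k k" 0] by simp
  then show ?thesis by simp
qed

lemma hom_diff:
  assumes "x \<in> carrier_mat k k" "y \<in> carrier_mat k k"
  shows "\<psi> (x - y) = \<psi> x - \<psi> y"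
proof -
  have "x = (x - y) + y" using assms by auto
  moreover have "x - y \<in> carrier_mat k k" using assms by (intro carrier_matI) simp_all
  ultimately have "\<psi> x = \<psi> (x - y) + \<psi> y" using hom_simps(2)[of "x - y" y] assms(2) by simp
  then show ?thesis by simp
qed

lemma hom_sum:
  assumes "\<And>s. s \<in> S \<Longrightarrow> f s \<in> carrier_mat k k"
  shows "\<psi> (mat_sum k k f S) = (\<Sum>s\<in>S. \<psi> (f s))"
  using assms
proof (induction S rule: infinite_finite_induct)
  case (infinite S)
  then have "mat_sum k k f S = 0\<^sub>m k k" by (auto intro!: eq_matI)
  with infinite show ?case by (simp add: hom_zero)
next
  case empty
  then show ?case by (simp add: hom_zero)
next
  case (insert s S)
  have "mat_sum k k f (insert s S) = f s + mat_sum k k f S"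
    using insert by (intro mat_sum_insert) auto
  moreover have "mat_sum k k f S \<in> carrier_mat k k" by auto
  ultimately show ?case using insert by (simp add: hom_simps)
qed

lemma hom_projection: "mat_projection k P \<Longrightarrow> projection (\<psi> P)"
  using hom_simps(3)[of P P] hom_simps(4)[of P] by (auto simp: mat_projection_def projection_def)

lemma hom_unitary:
  assumes "mat_unitary k U"
  shows "(\<psi> U)\<^sup>\<star> * \<psi> U = 1" "\<psi> U * (\<psi> U)\<^sup>\<star> = 1" "norm (\<psi> U) \<le> 1" "norm ((\<psi> U)\<^sup>\<star>) \<le> 1"
proof -
  note U = mat_unitaryD[OF assms]
  have a: "mat_adjoint U \<in> carrier_mat k k" using U by (auto intro!: carrier_matI)
  show 1: "(\<psi> U)\<^sup>\<star> * \<psi> U = 1" "\<psi> U * (\<psi> U)\<^sup>\<star> = 1"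
    using hom_simps(3)[OF a U(1)] hom_simps(3)[OF U(1) a] U by (auto simp: hom_simps)
  show "norm (\<psi> U) \<le> 1" by (rule norm_le_1_if_isometry[OF 1(1)])
  then show "norm ((\<psi> U)\<^sup>\<star>) \<le> 1" by simp
qed

text \<open>
  Compressing \<open>x\<close> by a diagonal matrix unit \<open>u\<close> gives \<open>x\<^sub>i\<^sub>i u\<close>. The projection \<open>\<psi> u\<close> has norm 1: if it were 0, the
  equivalent other diagonal units would be 0 as well, but they sum up to 1.
\<close>
lemma norm_diagonal_entry_le:
  assumes x: "x \<in> carrier_mat k k" and i: "i < k"
  shows "cmod (x $$ (i, i)) \<le> norm (\<psi> x)"
proof -
  define u where "u a b = mat_unit k k a b" for a b
  have ud: "dim_row (u a b) = k" "dim_col (u a b) = k" and uc: "u a b \<in> carrier_mat k k" for a b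
    by (simp_all add: u_def)
  have xi: "u i i * (x * u i i) = x $$ (i, i) \<cdot>\<^sub>m u i i"
  proof (rule eq_matI)
    fix a b assume "a < dim_row (x $$ (i, i) \<cdot>\<^sub>m u i i)" "b < dim_col (x $$ (i, i) \<cdot>\<^sub>m u i i)"
    then have ab: "a < k" "b < k" by (simp_all add: u_def)
    have "(u i i * (x * u i i)) $$ (a, b) = (if a = i then (x * (u i i * 1\<^sub>m k)) $$ (i, b) else 0)"
      unfolding u_def using x i ab by (simp add: mat_unit_mult_index del: index_mult_mat(1))
    also have "(x * (u i i * 1\<^sub>m k)) $$ (i, b) = x $$ (i, i) * 1\<^sub>m k $$ (i, b)"
      unfolding u_def using x i ab by (intro mat_unit_sandwich) auto
    finally show "(u i i * (x * u i i)) $$ (a, b) = (x $$ (i, i) \<cdot>\<^sub>m u i i) $$ (a, b)"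
      using i ab by (simp add: u_def del: index_mult_mat(1))
  qed (use x in \<open>simp_all add: ud\<close>)
  have p: "projection (\<psi> (u i i))" unfolding u_def by (rule hom_projection[OF mat_projection_mat_unit[OF i]])
  have "\<psi> (u i i) \<noteq> 0"
  proof
    assume zero: "\<psi> (u i i) = 0"
    have "\<psi> (u a a) = 0" for a
    proof -
      have "u a a = u a i * (u i i * u i a)" using i by (simp add: u_def mat_unit_mult)
      then have "\<psi> (u a a) = \<psi> (u a i) * (\<psi> (u i i) * \<psi> (u i a))"
        using uc by (simp add: hom_simps mult_carrier_mat[OF uc uc])
      then show ?thesis by (simp add: zero)
    qed
    then show False using hom_sum[of "{..<k}" "\<lambda>a. u a a"] uc hom_simps(1) by (simp add: u_def mat_unit_sum)
  qed
  then have n: "norm (\<psi> (u i i)) = 1" by (rule norm_projection[OF p])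
  have "cmod (x $$ (i, i)) = norm (\<psi> (x $$ (i, i) \<cdot>\<^sub>m u i i))" by (simp add: hom_simps uc norm_scaleC n)
  also have "\<dots> = norm (\<psi> (u i i) * (\<psi> x * \<psi> (u i i)))"
    unfolding xi[symmetric] using uc x by (simp add: hom_simps mult_carrier_mat[OF x uc])
  also have "\<dots> \<le> norm (\<psi> x)"
    using norm_mult_le_left[of "\<psi> (u i i)" "\<psi> x * \<psi> (u i i)"] norm_mult_le_right[of "\<psi> (u i i)" "\<psi> x"] n by simp
  finally show ?thesis .
qed

lemma norm_mat_unit_le:
  assumes "a < k" "b < k"
  shows "norm (\<psi> (mat_unit k k a b)) \<le> 1"
proof -
  have "norm (\<psi> (mat_unit k k b b)) \<le> 1"
    by (intro norm_projection_le hom_projection mat_projection_mat_unit assms)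
  moreover have "(\<psi> (mat_unit k k a b))\<^sup>\<star> * \<psi> (mat_unit k k a b) = \<psi> (mat_unit k k b b)"
    using assms hom_simps(4)[of "mat_unit k k a b"] hom_simps(3)[of "mat_unit k k b a" "mat_unit k k a b"]
    by (simp add: mat_unit_mult)
  ultimately have "(norm (\<psi> (mat_unit k k a b)))\<^sup>2 \<le> 1" by (simp flip: cstar_identity)
  then show ?thesis by (simp add: power_le_one_iff)
qed

lemma norm_trace_le:
  assumes "x \<in> carrier_mat k k"
  shows "cmod (mat_trace x) \<le> real k * norm (\<psi> x)"
proof -
  have "cmod (mat_trace x) \<le> (\<Sum>i<k. norm (\<psi> x))"
    unfolding mat_trace_def carrier_matD(1)[OF assms] using norm_diagonal_entry_le[OF assms] by (intro sum_norm_le) auto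
  then show ?thesis by simp
qed

lemma hom_eq_0D:
  assumes x: "x \<in> carrier_mat k k" and zero: "\<psi> x = 0"
  shows "x = 0\<^sub>m k k"
proof -
  have a: "mat_adjoint x \<in> carrier_mat k k" using x by (auto intro!: carrier_matI)
  have "cmod (mat_trace (mat_adjoint x * x)) \<le> real k * norm (\<psi> (mat_adjoint x * x))"
    by (rule norm_trace_le[OF mult_carrier_mat[OF a x]])
  then have "mat_trace (mat_adjoint x * x) = 0" using a x by (simp add: hom_simps zero)
  then show ?thesis using mat_trace_adjoint_mult_eq_0[of x] x by auto
qed

lemma norm_hom_projection:
  assumes "mat_projection k P" "P \<noteq> 0\<^sub>m k k"
  shows "norm (\<psi> P) = 1"
  using hom_eq_0D[of P] mat_projectionD(1)[OF assms(1)] assms(2) norm_projection[OF hom_projection[OF assms(1)]] by auto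

lemma dim_pos: "0 < k"
proof (rule ccontr)
  assume "\<not> 0 < k"
  then have "1\<^sub>m k = (0\<^sub>m k k :: complex mat)" by auto
  then show False using hom_simps(1) hom_zero by simp
qed

lemma spectral_orthogonal_projections:
  assumes e: "spectral_family k A e c"
  shows "orthogonal_projections {..<k} (\<lambda>i. \<psi> (e i))"
proof -
  note ed = spectral_familyD[OF e]
  have "\<psi> (e i) * \<psi> (e j) = 0" if "i < k" "j < k" "i \<noteq> j" for i j
    using hom_simps(3)[of "e i" "e j"] ed(1)[OF that(1)] ed(1)[OF that(2)] ed(4)[OF that]
    by (simp add: mat_projectionD(1) hom_zero)
  then show ?thesis using ed(1) by (auto simp: orthogonal_projections_def hom_projection)
qed

lemma hom_spectral_family:
  assumes A: "A \<in> carrier_mat k k" and e: "spectral_family k A e c"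
  shows "\<psi> A = (\<Sum>i<k. complex_of_real (c i) *\<^sub>C \<psi> (e i))"
    and "i < k \<Longrightarrow> \<psi> A * \<psi> (e i) = complex_of_real (c i) *\<^sub>C \<psi> (e i)"
    and "i < k \<Longrightarrow> norm (\<psi> (e i)) = 1"
proof -
  note ed = spectral_familyD[OF e]
  have ec: "e i \<in> carrier_mat k k" if "i < k" for i using ed(1)[OF that] by (rule mat_projectionD(1))
  have "\<psi> A = \<psi> (mat_sum k k (\<lambda>i. complex_of_real (c i) \<cdot>\<^sub>m e i) {..<k})"
    by (rule arg_cong[where f = \<psi>, OF spectral_family_sum[OF e A]])
  also have "\<dots> = (\<Sum>i<k. \<psi> (complex_of_real (c i) \<cdot>\<^sub>m e i))" using ec by (subst hom_sum) auto
  also have "\<dots> = (\<Sum>i<k. complex_of_real (c i) *\<^sub>C \<psi> (e i))" using ec by (intro sum.cong) (auto simp: hom_simps)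
  finally show "\<psi> A = (\<Sum>i<k. complex_of_real (c i) *\<^sub>C \<psi> (e i))" .
  show "\<psi> A * \<psi> (e i) = complex_of_real (c i) *\<^sub>C \<psi> (e i)" if i: "i < k"
    using hom_simps(3)[OF A ec[OF i]] ed(3)[OF i] ec[OF i] by (simp add: hom_simps)
  show "norm (\<psi> (e i)) = 1" if i: "i < k"
  proof (rule norm_hom_projection[OF ed(1)[OF i]])
    show "e i \<noteq> 0\<^sub>m k k" using ed(2)[OF i] by auto
  qed
qed

text \<open>
  Eigenprojections have norm 1, which bounds the eigenvalues; the reverse bound on the norm is
  norm_sum_orthogonal_projections_le for the spectral resolution.
\<close>
lemma norm_hermitian:
  assumes A: "A \<in> carrier_mat k k" "mat_adjoint A = A" and e: "spectral_family k A e c"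
  shows "i < k \<Longrightarrow> \<bar>c i\<bar> \<le> norm (\<psi> A)" and "\<exists>i<k. norm (\<psi> A) = \<bar>c i\<bar>"
proof -
  show le: "\<bar>c i\<bar> \<le> norm (\<psi> A)" if i: "i < k" for i
  proof -
    have "\<bar>c i\<bar> = norm (\<psi> A * \<psi> (e i))"
      by (simp add: hom_spectral_family(2)[OF A(1) e i] norm_scaleC hom_spectral_family(3)[OF A(1) e i])
    also have "\<dots> \<le> norm (\<psi> A)"
      by (rule norm_mult_le_right) (simp add: hom_spectral_family(3)[OF A(1) e i])
    finally show ?thesis .
  qed
  let ?M = "Max ((\<lambda>i. \<bar>c i\<bar>) ` {..<k})"
  have ne: "(\<lambda>i. \<bar>c i\<bar>) ` {..<k} \<noteq> {}" using dim_pos by auto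
  have "?M \<in> (\<lambda>i. \<bar>c i\<bar>) ` {..<k}" by (rule Max_in) (use ne in auto)
  then obtain i where i: "i < k" "?M = \<bar>c i\<bar>" by auto
  have "norm (\<psi> A) \<le> \<bar>c i\<bar>"
    unfolding hom_spectral_family(1)[OF A(1) e]
  proof (rule norm_sum_orthogonal_projections_le[OF spectral_orthogonal_projections[OF e]])
    fix j assume "j \<in> {..<k}"
    then have "\<bar>c j\<bar> \<le> ?M" by (intro Max_ge) auto
    then show "cmod (complex_of_real (c j)) \<le> \<bar>c i\<bar>" using i by simp
  qed auto
  with le[OF i(1)] i(1) show "\<exists>i<k. norm (\<psi> A) = \<bar>c i\<bar>" by (auto intro: antisym)
qed

text \<open>
  The eigenvalues \<open>c\<close> satisfy \<open>\<bar>c\<^sup>2 - c\<bar> \<le> \<delta>\<close> and are thus within \<open>2 \<delta>\<close> of 0 or 1; the spectral projection for the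
  eigenvalues above 1/2 rounds them.
\<close>
lemma near_projection:
  assumes A: "A \<in> carrier_mat k k" "mat_adjoint A = A"
    and near: "norm (\<psi> A * \<psi> A - \<psi> A) \<le> \<delta>"
  obtains P where "mat_projection k P" "norm (\<psi> P - \<psi> A) \<le> 2 * \<delta>"
proof -
  obtain e c where e: "spectral_family k A e c" using spectral_family_exists[OF A] .
  note ed = spectral_familyD[OF e]
  have ec: "e i \<in> carrier_mat k k" if "i < k" for i using ed(1)[OF that] by (rule mat_projectionD(1))
  have c: "\<bar>c i * c i - c i\<bar> \<le> \<delta>" if i: "i < k" for i
  proof -
    note h = hom_spectral_family(2,3)[OF A(1) e i]
    have "(\<psi> A * \<psi> A - \<psi> A) * \<psi> (e i) = complex_of_real (c i * c i - c i) *\<^sub>C \<psi> (e i)"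
      by (simp add: left_diff_distrib mult.assoc h mult_scaleC_right scaleC_scaleC scaleC_diff_left)
    from arg_cong[OF this, of norm] have "\<bar>c i * c i - c i\<bar> = norm ((\<psi> A * \<psi> A - \<psi> A) * \<psi> (e i))"
      by (simp add: norm_scaleC h del: of_real_diff of_real_mult)
    also have "\<dots> \<le> norm (\<psi> A * \<psi> A - \<psi> A)" by (rule norm_mult_le_right) (simp add: h)
    finally show ?thesis using near by simp
  qed
  let ?S = "{i. i < k \<and> c i > 1 / 2}"
  let ?P = "mat_sum k k e ?S"
  have "mat_projection k ?P" by (rule spectral_family_projection[OF e]) auto
  moreover have "norm (\<psi> ?P - \<psi> A) \<le> 2 * \<delta>"
  proof -
    have "\<psi> ?P = (\<Sum>i\<in>?S. \<psi> (e i))" using ec by (intro hom_sum) auto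
    also have "\<dots> = (\<Sum>i<k. (if c i > 1 / 2 then 1 else 0) *\<^sub>C \<psi> (e i))"
      by (rule sum.mono_neutral_cong_left) auto
    finally have "\<psi> ?P - \<psi> A = (\<Sum>i<k. ((if c i > 1 / 2 then 1 else 0) - complex_of_real (c i)) *\<^sub>C \<psi> (e i))"
      unfolding hom_spectral_family(1)[OF A(1) e] by (simp add: sum_subtractf scaleC_diff_left)
    also have "norm \<dots> \<le> 2 * \<delta>"
    proof (rule norm_sum_orthogonal_projections_le[OF spectral_orthogonal_projections[OF e]])
      fix i assume "i \<in> {..<k}"
      then have ci: "\<bar>c i\<bar> * \<bar>c i - 1\<bar> \<le> \<delta>" using c[of i] by (simp add: abs_mult[symmetric] algebra_simps)
      have "\<bar>(if c i > 1 / 2 then 1 else 0) - c i\<bar> \<le> 2 * \<delta>"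
      proof (cases "c i > 1 / 2")
        case True
        then have "1 / 2 * \<bar>c i - 1\<bar> \<le> \<bar>c i\<bar> * \<bar>c i - 1\<bar>" by (intro mult_right_mono) auto
        with ci True show ?thesis by auto
      next
        case False
        then have "\<bar>c i\<bar> * (1 / 2) \<le> \<bar>c i\<bar> * \<bar>c i - 1\<bar>" by (intro mult_left_mono) auto
        with ci False show ?thesis by auto
      qed
      moreover have "(if c i > 1 / 2 then 1 else 0) - complex_of_real (c i)
          = complex_of_real ((if c i > 1 / 2 then 1 else 0) - c i)" by simp
      ultimately show "cmod ((if c i > 1 / 2 then 1 else 0) - complex_of_real (c i)) \<le> 2 * \<delta>"
        by (simp only: norm_of_real)
    next
      show "0 \<le> 2 * \<delta>" using near norm_ge_zero[of "\<psi> A * \<psi> A - \<psi> A"] by linarith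
    qed auto
    finally show ?thesis .
  qed
  ultimately show ?thesis using that by blast
qed

text \<open>
  If the translates \<open>P\<^sub>h\<close> of a projection are nearly orthogonal and nearly sum up to 1, their ranges
  form an exact direct sum decomposition, permuted by the group, and so the character vanishes away
  from the identity. With \<open>Q = \<Sum> P\<^sub>h\<close>, which is invertible and commutes with the representation, the
  direct sum is expressed by \<open>P\<^sub>h Q\<^sup>-\<^sup>1 P\<^sub>l = \<delta>\<^sub>h\<^sub>l P\<^sub>l\<close>: the differences \<open>y\<^sub>h\<close> of the two sides lie in
  \<open>P\<^sub>h A\<close> and sum up to 0, which forces them to vanish.
\<close>
lemma character_eq_0_if_near_tower:
  assumes G: "group G" "finite (carrier G)" and v: "unitary_rep G k v" and P: "mat_projection k P"
    and orth: "\<And>h l. h \<in> carrier G \<Longrightarrow> l \<in> carrier G \<Longrightarrow> h \<noteq> l \<Longrightarrow>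
      norm (\<psi> (v h * P * mat_adjoint (v h)) * \<psi> (v l * P * mat_adjoint (v l))) \<le> 1 / (2 * real (card (carrier G)))"
    and sum: "norm (1 - (\<Sum>h\<in>carrier G. \<psi> (v h * P * mat_adjoint (v h)))) < 1"
    and g: "g \<in> carrier G" "g \<noteq> \<one>\<^bsub>G\<^esub>"
  shows "mat_trace (v g) = 0"
proof -
  interpret group G by (rule G(1))
  let ?N = "real (card (carrier G))"
  have N: "?N > 0" using G(2) one_closed by (auto simp: card_gt_0_iff)
  define p where "p h = v h * P * mat_adjoint (v h)" for h
  note Pd = mat_projectionD[OF P]
  have pp: "mat_projection k (p h)" if h: "h \<in> carrier G" for h
    using unitary_repD[OF v h] mat_unitaryD[OF unitary_repD(4)[OF v h]] Pd
    by (auto simp: mat_projection_def p_def mat_adjoint_mult mat_assoc intro!: carrier_matI)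
  have pd [simp]: "dim_row (p h) = k" "dim_col (p h) = k" "p h \<in> carrier_mat k k" if "h \<in> carrier G" for h
    using mat_projectionD[OF pp[OF that]] by auto
  have vp: "v g * p h = p (g \<otimes>\<^bsub>G\<^esub> h) * v g" if g: "g \<in> carrier G" and h: "h \<in> carrier G" for g h
    using unitary_repD[OF v g] unitary_repD[OF v h] mat_unitaryD[OF unitary_repD(4)[OF v g]] Pd
    by (simp add: p_def unitary_repD(5)[OF v g h] mat_adjoint_mult mat_assoc)
  define Q where "Q = mat_sum k k p (carrier G)"
  have Qd [simp]: "dim_row Q = k" "dim_col Q = k" and Qc: "Q \<in> carrier_mat k k" by (auto simp: Q_def)
  have psiQ: "\<psi> Q = (\<Sum>h\<in>carrier G. \<psi> (p h))" unfolding Q_def by (rule hom_sum) simp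
  have "det Q \<noteq> 0"
  proof
    assume "det Q = 0"
    then obtain w where w: "w \<in> carrier_vec k" "w \<noteq> 0\<^sub>v k" "Q *\<^sub>v w = 0\<^sub>v k"
      using det_0_iff_vec_prod_zero[OF Qc] by blast
    define X where "X = mat k k (\<lambda>(i, j). w $ i)"
    have Xc: "X \<in> carrier_mat k k" and Xd: "dim_row X = k" "dim_col X = k" by (simp_all add: X_def)
    have QX: "Q * X = 0\<^sub>m k k"
    proof (rule eq_matI)
      fix i j assume "i < dim_row (0\<^sub>m k k :: complex mat)" "j < dim_col (0\<^sub>m k k :: complex mat)"
      then have ij: "i < k" "j < k" by auto
      have "(Q * X) $$ (i, j) = (\<Sum>l<k. Q $$ (i, l) * w $ l)"
        using ij by (subst mat_mult_index) (auto simp: X_def)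
      also have "\<dots> = (Q *\<^sub>v w) $ i" using ij w(1) by (simp add: scalar_prod_def atLeast0LessThan)
      finally show "(Q * X) $$ (i, j) = 0\<^sub>m k k $$ (i, j)" using ij w(3) by simp
    qed (simp_all add: Xd)
    obtain i where i: "i < k" "w $ i \<noteq> 0" using w(1,2) by (metis carrier_vecD eq_vecI index_zero_vec(1) zero_carrier_vec)
    have "X \<noteq> 0\<^sub>m k k"
    proof
      assume "X = 0\<^sub>m k k"
      then have "X $$ (i, i) = 0" using i by simp
      then show False using i by (simp add: X_def)
    qed
    then have "\<psi> X \<noteq> 0" using hom_eq_0D[OF Xc] by auto
    have "\<psi> Q * \<psi> X = 0" using hom_simps(3)[OF Qc Xc] QX by (simp add: hom_zero)
    then have "\<psi> X = (1 - \<psi> Q) * \<psi> X" by (simp add: left_diff_distrib)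
    then have "norm (\<psi> X) \<le> norm (1 - \<psi> Q) * norm (\<psi> X)" by (metis norm_mult_ineq)
    moreover have "norm (1 - \<psi> Q) * norm (\<psi> X) < 1 * norm (\<psi> X)"
      using sum \<open>\<psi> X \<noteq> 0\<close> unfolding psiQ p_def by (intro mult_strict_right_mono) auto
    ultimately show False by simp
  qed
  then have "Q \<in> Units (ring_mat TYPE(complex) k ())" by (rule det_non_zero_imp_unit[OF Qc])
  then obtain R where Rc: "R \<in> carrier_mat k k" and QR: "Q * R = 1\<^sub>m k" "R * Q = 1\<^sub>m k"
    unfolding Units_def ring_mat_def by auto
  note Rd [simp] = carrier_matD[OF Rc]
  have key: "p h * (R * p l) = (if h = l then p l else 0\<^sub>m k k)" if h: "h \<in> carrier G" and l: "l \<in> carrier G" for h l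
  proof -
    define y where "y h = \<psi> (p h) * (\<psi> R * \<psi> (p l)) - (if h = l then \<psi> (p l) else 0)" for h
    have idem: "\<psi> (p h) * \<psi> (p h) = \<psi> (p h)" if "h \<in> carrier G" for h
      by (rule projection_mult[OF hom_projection[OF pp[OF that]]])
    have py: "\<psi> (p h) * y h = y h" if "h \<in> carrier G" for h
      using idem[OF that] by (auto simp: y_def right_diff_distrib simp flip: mult.assoc)
    have y_sum: "(\<Sum>h\<in>carrier G. y h) = 0"
    proof -
      have "(\<Sum>h\<in>carrier G. y h) = \<psi> Q * (\<psi> R * \<psi> (p l)) - \<psi> (p l)"
        using G(2) l by (simp add: y_def psiQ sum_subtractf sum_distrib_right)
      also have "\<psi> Q * (\<psi> R * \<psi> (p l)) = \<psi> (Q * R) * \<psi> (p l)"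
        by (simp add: hom_simps Qc Rc mult.assoc)
      finally show ?thesis by (simp add: QR hom_simps)
    qed
    define M where "M = (\<Sum>h\<in>carrier G. norm (y h))"
    have y_le: "norm (y h) \<le> 1 / (2 * ?N) * M" if h: "h \<in> carrier G" for h
    proof -
      have "y h = - (\<Sum>j\<in>carrier G - {h}. y j)"
        using y_sum sum.remove[OF G(2) h, of y] by (simp add: eq_neg_iff_add_eq_0)
      then have "\<psi> (p h) * y h = - (\<Sum>j\<in>carrier G - {h}. \<psi> (p h) * y j)"
        by (metis (no_types, lifting) mult_minus_right sum.cong sum_distrib_left)
      then have "norm (y h) = norm (\<Sum>j\<in>carrier G - {h}. \<psi> (p h) * y j)"
        unfolding py[OF h] by simp
      also have "\<dots> \<le> (\<Sum>j\<in>carrier G - {h}. 1 / (2 * ?N) * norm (y j))"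
      proof (rule sum_norm_le)
        fix j assume j: "j \<in> carrier G - {h}"
        have "norm (\<psi> (p h) * y j) = norm (\<psi> (p h) * \<psi> (p j) * y j)" using py[of j] j by (simp add: mult.assoc)
        also have "\<dots> \<le> norm (\<psi> (p h) * \<psi> (p j)) * norm (y j)" by (rule norm_mult_ineq)
        also have "\<dots> \<le> 1 / (2 * ?N) * norm (y j)"
          using orth[OF h, of j] j unfolding p_def by (intro mult_right_mono) auto
        finally show "norm (\<psi> (p h) * y j) \<le> 1 / (2 * ?N) * norm (y j)" .
      qed
      also have "\<dots> \<le> (\<Sum>j\<in>carrier G. 1 / (2 * ?N) * norm (y j))"
        using G(2) N by (intro sum_mono2) auto
      finally show ?thesis by (simp only: M_def sum_distrib_left)
    qed
    have "M \<le> (\<Sum>h\<in>carrier G. 1 / (2 * ?N) * M)" unfolding M_def[of] by (rule sum_mono) (use y_le in \<open>simp add: M_def\<close>)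
    also have "\<dots> = M / 2" using N by simp
    finally have "M \<le> 0" by simp
    then have "norm (y h) = 0"
      using G(2) h sum_nonneg_eq_0_iff[of "carrier G" "\<lambda>h. norm (y h)"] sum_nonneg[of "carrier G" "\<lambda>h. norm (y h)"]
      unfolding M_def by force
    then have "\<psi> (p h * (R * p l)) = \<psi> (if h = l then p l else 0\<^sub>m k k)"
      using h l by (simp add: y_def hom_simps Rc mult_carrier_mat[OF Rc] hom_zero)
    then have "\<psi> (p h * (R * p l) - (if h = l then p l else 0\<^sub>m k k)) = 0"
      using h l by (subst hom_diff) (auto intro!: mult_carrier_mat[of _ k k] Rc)
    then have zero: "p h * (R * p l) - (if h = l then p l else 0\<^sub>m k k) = 0\<^sub>m k k"
      using h l by (intro hom_eq_0D) (auto intro!: carrier_matI)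
    show ?thesis
    proof (rule eq_matI)
      fix i j assume "i < dim_row (if h = l then p l else 0\<^sub>m k k)" "j < dim_col (if h = l then p l else 0\<^sub>m k k)"
      then have ij: "i < k" "j < k" using l by (auto split: if_splits)
      then show "(p h * (R * p l)) $$ (i, j) = (if h = l then p l else 0\<^sub>m k k) $$ (i, j)"
        using arg_cong[OF zero, of "\<lambda>M. M $$ (i, j)"] h l by (auto split: if_splits simp del: index_mult_mat(1))
    qed (use h l in auto)
  qed
  note gd [simp] = unitary_repD(2,3)[OF v g(1)]
  have term_zero: "mat_trace (v g * (R * p h)) = 0" if h: "h \<in> carrier G" for h
  proof -
    let ?h = "inv\<^bsub>G\<^esub> g \<otimes>\<^bsub>G\<^esub> h"
    have h': "?h \<in> carrier G" "g \<otimes>\<^bsub>G\<^esub> ?h = h" using g h by (simp_all flip: m_assoc)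
    have ne: "?h \<noteq> h"
    proof
      assume "?h = h"
      with h' have "g \<otimes>\<^bsub>G\<^esub> h = h" by simp
      with g h show False by simp
    qed
    have "mat_trace (v g * (R * p h)) = mat_trace (v g * (R * p h) * p h)"
      using h mat_projectionD(5)[OF pp[OF h]] by (simp add: mat_assoc)
    also have "\<dots> = mat_trace (p h * (v g * (R * p h)))"
      using h by (intro mat_trace_commute) auto
    also have "p h * (v g * (R * p h)) = v g * (p ?h * (R * p h))"
      using h h' vp[OF g(1) h'(1)] by (simp add: mat_absorb[OF vp[OF g(1) h'(1)]] mat_assoc)
    also have "\<dots> = 0\<^sub>m k k" using key[OF h'(1) h] ne by simp
    finally show ?thesis by simp
  qed
  have "mat_trace (v g) = mat_trace (v g * (R * Q))" by (simp add: QR)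
  also have "v g * (R * Q) = mat_sum k k (\<lambda>h. v g * (R * p h)) (carrier G)"
  proof -
    have "R * Q = mat_sum k k (\<lambda>h. R * p h) (carrier G)"
      unfolding Q_def by (subst mat_sum_mult_left) auto
    then show ?thesis by (simp only:) (subst mat_sum_mult_left, auto intro!: carrier_matI)
  qed
  also have "mat_trace \<dots> = (\<Sum>h\<in>carrier G. mat_trace (v g * (R * p h)))"
    by (rule mat_sum_trace) (auto intro!: carrier_matI)
  also have "\<dots> = 0" using term_zero by simp
  finally show ?thesis .
qed

end

section \<open>The infinite tensor product\<close>

lemma mat_tensor_unit_right [simp]: "mat_tensor A (1\<^sub>m 1) = A" "mat_tensor A (1\<^sub>m (Suc 0)) = A"
  by (rule eq_matI; simp add: mat_tensor_index)+

lemma range_tensor_same [simp]: "range_tensor f m m = 1\<^sub>m 1"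
  by (simp add: range_tensor_def)

lemma range_tensor_Suc: "m \<le> n \<Longrightarrow> range_tensor f m (Suc n) = mat_tensor (range_tensor f m n) (f n)"
  by (simp add: range_tensor_def)

lemma range_tensor_concat:
  assumes "m \<le> n" "n \<le> l"
  shows "range_tensor f m l = mat_tensor (range_tensor f m n) (range_tensor f n l)"
  using assms(2) assms(1)
proof (induction l rule: dec_induct)
  case (step l)
  then show ?case by (simp add: range_tensor_Suc mat_tensor_assoc)
qed simp

lemma range_tensor_rep:
  assumes "\<And>i. unitary_rep G (d i) (\<pi> i)" "m \<le> n"
  shows "unitary_rep G (\<Prod>i\<in>{m..<n}. d i) (\<lambda>g. range_tensor (\<lambda>i. \<pi> i g) m n)"
  using assms(2)
proof (induction n rule: dec_induct)
  case base
  then show ?case by (auto simp: unitary_rep_def)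
next
  case (step n)
  have d: "(\<Prod>i\<in>{m..<Suc n}. d i) = (\<Prod>i\<in>{m..<n}. d i) * d n" using step by simp
  show ?case
    unfolding unitary_rep_def d
  proof (intro conjI ballI)
    fix g assume g: "g \<in> carrier G"
    note r = unitary_repD(2,3)[OF step(3) g] mat_unitaryD(4,5)[OF unitary_repD(4)[OF step(3) g]]
    note s = unitary_repD(2,3)[OF assms(1)[of n] g] mat_unitaryD(4,5)[OF unitary_repD(4)[OF assms(1)[of n] g]]
    let ?T = "range_tensor (\<lambda>i. \<pi> i g) m (Suc n)"
    have T: "?T = mat_tensor (range_tensor (\<lambda>i. \<pi> i g) m n) (\<pi> n g)" using step(1) by (rule range_tensor_Suc)
    show "?T \<in> carrier_mat ((\<Prod>i\<in>{m..<n}. d i) * d n) ((\<Prod>i\<in>{m..<n}. d i) * d n)"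
      unfolding T by (intro carrier_matI) (simp_all add: r s)
    show "?T * mat_adjoint ?T = 1\<^sub>m ((\<Prod>i\<in>{m..<n}. d i) * d n)" "mat_adjoint ?T * ?T = 1\<^sub>m ((\<Prod>i\<in>{m..<n}. d i) * d n)"
      unfolding T by (simp_all add: mat_tensor_mult r s)
    fix h assume h: "h \<in> carrier G"
    show "range_tensor (\<lambda>i. \<pi> i (g \<otimes>\<^bsub>G\<^esub> h)) m (Suc n) = ?T * range_tensor (\<lambda>i. \<pi> i h) m (Suc n)"
      using step(1) r s unitary_repD(2,3)[OF step(3) h] unitary_repD(2,3)[OF assms(1)[of n] h]
      by (simp add: range_tensor_Suc mat_tensor_mult unitary_repD(5)[OF step(3) g h] unitary_repD(5)[OF assms(1)[of n] g h])
  qed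
qed

lemma range_tensor_character:
  assumes "\<And>i. unitary_rep G (d i) (\<pi> i)" "m \<le> n" "g \<in> carrier G"
  shows "mat_trace (range_tensor (\<lambda>i. \<pi> i g) m n) = (\<Prod>i\<in>{m..<n}. mat_trace (\<pi> i g))"
  using assms(2)
proof (induction n rule: dec_induct)
  case (step n)
  then show ?case
    using unitary_repD(2,3)[OF range_tensor_rep[OF assms(1) step(1)] assms(3)] unitary_repD(2,3)[OF assms(1)[of n] assms(3)]
    by (simp add: range_tensor_Suc mat_tensor_trace)
qed simp

locale product_action =
  fixes G :: "('g, 'm) monoid_scheme" and d :: "nat \<Rightarrow> nat"
    and \<phi> :: "nat \<Rightarrow> complex mat \<Rightarrow> 'a::unital_cstar_algebra"
    and \<pi> :: "nat \<Rightarrow> 'g \<Rightarrow> complex mat" and \<alpha> :: "'g \<Rightarrow> 'a \<Rightarrow> 'a"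
  assumes G: "group G" "finite (carrier G)"
    and tensor: "infinite_tensor_product d \<phi>"
    and inf_dim: "infinite_dimensional TYPE('a)"
    and action: "product_type_action G d \<phi> \<pi> \<alpha>"
begin

definition D :: "nat \<Rightarrow> nat \<Rightarrow> nat" where "D m n = (\<Prod>i\<in>{m..<n}. d i)"

abbreviation M :: "nat \<Rightarrow> nat \<Rightarrow> complex mat set" where "M m n \<equiv> carrier_mat (D m n) (D m n)"

definition \<rho> :: "nat \<Rightarrow> nat \<Rightarrow> 'g \<Rightarrow> complex mat" where "\<rho> m n g = range_tensor (\<lambda>i. \<pi> i g) m n"

text \<open>The embedding of the factors with indices from \<open>m\<close> to \<open>n - 1\<close>.\<close>
definition \<iota> :: "nat \<Rightarrow> nat \<Rightarrow> complex mat \<Rightarrow> 'a" where "\<iota> m n y = \<phi> n (mat_tensor (1\<^sub>m (D 0 m)) y)"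

lemma D_0: "D 0 n = (\<Prod>i<n. d i)" by (simp add: D_def atLeast0LessThan)

lemma D_pos: "D m n > 0" using tensor by (simp add: D_def infinite_tensor_product_def prod_pos)

lemma D_concat: "m \<le> n \<Longrightarrow> n \<le> l \<Longrightarrow> D m n * D n l = D m l"
  by (simp add: D_def prod.atLeastLessThan_concat)

lemma rep: "unitary_rep G (d i) (\<pi> i)" using action by (simp add: product_type_action_def)

lemma \<rho>_rep: "m \<le> n \<Longrightarrow> unitary_rep G (D m n) (\<rho> m n)"
  unfolding \<rho>_def[abs_def] D_def by (rule range_tensor_rep[OF rep])

lemma \<rho>_concat: "m \<le> n \<Longrightarrow> n \<le> l \<Longrightarrow> mat_tensor (\<rho> m n g) (\<rho> n l g) = \<rho> m l g"
  unfolding \<rho>_def by (rule range_tensor_concat[symmetric])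

lemma \<phi>_hom: "mat_hom (D 0 n) (\<phi> n)"
  using tensor by unfold_locales (simp add: infinite_tensor_product_def D_0)

lemma \<phi>_extend:
  assumes "m \<le> n" "x \<in> M 0 m"
  shows "\<phi> n (mat_tensor x (1\<^sub>m (D m n))) = \<phi> m x"
  using assms(1)
proof (induction n rule: dec_induct)
  case base
  then show ?case by (simp add: D_def)
next
  case (step n)
  have DS: "D m n * d n = D m (Suc n)" using step by (simp add: D_def)
  have "mat_tensor x (1\<^sub>m (D m n)) \<in> M 0 n"
    using assms(2) D_concat[of 0 m n] step by (auto intro!: carrier_matI)
  then have "\<phi> (Suc n) (mat_tensor (mat_tensor x (1\<^sub>m (D m n))) (1\<^sub>m (d n))) = \<phi> n (mat_tensor x (1\<^sub>m (D m n)))"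
    using tensor by (simp add: infinite_tensor_product_def D_0)
  then show ?case using step by (simp add: mat_tensor_assoc DS)
qed

lemma \<iota>_hom:
  assumes "m \<le> n"
  shows "mat_hom (D m n) (\<iota> m n)"
proof
  interpret P: mat_hom "D 0 n" "\<phi> n" by (rule \<phi>_hom)
  have c: "mat_tensor (1\<^sub>m (D 0 m)) y \<in> M 0 n" if "y \<in> M m n" for y
    using that D_concat[of 0 m n] assms by (auto intro!: carrier_matI)
  show "mat_unital_star_hom (D m n) (\<iota> m n)"
    unfolding mat_unital_star_hom_def
  proof (intro conjI ballI allI)
    show "\<iota> m n (1\<^sub>m (D m n)) = 1" using D_concat[of 0 m n] assms by (simp add: \<iota>_def P.hom_simps)
    fix x assume x: "x \<in> M m n"
    show "\<iota> m n (mat_adjoint x) = (\<iota> m n x)\<^sup>\<star>" unfolding \<iota>_def P.hom_simps(4)[OF c[OF x], symmetric] by simp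
    show "\<iota> m n (b \<cdot>\<^sub>m x) = b *\<^sub>C \<iota> m n x" for b unfolding \<iota>_def P.hom_simps(5)[OF c[OF x], symmetric] by (simp add: mat_tensor_linear)
    fix y assume y: "y \<in> M m n"
    show "\<iota> m n (x + y) = \<iota> m n x + \<iota> m n y"
      unfolding \<iota>_def P.hom_simps(2)[OF c[OF x] c[OF y], symmetric] using x y by (simp add: mat_tensor_linear)
    show "\<iota> m n (x * y) = \<iota> m n x * \<iota> m n y"
      unfolding \<iota>_def P.hom_simps(3)[OF c[OF x] c[OF y], symmetric] using x y by (simp add: mat_tensor_mult)
  qed
qed

lemma \<phi>_\<iota>:
  assumes "m \<le> n" "x \<in> M 0 m" "y \<in> M m n"
  shows "\<phi> m x * \<iota> m n y = \<phi> n (mat_tensor x y)" "\<iota> m n y * \<phi> m x = \<phi> n (mat_tensor x y)"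
proof -
  interpret P: mat_hom "D 0 n" "\<phi> n" by (rule \<phi>_hom)
  have c: "mat_tensor a b \<in> M 0 n" if "a \<in> M 0 m" "b \<in> M m n" for a b
    using that D_concat[of 0 m n] assms(1) by (auto intro!: carrier_matI)
  show "\<phi> m x * \<iota> m n y = \<phi> n (mat_tensor x y)"
    unfolding \<phi>_extend[OF assms(1,2), symmetric] \<iota>_def
    using assms by (subst P.hom_simps(3)[symmetric]) (auto simp: mat_tensor_mult intro!: c)
  show "\<iota> m n y * \<phi> m x = \<phi> n (mat_tensor x y)"
    unfolding \<phi>_extend[OF assms(1,2), symmetric] \<iota>_def
    using assms by (subst P.hom_simps(3)[symmetric]) (auto simp: mat_tensor_mult intro!: c)
qed

lemma \<phi>_commute_\<iota>:
  "m \<le> n \<Longrightarrow> x \<in> M 0 m \<Longrightarrow> y \<in> M m n \<Longrightarrow> \<phi> m x * \<iota> m n y = \<iota> m n y * \<phi> m x"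
  by (simp add: \<phi>_\<iota>)

lemma dense:
  assumes "\<epsilon> > 0"
  obtains n x where "x \<in> M 0 n" "norm (a - \<phi> n x) < \<epsilon>"
proof -
  have "a \<in> closure (\<Union>n. \<phi> n ` M 0 n)" using tensor by (simp add: infinite_tensor_product_def D_0)
  with assms obtain b where "b \<in> (\<Union>n. \<phi> n ` M 0 n)" "dist b a < \<epsilon>" unfolding closure_approachable by blast
  then show ?thesis using that by (auto simp: dist_norm norm_minus_commute)
qed

lemma \<phi>_lift:
  assumes "x \<in> M 0 m" "m \<le> n"
  obtains y where "y \<in> M 0 n" "\<phi> n y = \<phi> m x"
proof
  show "mat_tensor x (1\<^sub>m (D m n)) \<in> M 0 n" using assms D_concat[of 0 m n] by (auto intro!: carrier_matI)
  show "\<phi> n (mat_tensor x (1\<^sub>m (D m n))) = \<phi> m x" by (rule \<phi>_extend[OF assms(2,1)])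
qed

lemma dense_finite:
  assumes "finite F" "\<epsilon> > 0"
  obtains n where "\<And>m a. m \<ge> n \<Longrightarrow> a \<in> F \<Longrightarrow> \<exists>x\<in>M 0 m. norm (a - \<phi> m x) < \<epsilon>"
proof -
  have "\<exists>n. \<forall>m\<ge>n. \<forall>a\<in>F. \<exists>x\<in>M 0 m. norm (a - \<phi> m x) < \<epsilon>"
    using assms(1)
  proof (induction F)
    case (insert a F)
    then obtain n1 where n1: "\<forall>m\<ge>n1. \<forall>a\<in>F. \<exists>x\<in>M 0 m. norm (a - \<phi> m x) < \<epsilon>" by blast
    obtain n2 x where x: "x \<in> M 0 n2" "norm (a - \<phi> n2 x) < \<epsilon>" using dense[OF assms(2)] .
    have "\<exists>y\<in>M 0 m. norm (a - \<phi> m y) < \<epsilon>" if "m \<ge> n2" for m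
      using \<phi>_lift[OF x(1) that] x(2) by metis
    with n1 show ?case by (intro exI[of _ "max n1 n2"]) auto
  qed simp
  then show ?thesis using that by blast
qed

lemma hermitian_part:
  assumes x: "x \<in> M 0 n" and a: "a\<^sup>\<star> = a" and near: "norm (a - \<phi> n x) < \<epsilon>"
  obtains y where "y \<in> M 0 n" "mat_adjoint y = y" "norm (a - \<phi> n y) < \<epsilon>"
proof -
  interpret P: mat_hom "D 0 n" "\<phi> n" by (rule \<phi>_hom)
  define y where "y = (1 / 2 :: complex) \<cdot>\<^sub>m (x + mat_adjoint x)"
  have xa: "mat_adjoint x \<in> M 0 n" using x by (auto intro!: carrier_matI)
  have y: "y \<in> M 0 n" using x xa by (simp add: y_def)
  have "mat_adjoint y = y" using x by (auto simp: y_def intro!: eq_matI)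
  moreover have "a - \<phi> n y = (1 / 2 :: complex) *\<^sub>C ((a - \<phi> n x) + (a - \<phi> n x)\<^sup>\<star>)"
  proof -
    have "(1 / 2 :: complex) *\<^sub>C (a + a) = a"
      using scaleC_add_left[of "1/2" "1/2" a] by (simp add: scaleC_add_right)
    then show ?thesis
      using x xa by (simp add: y_def P.hom_simps star_diff a scaleC_add_right scaleC_diff_right)
  qed
  then have "norm (a - \<phi> n y) \<le> 1 / 2 * (norm (a - \<phi> n x) + norm (a - \<phi> n x))"
    using norm_triangle_ineq[of "a - \<phi> n x" "(a - \<phi> n x)\<^sup>\<star>"] by (simp add: norm_scaleC)
  ultimately show ?thesis using that[OF y] near by simp
qed

subsection \<open>The trace\<close>

text \<open>
  This one inequality shows that the normalized traces on the finite tensor products are compatible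
  (take \<open>\<phi> m x = \<phi> n y\<close>) and that they extend continuously to the whole algebra.
\<close>
lemma trace_lipschitz:
  assumes x: "x \<in> M 0 m" and y: "y \<in> M 0 n"
  shows "cmod (mat_trace x / of_nat (D 0 m) - mat_trace y / of_nat (D 0 n)) \<le> norm (\<phi> m x - \<phi> n y)"
proof -
  define l where "l = max m n"
  interpret P: mat_hom "D 0 l" "\<phi> l" by (rule \<phi>_hom)
  let ?x = "mat_tensor x (1\<^sub>m (D m l))" and ?y = "mat_tensor y (1\<^sub>m (D n l))"
  have l: "m \<le> l" "n \<le> l" by (auto simp: l_def)
  have c: "?x \<in> M 0 l" "?y \<in> M 0 l" using x y D_concat[of 0 m l] D_concat[of 0 n l] l by (auto intro!: carrier_matI)
  have Dl: "D 0 l = D 0 m * D m l" "D 0 l = D 0 n * D n l" using l by (simp_all add: D_concat)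
  have "mat_trace ?x / of_nat (D 0 l) = mat_trace x / of_nat (D 0 m)"
    using x D_pos[of m l] unfolding Dl(1) by (simp add: mat_tensor_trace)
  moreover have "mat_trace ?y / of_nat (D 0 l) = mat_trace y / of_nat (D 0 n)"
    using y D_pos[of n l] unfolding Dl(2) by (simp add: mat_tensor_trace)
  moreover have "mat_trace (?x - ?y) = mat_trace ?x - mat_trace ?y" 
    by (intro mat_trace_simps) (simp_all only: carrier_matD[OF c(1)] carrier_matD[OF c(2)])
  ultimately have "cmod (mat_trace x / of_nat (D 0 m) - mat_trace y / of_nat (D 0 n)) = cmod (mat_trace (?x - ?y)) / D 0 l"
    by (metis diff_divide_distrib norm_divide norm_of_nat)
  also have "\<dots> \<le> norm (\<phi> l (?x - ?y))"
  proof -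
    have "?x - ?y \<in> M 0 l"
      by (rule carrier_matI) (simp_all only: index_minus_mat carrier_matD[OF c(2)])
    from P.norm_trace_le[OF this] show ?thesis using D_pos[of 0 l] by (simp only: divide_le_eq of_nat_0_less_iff if_True mult.commute)
  qed
  also have "\<phi> l (?x - ?y) = \<phi> m x - \<phi> n y" using P.hom_diff[OF c] l x y by (simp add: \<phi>_extend)
  finally show ?thesis .
qed

lemma trace_exists:
  "\<exists>\<tau>. continuous_on UNIV \<tau> \<and> (\<forall>n. \<forall>x\<in>M 0 n. \<tau> (\<phi> n x) = mat_trace x / of_nat (D 0 n))"
proof -
  let ?X = "\<Union>n. \<phi> n ` M 0 n"
  define t where "t a = (SOME z. \<exists>n. \<exists>x\<in>M 0 n. \<phi> n x = a \<and> z = mat_trace x / of_nat (D 0 n))" for a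
  have t: "t (\<phi> n x) = mat_trace x / of_nat (D 0 n)" if x: "x \<in> M 0 n" for n x
    unfolding t_def
  proof (rule some_equality)
    fix z assume "\<exists>m. \<exists>y\<in>M 0 m. \<phi> m y = \<phi> n x \<and> z = mat_trace y / of_nat (D 0 m)"
    then obtain m y where "y \<in> M 0 m" "\<phi> m y = \<phi> n x" "z = mat_trace y / of_nat (D 0 m)" by blast
    then show "z = mat_trace x / of_nat (D 0 n)" using trace_lipschitz[of y m x n] x by simp
  qed (use x in blast)
  have uc: "uniformly_continuous_on ?X t"
    unfolding uniformly_continuous_on_def
  proof (intro allI impI)
    fix e :: real assume e: "e > 0"
    have lip: "dist (t b) (t a) \<le> dist b a" if "a \<in> ?X" "b \<in> ?X" for a b
      using that trace_lipschitz by (auto simp: t dist_norm)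
    show "\<exists>r>0. \<forall>a\<in>?X. \<forall>b\<in>?X. dist b a < r \<longrightarrow> dist (t b) (t a) < e"
    proof (intro exI[of _ e] conjI ballI impI e)
      fix a b assume "a \<in> ?X" "b \<in> ?X" "dist b a < e"
      then show "dist (t b) (t a) < e" using lip[of a b] by simp
    qed
  qed
  have closure: "closure ?X = UNIV" using tensor by (simp add: infinite_tensor_product_def D_0)
  obtain \<tau> where \<tau>: "uniformly_continuous_on UNIV \<tau>" "\<And>a. a \<in> ?X \<Longrightarrow> t a = \<tau> a"
    by (rule uniformly_continuous_on_extension_on_closure[OF uc, unfolded closure]) blast
  have "\<tau> (\<phi> n x) = mat_trace x / of_nat (D 0 n)" if "x \<in> M 0 n" for n x
  proof -
    have "\<phi> n x \<in> ?X" using that by blast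
    from \<tau>(2)[OF this] t[OF that] show ?thesis by simp
  qed
  then show ?thesis using uniformly_continuous_imp_continuous[OF \<tau>(1)] by blast
qed

definition \<tau> :: "'a \<Rightarrow> complex" where
  "\<tau> = (SOME \<tau>. continuous_on UNIV \<tau> \<and> (\<forall>n. \<forall>x\<in>M 0 n. \<tau> (\<phi> n x) = mat_trace x / of_nat (D 0 n)))"

lemma \<tau>_continuous: "continuous_on UNIV \<tau>"
  and \<tau>_\<phi>: "x \<in> M 0 n \<Longrightarrow> \<tau> (\<phi> n x) = mat_trace x / of_nat (D 0 n)"
  using someI_ex[OF trace_exists] unfolding \<tau>_def[symmetric] by auto

lemma \<phi>_sequence:
  obtains s where "s \<longlonglongrightarrow> a" "\<And>j :: nat. \<exists>n. \<exists>x\<in>M 0 n. s j = \<phi> n x"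
proof -
  have "a \<in> closure (\<Union>n. \<phi> n ` M 0 n)" using tensor by (simp add: infinite_tensor_product_def D_0)
  then obtain s where "\<forall>j. s j \<in> (\<Union>n. \<phi> n ` M 0 n)" "s \<longlonglongrightarrow> a" unfolding closure_sequential by blast
  then show ?thesis using that by blast
qed

lemma \<phi>_common:
  assumes "\<exists>n. \<exists>x\<in>M 0 n. a = \<phi> n x" "\<exists>n. \<exists>x\<in>M 0 n. b = \<phi> n x"
  obtains n x y where "x \<in> M 0 n" "y \<in> M 0 n" "a = \<phi> n x" "b = \<phi> n y"
proof -
  obtain n x m y where *: "x \<in> M 0 n" "a = \<phi> n x" "y \<in> M 0 m" "b = \<phi> m y" using assms by blast
  obtain x' where "x' \<in> M 0 (max n m)" "\<phi> (max n m) x' = a" using \<phi>_lift[OF *(1), of "max n m"] *(2) by auto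
  moreover obtain y' where "y' \<in> M 0 (max n m)" "\<phi> (max n m) y' = b" using \<phi>_lift[OF *(3), of "max n m"] *(4) by auto
  ultimately show ?thesis using that by blast
qed

lemma \<tau>_tendsto: "s \<longlonglongrightarrow> a \<Longrightarrow> (\<lambda>j. \<tau> (s j)) \<longlonglongrightarrow> \<tau> a"
  using \<tau>_continuous by (rule continuous_on_tendsto_compose) auto

lemma \<tau>_add: "\<tau> (a + b) = \<tau> a + \<tau> b"
  and \<tau>_mult_commute: "\<tau> (a * b) = \<tau> (b * a)"
proof -
  obtain s where s: "s \<longlonglongrightarrow> a" "\<And>j. \<exists>n. \<exists>x\<in>M 0 n. s j = \<phi> n x" by (rule \<phi>_sequence[of a]) blast
  obtain t where t: "t \<longlonglongrightarrow> b" "\<And>j. \<exists>n. \<exists>x\<in>M 0 n. t j = \<phi> n x" by (rule \<phi>_sequence[of b]) blast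
  have st: "\<tau> (s j + t j) = \<tau> (s j) + \<tau> (t j) \<and> \<tau> (s j * t j) = \<tau> (t j * s j)" for j
  proof -
    obtain n x y where *: "x \<in> M 0 n" "y \<in> M 0 n" "s j = \<phi> n x" "t j = \<phi> n y"
      by (rule \<phi>_common[OF s(2)[of j] t(2)[of j]])
    interpret P: mat_hom "D 0 n" "\<phi> n" by (rule \<phi>_hom)
    note c [simp] = carrier_matD[OF *(1)] carrier_matD[OF *(2)]
    have "mat_trace (x * y) = mat_trace (y * x)" by (rule mat_trace_commute) simp_all
    then show ?thesis
      using * mult_carrier_mat[OF *(1,2)] mult_carrier_mat[OF *(2,1)]
      by (simp add: P.hom_simps[symmetric] \<tau>_\<phi> add_divide_distrib)
  qed
  have "(\<lambda>j. \<tau> (s j + t j)) \<longlonglongrightarrow> \<tau> (a + b)" by (intro \<tau>_tendsto tendsto_intros s t)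
  moreover have "(\<lambda>j. \<tau> (s j + t j)) \<longlonglongrightarrow> \<tau> a + \<tau> b"
    using st by (auto intro!: tendsto_intros \<tau>_tendsto s t)
  ultimately show "\<tau> (a + b) = \<tau> a + \<tau> b" by (rule LIMSEQ_unique)
  have "(\<lambda>j. \<tau> (s j * t j)) \<longlonglongrightarrow> \<tau> (a * b)" by (intro \<tau>_tendsto tendsto_intros s t)
  moreover have "(\<lambda>j. \<tau> (s j * t j)) \<longlonglongrightarrow> \<tau> (b * a)"
    using st by (auto intro!: \<tau>_tendsto tendsto_intros s t)
  ultimately show "\<tau> (a * b) = \<tau> (b * a)" by (rule LIMSEQ_unique)
qed

lemma \<tau>_zero [simp]: "\<tau> 0 = 0" using \<tau>_add[of 0 0] by simp

lemma \<tau>_sum: "\<tau> (\<Sum>i\<in>S. f i) = (\<Sum>i\<in>S. \<tau> (f i))"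
  by (induction S rule: infinite_finite_induct) (auto simp: \<tau>_add)

lemma \<tau>_norm_le: "cmod (\<tau> a) \<le> norm a"
proof -
  obtain s where s: "s \<longlonglongrightarrow> a" "\<And>j. \<exists>n. \<exists>x\<in>M 0 n. s j = \<phi> n x" by (rule \<phi>_sequence[of a]) blast
  have "cmod (\<tau> (s j)) \<le> norm (s j)" for j
  proof -
    obtain n x where x: "x \<in> M 0 n" "s j = \<phi> n x" using s(2)[of j] by blast
    interpret P: mat_hom "D 0 n" "\<phi> n" by (rule \<phi>_hom)
    show ?thesis using P.norm_trace_le[OF x(1)] D_pos[of 0 n] x
      by (simp add: \<tau>_\<phi> norm_divide divide_le_eq mult.commute)
  qed
  moreover have "(\<lambda>j. cmod (\<tau> (s j))) \<longlonglongrightarrow> cmod (\<tau> a)" "(\<lambda>j. norm (s j)) \<longlonglongrightarrow> norm a"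
    by (intro tendsto_norm \<tau>_tendsto s)+
  ultimately show ?thesis by (blast intro: LIMSEQ_le)
qed

text \<open>The projection of the smallest positive trace in the first \<open>n\<close> factors.\<close>
definition corner :: "nat \<Rightarrow> complex mat" where "corner n = mat_unit (D 0 n) (D 0 n) 0 0"

lemma corner_projection: "mat_projection (D 0 n) (corner n)" and corner_nonzero: "corner n \<noteq> 0\<^sub>m (D 0 n) (D 0 n)"
proof -
  show "mat_projection (D 0 n) (corner n)" unfolding corner_def by (rule mat_projection_mat_unit[OF D_pos])
  have "corner n $$ (0, 0) \<noteq> 0\<^sub>m (D 0 n) (D 0 n) $$ (0, 0)" using D_pos[of 0 n] by (simp add: corner_def)
  then show "corner n \<noteq> 0\<^sub>m (D 0 n) (D 0 n)" by metis
qed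

text \<open>
  In a finite tensor product with more factors, \<open>corner n\<close> becomes the projection \<open>C\<close> onto the first \<open>k\<close>
  basis vectors, where \<open>1 / D 0 n\<close> is the proportion of \<open>k\<close> in the whole dimension; only the first \<open>k\<close> diagonal
  entries of \<open>b\<close> contribute to the trace.
\<close>
lemma \<tau>_corner_le: "cmod (\<tau> (\<phi> n (corner n) * b * \<phi> n (corner n))) \<le> norm b / D 0 n"
proof -
  let ?x = "\<phi> n (corner n)"
  interpret N: mat_hom "D 0 n" "\<phi> n" by (rule \<phi>_hom)
  have xx: "?x * ?x = ?x" using N.hom_projection[OF corner_projection] by (rule projection_mult)
  obtain s where s: "s \<longlonglongrightarrow> b" "\<And>j. \<exists>n. \<exists>x\<in>M 0 n. s j = \<phi> n x" by (rule \<phi>_sequence[of b]) blast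
  have "cmod (\<tau> (?x * s j * ?x)) \<le> norm (s j) / D 0 n" for j
  proof -
    obtain m y0 where y0: "y0 \<in> M 0 m" "s j = \<phi> m y0" using s(2)[of j] by blast
    define l where "l = max m n"
    obtain y where y: "y \<in> M 0 l" "\<phi> l y = s j" using \<phi>_lift[OF y0(1), of l] y0(2) by (auto simp: l_def)
    interpret P: mat_hom "D 0 l" "\<phi> l" by (rule \<phi>_hom)
    have nl: "n \<le> l" by (simp add: l_def)
    define k where "k = D n l"
    have Dl: "D 0 l = D 0 n * k" using D_concat[of 0 n l] nl by (simp add: k_def)
    have k_le: "k \<le> D 0 l" "k > 0" using D_pos[of 0 n] D_pos[of n l] unfolding Dl by (auto simp: k_def)
    define C where "C = mat_tensor (corner n) (1\<^sub>m k)"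
    have C: "C \<in> M 0 l" using Dl by (auto simp: C_def corner_def intro!: carrier_matI)
    have Ci: "C $$ (i, i') = (if i = i' \<and> i < k then 1 else 0)" if "i < D 0 l" "i' < D 0 l" for i i'
    proof -
      have "i div k = 0 \<and> i' div k = 0 \<and> i mod k = i' mod k \<longleftrightarrow> i = i' \<and> i < k"
        using k_le by (auto simp: div_eq_0_iff)
      then show ?thesis
        using that div_mod_bounds[of i "D 0 n" k] div_mod_bounds[of i' "D 0 n" k]
        by (auto simp: C_def corner_def mat_tensor_index Dl)
    qed
    have x: "\<phi> l C = ?x" unfolding C_def k_def using corner_projection mat_projectionD(1) by (intro \<phi>_extend[OF nl]) blast
    have "\<tau> (?x * s j * ?x) = \<tau> (s j * ?x)" using \<tau>_mult_commute[of ?x "s j * ?x"] by (simp add: mult.assoc xx)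
    also have "\<dots> = \<tau> (\<phi> l (y * C))" using P.hom_simps(3)[OF y(1) C] y x by simp
    also have "\<dots> = mat_trace (y * C) / of_nat (D 0 l)" by (rule \<tau>_\<phi>[OF mult_carrier_mat[OF y(1) C]])
    also have "mat_trace (y * C) = (\<Sum>i<D 0 l. if i < k then y $$ (i, i) else 0)"
    proof -
      have "(y * C) $$ (i, i) = (if i < k then y $$ (i, i) else 0)" if "i < D 0 l" for i
      proof -
        have "(y * C) $$ (i, i) = (\<Sum>a<D 0 l. y $$ (i, a) * C $$ (a, i))"
          using y C that by (subst mat_mult_index) auto
        also have "\<dots> = (\<Sum>a<D 0 l. if a = i then (if i < k then y $$ (i, i) else 0) else 0)"
          using that by (intro sum.cong) (auto simp: Ci)
        finally show ?thesis using that by simp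
      qed
      then show ?thesis using y by (simp add: mat_trace_def del: index_mult_mat(1))
    qed
    also have "\<dots> = (\<Sum>i<k. y $$ (i, i))"
      using k_le by (intro sum.mono_neutral_cong_right) auto
    finally have "cmod (\<tau> (?x * s j * ?x)) = cmod (\<Sum>i<k. y $$ (i, i)) / D 0 l" by (simp add: norm_divide)
    also have "cmod (\<Sum>i<k. y $$ (i, i)) \<le> (\<Sum>i<k. norm (s j))"
      using P.norm_diagonal_entry_le[OF y(1)] k_le y(2) by (intro sum_norm_le) auto
    then have "cmod (\<Sum>i<k. y $$ (i, i)) / D 0 l \<le> k * norm (s j) / D 0 l" by (intro divide_right_mono) auto
    also have "k * norm (s j) / D 0 l = norm (s j) / D 0 n" using k_le by (simp add: Dl)
    finally show ?thesis .
  qed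
  moreover have "(\<lambda>j. cmod (\<tau> (?x * s j * ?x))) \<longlonglongrightarrow> cmod (\<tau> (?x * b * ?x))"
    by (intro tendsto_norm \<tau>_tendsto tendsto_intros s)
  moreover have "(\<lambda>j. norm (s j) / D 0 n) \<longlonglongrightarrow> norm b / D 0 n" using D_pos[of 0 n] by (intro tendsto_intros s) auto
  ultimately show ?thesis by (blast intro: LIMSEQ_le)
qed

text \<open>
  If the dimensions of the finite tensor products were bounded, the algebra would be spanned by the
  matrix units of one of them: the matrix coefficients are continuous because the trace is.
\<close>
lemma D_unbounded: "\<exists>n. D 0 n > B"
proof (rule ccontr)
  assume "\<not> (\<exists>n. D 0 n > B)"
  then have "\<forall>n. D 0 n < Suc B" by (simp add: not_less less_Suc_eq_le)
  then obtain N where N: "\<And>n. D 0 n \<le> D 0 N"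
    using ex_has_greatest_nat[of "\<lambda>_. True" 0 "\<lambda>n. D 0 n" "Suc B"] by auto
  define k where "k = D 0 N"
  interpret P: mat_hom k "\<phi> N" unfolding k_def by (rule \<phi>_hom)
  have one: "D N n = 1" if "n \<ge> N" for n
  proof -
    have "D 0 N * D N n \<le> D 0 N * 1" using N[of n] D_concat[of 0 N n] that by simp
    then have "D N n \<le> 1" using D_pos[of 0 N] by simp
    then show ?thesis using D_pos[of N n] by linarith
  qed
  have subset: "\<exists>y\<in>M 0 N. \<phi> n x = \<phi> N y" if x: "x \<in> M 0 n" for n x
  proof (cases "n \<le> N")
    case True
    then show ?thesis using \<phi>_lift[OF x] by metis
  next
    case False
    then have "D 0 n = D 0 N" using D_concat[of 0 N n] one[of n] by simp
    then have x': "x \<in> M 0 N" using x by simp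
    then have "\<phi> N x = \<phi> n x" using \<phi>_extend[of N n x] one[of n] False by simp
    then show ?thesis using x' by metis
  qed
  define u where "u a b = mat_unit k k a b" for a b
  have uc: "u a b \<in> carrier_mat k k" for a b by (simp add: u_def)
  define p where "p a = (\<Sum>i<k. \<Sum>j<k. (of_nat k * \<tau> (\<phi> N (u j i) * a)) *\<^sub>C \<phi> N (u i j))" for a
  have p_\<phi>: "p (\<phi> N x) = \<phi> N x" if x: "x \<in> carrier_mat k k" for x
  proof -
    have tr: "of_nat k * \<tau> (\<phi> N (u j i) * \<phi> N x) = x $$ (i, j)" if ij: "i < k" "j < k" for i j
    proof -
      have "mat_trace (u j i * x) = (\<Sum>l<k. (u j i * x) $$ (l, l))" by (simp add: mat_trace_def u_def)
      also have "\<dots> = (\<Sum>l<k. if l = j then x $$ (i, j) else 0)"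
        using x ij by (intro sum.cong refl) (auto simp: u_def mat_unit_mult_index simp del: index_mult_mat(1))
      finally have "mat_trace (u j i * x) = x $$ (i, j)" using ij by simp
      moreover have "\<tau> (\<phi> N (u j i * x)) = mat_trace (u j i * x) / of_nat k"
        unfolding k_def by (rule \<tau>_\<phi>) (use mult_carrier_mat[OF uc x] in \<open>simp add: k_def\<close>)
      ultimately show ?thesis using P.dim_pos by (simp add: P.hom_simps(3)[OF uc x, symmetric])
    qed
    have "p (\<phi> N x) = (\<Sum>i<k. \<Sum>j<k. \<phi> N (x $$ (i, j) \<cdot>\<^sub>m u i j))"
      unfolding p_def using tr by (intro sum.cong refl) (simp add: P.hom_simps uc)
    also have "\<dots> = (\<Sum>i<k. \<phi> N (mat_sum k k (\<lambda>j. x $$ (i, j) \<cdot>\<^sub>m u i j) {..<k}))"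
      using uc by (intro sum.cong refl) (subst P.hom_sum, auto)
    also have "\<dots> = \<phi> N (mat_sum k k (\<lambda>i. mat_sum k k (\<lambda>j. x $$ (i, j) \<cdot>\<^sub>m u i j) {..<k}) {..<k})"
      by (subst P.hom_sum) (auto intro!: carrier_matI)
    also have "mat_sum k k (\<lambda>i. mat_sum k k (\<lambda>j. x $$ (i, j) \<cdot>\<^sub>m u i j) {..<k}) {..<k} = x"
    proof (rule eq_matI)
      fix a b assume "a < dim_row x" "b < dim_col x"
      then have ab: "a < k" "b < k" using x by auto
      have "(\<Sum>i<k. \<Sum>j<k. x $$ (i, j) * u i j $$ (a, b)) = (\<Sum>i<k. \<Sum>j<k. if j = b then (if i = a then x $$ (a, b) else 0) else 0)"
        using ab by (intro sum.cong refl) (simp add: u_def)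
      also have "\<dots> = x $$ (a, b)" using ab by simp
      finally have "(\<Sum>i<k. \<Sum>j<k. x $$ (i, j) * u i j $$ (a, b)) = x $$ (a, b)" .
      then show "mat_sum k k (\<lambda>i. mat_sum k k (\<lambda>j. x $$ (i, j) \<cdot>\<^sub>m u i j) {..<k}) {..<k} $$ (a, b) = x $$ (a, b)"
        using ab by (simp add: carrier_matD[OF uc])
    qed (use x in auto)
    finally show ?thesis .
  qed
  have "p a = a" for a
  proof -
    obtain s where s: "s \<longlonglongrightarrow> a" "\<And>j. \<exists>n. \<exists>x\<in>M 0 n. s j = \<phi> n x" by (rule \<phi>_sequence[of a]) blast
    have "p (s j) = s j" for j
    proof -
      obtain n x where x: "x \<in> M 0 n" "s j = \<phi> n x" using s(2)[of j] by blast
      obtain y where "y \<in> M 0 N" "\<phi> n x = \<phi> N y" using subset[OF x(1)] by blast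
      then show ?thesis using p_\<phi>[of y] x by (simp add: k_def)
    qed
    moreover have "(\<lambda>j. p (s j)) \<longlonglongrightarrow> p a"
    proof -
      have scaleC_tendsto: "(\<lambda>j. c j *\<^sub>C b) \<longlonglongrightarrow> c0 *\<^sub>C b" if "c \<longlonglongrightarrow> c0" for c c0 and b :: 'a
      proof (rule LIM_zero_cancel, rule tendsto_norm_zero_cancel)
        have "(\<lambda>j. cmod (c j - c0) * norm b) \<longlonglongrightarrow> 0"
          using that by (auto intro!: tendsto_mult_left_zero tendsto_norm_zero LIM_zero)
        then show "(\<lambda>j. norm (c j *\<^sub>C b - c0 *\<^sub>C b)) \<longlonglongrightarrow> 0"
          by (simp add: norm_scaleC flip: scaleC_diff_left)
      qed
      then show ?thesis unfolding p_def
        by (intro tendsto_sum scaleC_tendsto tendsto_mult tendsto_const \<tau>_tendsto s)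
    qed
    ultimately have "s \<longlonglongrightarrow> p a" by simp
    then show ?thesis using s(1) LIMSEQ_unique by blast
  qed
  define S where "S = (\<lambda>(i, j). \<phi> N (u i j)) ` ({..<k} \<times> {..<k})"
  interpret V: Modules.module "scaleC :: complex \<Rightarrow> 'a \<Rightarrow> 'a"
    by unfold_locales (simp_all add: scaleC_add_right scaleC_add_left scaleC_scaleC)
  have "a \<in> V.span S" for a
  proof -
    have "p a \<in> V.span S"
      unfolding p_def by (intro V.span_sum V.span_scale V.span_base) (auto simp: S_def)
    then show ?thesis using \<open>p a = a\<close> by simp
  qed
  moreover have "finite S" by (simp add: S_def)
  ultimately have "\<not> infinite_dimensional TYPE('a)" unfolding infinite_dimensional_def by blast
  then show False using inf_dim by contradiction
qed

lemma D_tendsto: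
  obtains n where "n \<ge> m" "\<And>l. l \<ge> n \<Longrightarrow> D m l \<ge> B"
proof -
  obtain n where n: "D 0 n > D 0 m * B" using D_unbounded by blast
  have "D m l \<ge> B" if l: "l \<ge> max m n" for l
  proof -
    have "D 0 m * D m l = D 0 n * D n l" using l by (simp add: D_concat)
    moreover have "D 0 n \<le> D 0 n * D n l" using D_pos[of n l] by simp
    ultimately have "D 0 m * B \<le> D 0 m * D m l" using n by linarith
    then show ?thesis using D_pos[of 0 m] by simp
  qed
  then show ?thesis using that[of "max m n"] by simp
qed

subsection \<open>The action\<close>

lemma \<alpha>_\<phi>: "g \<in> carrier G \<Longrightarrow> x \<in> M 0 n \<Longrightarrow> \<alpha> g (\<phi> n x) = \<phi> n (\<rho> 0 n g * x * mat_adjoint (\<rho> 0 n g))"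
  using action by (simp add: product_type_action_def D_0 \<rho>_def)

lemma \<rho>_unitary: "g \<in> carrier G \<Longrightarrow> m \<le> n \<Longrightarrow> mat_unitary (D m n) (\<rho> m n g)"
  by (rule unitary_repD(4)[OF \<rho>_rep])

lemma \<alpha>_diff: "g \<in> carrier G \<Longrightarrow> \<alpha> g (a - b) = \<alpha> g a - \<alpha> g b"
proof -
  assume g: "g \<in> carrier G"
  have "\<alpha> g ((a - b) + b) = \<alpha> g (a - b) + \<alpha> g b"
    using action g unfolding product_type_action_def cstar_action_def star_automorphism_def by blast
  then show ?thesis by simp
qed

lemma norm_\<alpha>_le:
  assumes g: "g \<in> carrier G"
  shows "norm (\<alpha> g a) \<le> norm a"
proof -
  obtain s where s: "s \<longlonglongrightarrow> a" "\<And>j. \<exists>n. \<exists>x\<in>M 0 n. s j = \<phi> n x" by (rule \<phi>_sequence[of a]) blast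
  have "norm (\<alpha> g (s j)) \<le> norm (s j)" for j
  proof -
    obtain n x where x: "x \<in> M 0 n" "s j = \<phi> n x" using s(2)[of j] by blast
    interpret P: mat_hom "D 0 n" "\<phi> n" by (rule \<phi>_hom)
    note U = \<rho>_unitary[OF g, of 0 n]
    note Ud = mat_unitaryD[OF U[simplified]]
    have a: "mat_adjoint (\<rho> 0 n g) \<in> M 0 n" using Ud by (auto intro!: carrier_matI)
    have "\<alpha> g (s j) = \<phi> n (\<rho> 0 n g) * s j * (\<phi> n (\<rho> 0 n g))\<^sup>\<star>"
      using x Ud(1) a by (simp add: \<alpha>_\<phi>[OF g] P.hom_simps mult_carrier_mat[OF Ud(1)] mult.assoc)
    then show ?thesis
      using P.hom_unitary(3,4)[OF U[simplified]]
      by (simp add: order_trans[OF norm_mult_le_right norm_mult_le_left])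
  qed
  moreover have "(\<lambda>j. \<alpha> g (s j)) \<longlonglongrightarrow> \<alpha> g a"
    using action g s(1) by (intro continuous_on_tendsto_compose[of UNIV "\<alpha> g"]) (auto simp: product_type_action_def)
  then have "(\<lambda>j. norm (\<alpha> g (s j))) \<longlonglongrightarrow> norm (\<alpha> g a)" by (rule tendsto_norm)
  moreover have "(\<lambda>j. norm (s j)) \<longlonglongrightarrow> norm a" by (intro tendsto_norm s)
  ultimately show ?thesis by (blast intro: LIMSEQ_le)
qed

lemma \<alpha>_\<iota>:
  assumes g: "g \<in> carrier G" and mn: "m \<le> n" and y: "y \<in> M m n"
  shows "\<alpha> g (\<iota> m n y) = \<iota> m n (\<rho> m n g * y * mat_adjoint (\<rho> m n g))"
proof -
  note U = mat_unitaryD[OF \<rho>_unitary[OF g mn]] mat_unitaryD[OF \<rho>_unitary[OF g le0, of m]]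
  have c: "mat_tensor (1\<^sub>m (D 0 m)) y \<in> M 0 n" using y D_concat[of 0 m n] mn by (auto intro!: carrier_matI)
  have "\<rho> 0 n g * mat_tensor (1\<^sub>m (D 0 m)) y * mat_adjoint (\<rho> 0 n g)
    = mat_tensor (1\<^sub>m (D 0 m)) (\<rho> m n g * y * mat_adjoint (\<rho> m n g))"
    unfolding \<rho>_concat[of 0 m n g, OF le0 mn, symmetric] using U y by (simp add: mat_tensor_mult)
  then show ?thesis unfolding \<iota>_def \<alpha>_\<phi>[OF g c] by simp
qed

end

section \<open>The strict Rokhlin property\<close>

text \<open>The mean of the \<open>\<pi> g\<close> is a projection of trace \<open>k / card G\<close>, and traces of projections are natural numbers.\<close>
lemma card_dvd_if_character_eq_0:
  assumes G: "group G" "finite (carrier G)" and \<pi>: "unitary_rep G k \<pi>"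
    and zero: "\<And>g. g \<in> carrier G \<Longrightarrow> g \<noteq> \<one>\<^bsub>G\<^esub> \<Longrightarrow> mat_trace (\<pi> g) = 0"
  shows "card (carrier G) dvd k"
proof -
  interpret group G by (rule G(1))
  define N where "N = card (carrier G)"
  have N: "N > 0" using G(2) one_closed by (auto simp: N_def card_gt_0_iff)
  have c: "\<pi> g \<in> carrier_mat k k" if "g \<in> carrier G" for g by (rule unitary_repD(1)[OF \<pi> that])
  define S where "S = mat_sum k k \<pi> (carrier G)"
  have Sd [simp]: "dim_row S = k" "dim_col S = k" by (simp_all add: S_def)
  have S_invariant: "\<pi> g * S = S" if g: "g \<in> carrier G" for g
  proof -
    have bij: "bij_betw (\<lambda>h. g \<otimes>\<^bsub>G\<^esub> h) (carrier G) (carrier G)"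
      by (rule bij_betwI[where g = "\<lambda>h. inv\<^bsub>G\<^esub> g \<otimes>\<^bsub>G\<^esub> h"]) (use g in \<open>auto simp flip: m_assoc\<close>)
    have "\<pi> g * S = mat_sum k k (\<lambda>h. \<pi> g * \<pi> h) (carrier G)"
      unfolding S_def using c[OF g] by (subst mat_sum_mult_left) (auto intro: c)
    also have "\<dots> = mat_sum k k (\<lambda>h. \<pi> (g \<otimes>\<^bsub>G\<^esub> h)) (carrier G)"
      by (intro mat_sum_cong refl unitary_repD(5)[OF \<pi> g, symmetric])
    also have "\<dots> = S" unfolding S_def by (rule mat_sum_reindex[OF bij])
    finally show ?thesis .
  qed
  have SS: "S * S = of_nat N \<cdot>\<^sub>m S"
  proof -
    have "S * S = mat_sum k k (\<lambda>g. \<pi> g * S) (carrier G)"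
      unfolding S_def[of] by (subst mat_sum_mult_right) (auto intro: c)
    also have "\<dots> = mat_sum k k (\<lambda>g. S) (carrier G)" using S_invariant by (intro mat_sum_cong) auto
    also have "\<dots> = of_nat N \<cdot>\<^sub>m S" unfolding N_def by (rule mat_sum_const) (rule carrier_matI, simp_all)
    finally show ?thesis .
  qed
  have S_adj: "mat_adjoint S = S"
  proof -
    have bij: "bij_betw (\<lambda>g. inv\<^bsub>G\<^esub> g) (carrier G) (carrier G)"
      by (rule bij_betwI[where g = "\<lambda>g. inv\<^bsub>G\<^esub> g"]) auto
    have "mat_adjoint S = mat_sum k k (\<lambda>g. mat_adjoint (\<pi> g)) (carrier G)"
      unfolding S_def by (rule mat_sum_adjoint[OF c])
    also have "\<dots> = mat_sum k k (\<lambda>g. \<pi> (inv\<^bsub>G\<^esub> g)) (carrier G)"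
      by (intro mat_sum_cong refl unitary_rep_inv[OF G(1) \<pi>, symmetric])
    also have "\<dots> = S" unfolding S_def by (rule mat_sum_reindex[OF bij])
    finally show ?thesis .
  qed
  have "(1 / of_nat N :: complex) \<cdot>\<^sub>m ((1 / of_nat N) \<cdot>\<^sub>m (of_nat N \<cdot>\<^sub>m S)) = (1 / of_nat N) \<cdot>\<^sub>m S"
    using N by (intro eq_matI) auto
  then have "mat_projection k ((1 / of_nat N) \<cdot>\<^sub>m S)"
    by (auto simp: mat_projection_def S_adj mat_distribs SS intro!: carrier_matI)
  then obtain j where j: "mat_trace ((1 / of_nat N) \<cdot>\<^sub>m S) = of_nat j" by (rule mat_projection_trace_nat)
  have "mat_trace S = (\<Sum>g\<in>carrier G. mat_trace (\<pi> g))" unfolding S_def by (rule mat_sum_trace[OF c])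
  also have "\<dots> = (\<Sum>g\<in>carrier G. if g = \<one>\<^bsub>G\<^esub> then of_nat k else 0)"
    using zero by (intro sum.cong) (auto simp: unitary_rep_one[OF G(1) \<pi>])
  also have "\<dots> = of_nat k" using G(2) by simp
  finally have "of_nat k = (of_nat (N * j) :: complex)" using j N by (simp add: field_simps)
  then have "k = N * j" by (simp only: of_nat_eq_iff)
  then show ?thesis by (simp add: N_def)
qed

context product_action
begin

text \<open>Averaging over matrix units of the first factors is a partial trace, with values in the other factors.\<close>
lemma matrix_unit_average:
  assumes mn: "m \<le> n" and Y: "Y \<in> M 0 n" "mat_adjoint Y = Y"
  obtains Z where "Z \<in> M m n" "mat_adjoint Z = Z"
    "(\<Sum>i<D 0 m. \<Sum>j<D 0 m. \<phi> m (mat_unit (D 0 m) (D 0 m) i j) * \<phi> n Y * \<phi> m (mat_unit (D 0 m) (D 0 m) j i)) = \<iota> m n Z"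
proof -
  define K where "K = D 0 m"
  define k where "k = D m n"
  have Kk: "K * k = D 0 n" using D_concat[of 0 m n] mn by (simp add: K_def k_def)
  interpret P: mat_hom "D 0 n" "\<phi> n" by (rule \<phi>_hom)
  note Yd [simp] = carrier_matD[OF Y(1)]
  define W where "W j = mat_tensor (mat_unit K 1 j 0) (1\<^sub>m k)" for j
  have Wd [simp]: "dim_row (W j) = D 0 n" "dim_col (W j) = k" for j by (simp_all add: W_def Kk)
  define Z where "Z = mat_sum k k (\<lambda>j. mat_adjoint (W j) * (Y * W j)) {..<K}"
  have Zd [simp]: "dim_row Z = k" "dim_col Z = k" by (simp_all add: Z_def)
  have Z: "Z \<in> M m n" by (rule carrier_matI) (simp_all add: k_def[symmetric])
  have Zadj: "mat_adjoint Z = Z"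
  proof -
    have "mat_adjoint Z = mat_sum k k (\<lambda>j. mat_adjoint (mat_adjoint (W j) * (Y * W j))) {..<K}"
      unfolding Z_def by (rule mat_sum_adjoint) (rule carrier_matI, simp_all)
    also have "\<dots> = Z" unfolding Z_def by (rule mat_sum_cong) (simp_all add: mat_adjoint_mult Y(2) mat_assoc)
    finally show ?thesis .
  qed
  have unit: "\<phi> m (mat_unit K K i j) = \<phi> n (W i * mat_adjoint (W j))" for i j
  proof -
    have "W i * mat_adjoint (W j) = mat_tensor (mat_unit K K i j) (1\<^sub>m k)"
      unfolding W_def by (simp add: mat_tensor_mult mat_unit_mult)
    then show ?thesis using \<phi>_extend[OF mn, of "mat_unit K K i j"] by (simp add: K_def k_def)
  qed
  have WW: "W i * mat_adjoint (W j) \<in> M 0 n" for i j by (rule carrier_matI) simp_all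
  have sandwich_c: "W i * (mat_adjoint (W j) * (Y * (W j * mat_adjoint (W i)))) \<in> M 0 n" for i j by (rule carrier_matI) simp_all
  have "(\<Sum>i<K. \<Sum>j<K. \<phi> m (mat_unit K K i j) * \<phi> n Y * \<phi> m (mat_unit K K j i))
    = (\<Sum>i<K. \<Sum>j<K. \<phi> n (W i * (mat_adjoint (W j) * (Y * (W j * mat_adjoint (W i))))))"
  proof (intro sum.cong refl)
    fix i j
    have "\<phi> n (W i * mat_adjoint (W j)) * \<phi> n Y * \<phi> n (W j * mat_adjoint (W i))
      = \<phi> n (W i * mat_adjoint (W j) * Y * (W j * mat_adjoint (W i)))"
      by (simp only: P.hom_simps(3) WW Y(1) mult_carrier_mat[OF WW Y(1)])
    then show "\<phi> m (mat_unit K K i j) * \<phi> n Y * \<phi> m (mat_unit K K j i)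
      = \<phi> n (W i * (mat_adjoint (W j) * (Y * (W j * mat_adjoint (W i)))))"
      unfolding unit by (simp add: mat_assoc)
  qed
  also have "\<dots> = (\<Sum>i<K. \<phi> n (W i * (Z * mat_adjoint (W i))))"
  proof (rule sum.cong[OF refl])
    fix i
    have "(\<Sum>j<K. \<phi> n (W i * (mat_adjoint (W j) * (Y * (W j * mat_adjoint (W i))))))
      = \<phi> n (mat_sum (D 0 n) (D 0 n) (\<lambda>j. W i * (mat_adjoint (W j) * (Y * (W j * mat_adjoint (W i))))) {..<K})"
      by (rule P.hom_sum[OF sandwich_c, symmetric])
    also have "mat_sum (D 0 n) (D 0 n) (\<lambda>j. W i * (mat_adjoint (W j) * (Y * (W j * mat_adjoint (W i))))) {..<K}
      = W i * mat_sum k (D 0 n) (\<lambda>j. mat_adjoint (W j) * (Y * W j) * mat_adjoint (W i)) {..<K}"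
      by (subst mat_sum_mult_left) (auto simp: mat_assoc intro!: carrier_matI)
    also have "mat_sum k (D 0 n) (\<lambda>j. mat_adjoint (W j) * (Y * W j) * mat_adjoint (W i)) {..<K} = Z * mat_adjoint (W i)"
      unfolding Z_def by (subst mat_sum_mult_right) (auto intro!: carrier_matI)
    finally show "(\<Sum>j<K. \<phi> n (W i * (mat_adjoint (W j) * (Y * (W j * mat_adjoint (W i)))))) = \<phi> n (W i * (Z * mat_adjoint (W i)))" .
  qed
  also have "\<dots> = (\<Sum>i<K. \<phi> m (mat_unit K K i i) * \<iota> m n Z)"
  proof (rule sum.cong[OF refl])
    fix i
    have "W i * (mat_tensor (1\<^sub>m 1) Z * mat_adjoint (W i)) = mat_tensor (mat_unit K K i i) Z"
      unfolding W_def mat_tensor_adjoint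
      by (subst mat_tensor_mult, simp, simp, subst mat_tensor_mult, simp, simp) (simp add: mat_unit_mult)
    then show "\<phi> n (W i * (Z * mat_adjoint (W i))) = \<phi> m (mat_unit K K i i) * \<iota> m n Z"
      using \<phi>_\<iota>(1)[OF mn _ Z, of "mat_unit K K i i"] by (simp add: K_def)
  qed
  also have "\<dots> = (\<Sum>i<K. \<phi> m (mat_unit K K i i)) * \<iota> m n Z" by (simp add: sum_distrib_right)
  also have "(\<Sum>i<K. \<phi> m (mat_unit K K i i)) = 1"
  proof -
    interpret Q: mat_hom K "\<phi> m" unfolding K_def by (rule \<phi>_hom)
    show ?thesis using Q.hom_sum[of "{..<K}" "\<lambda>i. mat_unit K K i i"] by (simp add: mat_unit_sum Q.hom_simps)
  qed
  finally show ?thesis using that[OF Z Zadj] by (simp add: K_def)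
qed

text \<open>
  The sum of all \<open>e\<^sub>i\<^sub>j e\<^sub>j\<^sub>i\<close> is the size of the matrix units, so averaging changes \<open>a\<close> only by its commutators
  with them.
\<close>
lemma matrix_unit_average_near:
  fixes \<eta> :: real
  assumes comm: "\<And>i j. i < D 0 m \<Longrightarrow> j < D 0 m \<Longrightarrow>
      norm (a * \<phi> m (mat_unit (D 0 m) (D 0 m) i j) - \<phi> m (mat_unit (D 0 m) (D 0 m) i j) * a) \<le> \<eta>"
    and near: "norm (y - a) \<le> \<eta>"
  shows "norm ((1 / of_nat (D 0 m) :: complex) *\<^sub>C
      (\<Sum>i<D 0 m. \<Sum>j<D 0 m. \<phi> m (mat_unit (D 0 m) (D 0 m) i j) * y * \<phi> m (mat_unit (D 0 m) (D 0 m) j i)) - a) \<le> 2 * real (D 0 m) * \<eta>"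
proof -
  define K where "K = D 0 m"
  have K: "K > 0" using D_pos by (simp add: K_def)
  interpret P: mat_hom K "\<phi> m" unfolding K_def by (rule \<phi>_hom)
  define u where "u i j = \<phi> m (mat_unit K K i j)" for i j
  have u: "norm (u i j) \<le> 1" if "i < K" "j < K" for i j unfolding u_def by (rule P.norm_mat_unit_le[OF that])
  have u_mult: "u i j * u j i = u i i" if "j < K" for i j
    unfolding u_def using that by (simp add: P.hom_simps(3)[symmetric] mat_unit_mult)
  have u_sum: "(\<Sum>i<K. u i i) = 1"
    unfolding u_def using P.hom_sum[of "{..<K}" "\<lambda>i. mat_unit K K i i"] by (simp add: mat_unit_sum P.hom_simps)
  have "(\<Sum>i<K. \<Sum>j<K. a * (u i j * u j i)) = (\<Sum>i<K. \<Sum>j<K. a * u i i)"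
    using u_mult by (intro sum.cong refl) simp
  also have "\<dots> = of_nat K * a"
    by (simp add: u_sum flip: sum_distrib_left)
  finally have a_sum: "of_nat K * a = (\<Sum>i<K. \<Sum>j<K. a * (u i j * u j i))" by simp
  have Ka: "of_nat K * b = complex_of_real (real K) *\<^sub>C b" for b :: 'a
    by (metis scaleR_scaleC scaleR_conv_of_real of_real_of_nat_eq)
  define T where "T = (\<Sum>i<K. \<Sum>j<K. u i j * y * u j i)"
  have "T - of_nat K * a = (\<Sum>i<K. \<Sum>j<K. u i j * (y - a) * u j i - (a * u i j - u i j * a) * u j i)"
    unfolding T_def a_sum by (simp add: algebra_simps sum_subtractf sum.distrib)
  also have "norm \<dots> \<le> (\<Sum>i<K. \<Sum>j<K. 2 * \<eta>)"
  proof (intro order_trans[OF norm_sum] sum_mono)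
    fix i j assume "i \<in> {..<K}" "j \<in> {..<K}"
    then have ij: "i < K" "j < K" by auto
    have "norm (u i j * (y - a) * u j i) \<le> \<eta>"
      using near norm_mult_le_right[OF u[OF ij(2,1)], of "u i j * (y - a)"] norm_mult_le_left[OF u[OF ij], of "y - a"] by linarith
    moreover have "norm ((a * u i j - u i j * a) * u j i) \<le> \<eta>"
      using comm[of i j] ij norm_mult_le_right[OF u[OF ij(2,1)], of "a * u i j - u i j * a"] by (simp add: K_def u_def)
    ultimately show "norm (u i j * (y - a) * u j i - (a * u i j - u i j * a) * u j i) \<le> 2 * \<eta>"
      using norm_triangle_ineq4[of "u i j * (y - a) * u j i" "(a * u i j - u i j * a) * u j i"] by linarith
  qed
  finally have "norm (T - of_nat K * a) \<le> real K * real K * (2 * \<eta>)" by simp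
  moreover have "(1 / of_nat K :: complex) *\<^sub>C T - a = (1 / of_nat K) *\<^sub>C (T - of_nat K * a)"
    using K by (simp add: scaleC_diff_right Ka scaleC_scaleC)
  then have "norm ((1 / of_nat K :: complex) *\<^sub>C T - a) = norm (T - of_nat K * a) / real K"
    by (simp add: norm_scaleC norm_divide)
  ultimately have "norm ((1 / of_nat K :: complex) *\<^sub>C T - a) \<le> real K * real K * (2 * \<eta>) / real K"
    using divide_right_mono[of "norm (T - of_nat K * a)" "real K * real K * (2 * \<eta>)" "real K"] by simp
  also have "\<dots> = 2 * real K * \<eta>" using K by simp
  finally show ?thesis by (simp add: T_def u_def K_def)
qed

text \<open>
  Rokhlin projections that nearly commute with the first \<open>m\<close> factors are moved into the commutant of
  these factors, and there the projection for the unit element is made exact; its exact translates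
  are then close to all the given projections.
\<close>
lemma strict_Rokhlin_imp_character_eq_0:
  assumes R: "strict_Rokhlin G \<alpha>"
  obtains n where "n > m" "\<And>g. g \<in> carrier G \<Longrightarrow> g \<noteq> \<one>\<^bsub>G\<^esub> \<Longrightarrow> mat_trace (\<rho> m n g) = 0"
proof -
  interpret group G by (rule G(1))
  define N where "N = card (carrier G)"
  have N: "N > 0" using G(2) one_closed by (auto simp: N_def card_gt_0_iff)
  define K where "K = D 0 m"
  have K: "K > 0" using D_pos by (simp add: K_def)
  \<comment> \<open>The projection for the unit element is moved by at most \<open>\<delta> = 2 * K * \<eta>\<close> by averaging, and by another \<open>8 * \<delta>\<close>
    to make it a projection again; the translates must end within \<open>1 / (4 * N)\<close> of the given projections.\<close>
  define \<eta> where "\<eta> = 1 / (76 * real K * real N)"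
  have \<eta>: "\<eta> > 0" using K N by (simp add: \<eta>_def)
  define \<delta> where "\<delta> = 2 * real K * \<eta>"
  have \<delta>_eq: "\<delta> = 1 / (38 * real N)" using K N by (simp add: \<delta>_def \<eta>_def field_simps)
  have \<delta>: "\<delta> \<ge> 0" "\<delta> \<le> 1" using N unfolding \<delta>_eq by (auto simp: divide_le_eq)
  let ?F = "(\<lambda>(i, j). \<phi> m (mat_unit K K i j)) ` ({..<K} \<times> {..<K})"
  have "finite ?F" by simp
  with R \<eta> obtain e where e: "orthogonal_projections (carrier G) e" "(\<Sum>g\<in>carrier G. e g) = 1"
    "\<And>g h. g \<in> carrier G \<Longrightarrow> h \<in> carrier G \<Longrightarrow> norm (\<alpha> g (e h) - e (g \<otimes>\<^bsub>G\<^esub> h)) < \<eta>"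
    "\<And>g a. g \<in> carrier G \<Longrightarrow> a \<in> ?F \<Longrightarrow> norm (e g * a - a * e g) < \<eta>"
    unfolding strict_Rokhlin_def by metis
  have eproj: "projection (e g)" if "g \<in> carrier G" for g using e(1) that by (simp add: orthogonal_projections_def)
  let ?a = "e \<one>\<^bsub>G\<^esub>"
  have a: "?a\<^sup>\<star> = ?a" "?a * ?a = ?a" "norm ?a \<le> 1"
    using eproj[OF one_closed] projection_star projection_mult norm_projection_le by auto
  obtain n1 x where x: "x \<in> M 0 n1" "norm (?a - \<phi> n1 x) < \<eta>" using dense[OF \<eta>] .
  obtain y where y: "y \<in> M 0 n1" "mat_adjoint y = y" "norm (?a - \<phi> n1 y) < \<eta>"
    using hermitian_part[OF x(1) a(1) x(2)] .
  define n where "n = max n1 (Suc m)"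
  have mn: "m \<le> n" "n > m" "n1 \<le> n" by (auto simp: n_def)
  define Y where "Y = mat_tensor y (1\<^sub>m (D n1 n))"
  have Y: "Y \<in> M 0 n" "mat_adjoint Y = Y" "\<phi> n Y = \<phi> n1 y"
    using y D_concat[of 0 n1 n] mn \<phi>_extend[OF mn(3) y(1)] by (auto simp: Y_def intro!: carrier_matI)
  obtain Z0 where Z0: "Z0 \<in> M m n" "mat_adjoint Z0 = Z0"
    "(\<Sum>i<D 0 m. \<Sum>j<D 0 m. \<phi> m (mat_unit (D 0 m) (D 0 m) i j) * \<phi> n Y * \<phi> m (mat_unit (D 0 m) (D 0 m) j i)) = \<iota> m n Z0"
    using matrix_unit_average[OF mn(1) Y(1,2)] .
  define k where "k = D m n"
  interpret I: mat_hom k "\<iota> m n" unfolding k_def by (rule \<iota>_hom[OF mn(1)])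
  define Z where "Z = (1 / of_nat K :: complex) \<cdot>\<^sub>m Z0"
  have Z: "Z \<in> carrier_mat k k" "mat_adjoint Z = Z" using Z0 by (simp_all add: Z_def k_def)
  let ?f = "\<iota> m n Z"
  have f_eq: "?f = (1 / of_nat K :: complex) *\<^sub>C \<iota> m n Z0"
    unfolding Z_def using Z0(1) by (intro I.hom_simps(5)) (simp add: k_def)
  have f: "norm (?f - ?a) \<le> \<delta>"
    unfolding f_eq Z0(3)[symmetric] \<delta>_def K_def
  proof (rule matrix_unit_average_near)
    show "norm (?a * \<phi> m (mat_unit (D 0 m) (D 0 m) i j) - \<phi> m (mat_unit (D 0 m) (D 0 m) i j) * ?a) \<le> \<eta>" if "i < D 0 m" "j < D 0 m" for i j
      using e(4)[OF one_closed, of "\<phi> m (mat_unit (D 0 m) (D 0 m) i j)"] that by (force simp: K_def)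
    show "norm (\<phi> n Y - ?a) \<le> \<eta>" using y(3) by (simp add: Y(3) norm_minus_commute)
  qed
  have "norm (?f * ?f - ?f) \<le> 4 * \<delta>"
  proof -
    let ?r = "?f - ?a"
    have eq: "?f * ?f - ?f = ?a * ?r + ?r * ?a + ?r * ?r - ?r" by (simp add: algebra_simps a(2))
    have "norm (?a * ?r) \<le> \<delta>" using norm_mult_le_left[OF a(3), of ?r] f by linarith
    moreover have "norm (?r * ?a) \<le> \<delta>" using norm_mult_le_right[OF a(3), of ?r] f by linarith
    moreover have "norm (?r * ?r) \<le> \<delta>" using norm_mult_le_left[of ?r ?r] f \<delta>(2) by linarith
    ultimately show ?thesis unfolding eq
      using norm_triangle_ineq4[of "?a * ?r + ?r * ?a + ?r * ?r" ?r] norm_triangle_ineq[of "?a * ?r + ?r * ?a" "?r * ?r"]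
        norm_triangle_ineq[of "?a * ?r" "?r * ?a"] f by linarith
  qed
  then obtain P where P: "mat_projection k P" "norm (\<iota> m n P - ?f) \<le> 2 * (4 * \<delta>)"
    by (rule I.near_projection[OF Z])
  have Pc: "P \<in> M m n" using mat_projectionD(1)[OF P(1)] by (simp add: k_def)
  have Pa: "norm (\<iota> m n P - ?a) \<le> 9 * \<delta>"
    using norm_triangle_ineq[of "\<iota> m n P - ?f" "?f - ?a"] P(2) f by simp
  let ?p = "\<lambda>h. \<iota> m n (\<rho> m n h * P * mat_adjoint (\<rho> m n h))"
  define \<kappa> where "\<kappa> = 1 / (4 * real N)"
  have p_near: "norm (?p h - e h) \<le> \<kappa>" if h: "h \<in> carrier G" for h
  proof -
    have eq: "?p h - e h = \<alpha> h (\<iota> m n P - ?a) + (\<alpha> h ?a - e h)"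
      by (simp add: \<alpha>_diff[OF h] \<alpha>_\<iota>[OF h mn(1) Pc])
    have "norm (\<alpha> h (\<iota> m n P - ?a)) \<le> 9 * \<delta>" using norm_\<alpha>_le[OF h] Pa by (rule order_trans)
    moreover have "norm (\<alpha> h ?a - e h) < \<eta>" using e(3)[OF h one_closed] h by simp
    moreover have "9 * \<delta> + \<eta> \<le> \<kappa>"
    proof -
      have "\<eta> \<le> \<delta> / 2" using K \<eta> by (simp add: \<delta>_def)
      then show ?thesis using N by (simp add: \<delta>_eq \<kappa>_def field_simps)
    qed
    ultimately show ?thesis unfolding eq
      using norm_triangle_ineq[of "\<alpha> h (\<iota> m n P - ?a)" "\<alpha> h ?a - e h"] by linarith
  qed
  have p_proj: "norm (?p h) \<le> 1" if h: "h \<in> carrier G" for h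
  proof -
    note U = mat_unitaryD[OF \<rho>_unitary[OF h mn(1)], folded k_def] note Pd = mat_projectionD[OF P(1)]
    have "mat_projection k (\<rho> m n h * P * mat_adjoint (\<rho> m n h))"
      using U Pd by (auto simp: mat_projection_def mat_adjoint_mult mat_assoc intro!: carrier_matI)
    then show ?thesis by (intro norm_projection_le I.hom_projection)
  qed
  have orth: "norm (?p h * ?p l) \<le> 1 / (2 * real N)" if hl: "h \<in> carrier G" "l \<in> carrier G" "h \<noteq> l" for h l
  proof -
    have "e h * e l = 0" using e(1) hl by (simp add: orthogonal_projections_def)
    then have eq: "?p h * ?p l = (?p h - e h) * ?p l + e h * (?p l - e l)" by (simp add: algebra_simps)
    have "norm ((?p h - e h) * ?p l) \<le> \<kappa>"
      using norm_mult_le_right[OF p_proj[OF hl(2)], of "?p h - e h"] p_near[OF hl(1)] by linarith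
    moreover have "norm (e h * (?p l - e l)) \<le> \<kappa>"
      using norm_mult_le_left[OF norm_projection_le[OF eproj[OF hl(1)]], of "?p l - e l"] p_near[OF hl(2)] by linarith
    ultimately have "norm (?p h * ?p l) \<le> 2 * \<kappa>" unfolding eq
      using norm_triangle_ineq[of "(?p h - e h) * ?p l" "e h * (?p l - e l)"] by linarith
    then show ?thesis by (simp add: \<kappa>_def)
  qed
  have sum: "norm (1 - (\<Sum>h\<in>carrier G. ?p h)) < 1"
  proof -
    have "norm (1 - (\<Sum>h\<in>carrier G. ?p h)) = norm (\<Sum>h\<in>carrier G. e h - ?p h)"
      by (simp add: sum_subtractf e(2))
    also have "\<dots> \<le> (\<Sum>h\<in>carrier G. \<kappa>)"
      using p_near by (intro sum_norm_le) (simp add: norm_minus_commute)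
    also have "\<dots> < 1" using N by (simp add: \<kappa>_def N_def)
    finally show ?thesis .
  qed
  have rep: "unitary_rep G k (\<rho> m n)" unfolding k_def by (rule \<rho>_rep[OF mn(1)])
  have "mat_trace (\<rho> m n g) = 0" if g: "g \<in> carrier G" "g \<noteq> \<one>\<^bsub>G\<^esub>" for g
    by (rule I.character_eq_0_if_near_tower[OF G rep P(1) _ sum g]) (use orth in \<open>simp add: N_def\<close>)
  then show ?thesis using that mn(2) by blast
qed

text \<open>Equivariant projections in a later factor commute with the earlier ones and are permuted by the action.\<close>
lemma tower_in_later_factors:
  assumes mn: "m \<le> n" and equi: "equivariant_projections G (D m n) (\<rho> m n) e"
  shows "orthogonal_projections (carrier G) (\<lambda>g. \<iota> m n (e g))"
    and "\<And>g h. g \<in> carrier G \<Longrightarrow> h \<in> carrier G \<Longrightarrow> \<alpha> g (\<iota> m n (e h)) = \<iota> m n (e (g \<otimes>\<^bsub>G\<^esub> h))"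
    and "\<And>g a x. g \<in> carrier G \<Longrightarrow> x \<in> M 0 m \<Longrightarrow> norm (a - \<phi> m x) < \<epsilon> / 2 \<Longrightarrow>
      norm (\<iota> m n (e g) * a - a * \<iota> m n (e g)) < \<epsilon>"
    and "\<iota> m n (mat_sum (D m n) (D m n) e (carrier G)) = (\<Sum>g\<in>carrier G. \<iota> m n (e g))"
proof -
  interpret I: mat_hom "D m n" "\<iota> m n" by (rule \<iota>_hom[OF mn])
  have e: "\<And>g. g \<in> carrier G \<Longrightarrow> mat_projection (D m n) (e g)"
    "\<And>g h. g \<in> carrier G \<Longrightarrow> h \<in> carrier G \<Longrightarrow> g \<noteq> h \<Longrightarrow> e g * e h = 0\<^sub>m (D m n) (D m n)"
    "\<And>g h. g \<in> carrier G \<Longrightarrow> h \<in> carrier G \<Longrightarrow> \<rho> m n g * e h * mat_adjoint (\<rho> m n g) = e (g \<otimes>\<^bsub>G\<^esub> h)"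
    using equi by (auto simp: equivariant_projections_def)
  have ec: "e g \<in> M m n" if "g \<in> carrier G" for g using e(1)[OF that] by (rule mat_projectionD(1))
  show "orthogonal_projections (carrier G) (\<lambda>g. \<iota> m n (e g))"
    unfolding orthogonal_projections_def
    using e(1,2) ec by (simp add: I.hom_projection I.hom_simps(3)[symmetric] I.hom_zero)
  show "\<alpha> g (\<iota> m n (e h)) = \<iota> m n (e (g \<otimes>\<^bsub>G\<^esub> h))" if "g \<in> carrier G" "h \<in> carrier G" for g h
    using \<alpha>_\<iota>[OF that(1) mn ec[OF that(2)]] e(3)[OF that] by simp
  show "norm (\<iota> m n (e g) * a - a * \<iota> m n (e g)) < \<epsilon>"
    if g: "g \<in> carrier G" and x: "x \<in> M 0 m" and near: "norm (a - \<phi> m x) < \<epsilon> / 2" for g a x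
  proof -
    let ?e = "\<iota> m n (e g)" let ?r = "a - \<phi> m x"
    have n: "norm ?e \<le> 1" by (rule norm_projection_le[OF I.hom_projection[OF e(1)[OF g]]])
    have "?e * a - a * ?e = ?e * ?r - ?r * ?e"
      using \<phi>_commute_\<iota>[OF mn x ec[OF g]] by (simp add: algebra_simps)
    then have "norm (?e * a - a * ?e) \<le> norm ?r + norm ?r"
      using norm_triangle_ineq4[of "?e * ?r" "?r * ?e"] norm_mult_le_left[OF n, of ?r] norm_mult_le_right[OF n, of ?r] by simp
    then show ?thesis using near by simp
  qed
  show "\<iota> m n (mat_sum (D m n) (D m n) e (carrier G)) = (\<Sum>g\<in>carrier G. \<iota> m n (e g))"
    by (rule I.hom_sum[OF ec])
qed

lemma strict_Rokhlin_if_character_eq_0: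
  assumes later: "\<And>l. \<exists>m n. l \<le> m \<and> m \<le> n \<and> (\<forall>g\<in>carrier G. g \<noteq> \<one>\<^bsub>G\<^esub> \<longrightarrow> mat_trace (\<rho> m n g) = 0)"
  shows "strict_Rokhlin G \<alpha>"
  unfolding strict_Rokhlin_def
proof (intro allI impI, elim conjE)
  fix F :: "'a set" and \<epsilon> :: real assume F: "finite F" and \<epsilon>: "\<epsilon> > 0"
  obtain l where l: "\<And>m a. m \<ge> l \<Longrightarrow> a \<in> F \<Longrightarrow> \<exists>x\<in>M 0 m. norm (a - \<phi> m x) < \<epsilon> / 2"
    using dense_finite[OF F, of "\<epsilon> / 2"] \<epsilon> by auto
  obtain m n where mn: "l \<le> m" "m \<le> n" and zero: "\<And>g. g \<in> carrier G \<Longrightarrow> g \<noteq> \<one>\<^bsub>G\<^esub> \<Longrightarrow> mat_trace (\<rho> m n g) = 0"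
    using later[of l] by blast
  let ?k = "D m n"
  interpret I: mat_hom ?k "\<iota> m n" by (rule \<iota>_hom[OF mn(2)])
  note rep = \<rho>_rep[OF mn(2)]
  obtain j where j: "?k = card (carrier G) * j" using card_dvd_if_character_eq_0[OF G rep zero] by (auto elim: dvdE)
  have "real (card (carrier G) * j) + (\<Sum>g\<in>carrier G - {\<one>\<^bsub>G\<^esub>}. cmod (mat_trace (\<rho> m n g))) \<le> real ?k"
    using zero by (simp add: j)
  then obtain e where e: "equivariant_projections G ?k (\<rho> m n) e"
    and tr: "mat_trace (mat_sum ?k ?k e (carrier G)) = of_nat (card (carrier G) * j)"
    using equivariant_projections_exist[OF G rep] by blast
  note T = tower_in_later_factors[OF mn(2) e]
  have sum1: "(\<Sum>g\<in>carrier G. \<iota> m n (e g)) = 1"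
  proof -
    have S: "mat_projection ?k (mat_sum ?k ?k e (carrier G))"
      by (rule equivariant_projections_sum[OF e G(2)])
    note S' = mat_projection_one_minus[OF S]
    have "1\<^sub>m ?k - mat_sum ?k ?k e (carrier G) = 0\<^sub>m ?k ?k"
      by (rule mat_projection_trace_eq_0[OF S']) (use tr j in simp)
    then have "\<iota> m n (1\<^sub>m ?k) - \<iota> m n (mat_sum ?k ?k e (carrier G)) = 0"
      using I.hom_diff[of "1\<^sub>m ?k" "mat_sum ?k ?k e (carrier G)"] mat_projectionD(1)[OF S] by (simp add: I.hom_zero)
    then show ?thesis by (simp add: T(4) I.hom_simps)
  qed
  show "\<exists>e. orthogonal_projections (carrier G) e \<and> (\<Sum>g\<in>carrier G. e g) = 1
     \<and> (\<forall>g\<in>carrier G. \<forall>h\<in>carrier G. norm (\<alpha> g (e h) - e (g \<otimes>\<^bsub>G\<^esub> h)) < \<epsilon>)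
     \<and> (\<forall>g\<in>carrier G. \<forall>a\<in>F. norm (e g * a - a * e g) < \<epsilon>)"
  proof (intro exI[of _ "\<lambda>g. \<iota> m n (e g)"] conjI ballI T(1) sum1)
    show "norm (\<alpha> g (\<iota> m n (e h)) - \<iota> m n (e (g \<otimes>\<^bsub>G\<^esub> h))) < \<epsilon>" if "g \<in> carrier G" "h \<in> carrier G" for g h
      using T(2)[OF that] \<epsilon> by simp
    show "norm (\<iota> m n (e g) * a - a * \<iota> m n (e g)) < \<epsilon>" if "g \<in> carrier G" "a \<in> F" for g a
      using l[OF mn(1) that(2)] T(3)[OF that(1)] by blast
  qed
qed

end

section \<open>The tracial Rokhlin property\<close>

text \<open>
  For a projection \<open>x\<close>, subequivalence to \<open>x\<close> is implemented by an element supported on \<open>x\<close>: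
  everything in \<open>Her x\<close> is absorbed by \<open>x\<close>.
\<close>
lemma blackadar_below_projection:
  fixes p x :: "'a::unital_cstar_algebra"
  assumes p: "projection p" and x: "projection x" and below: "p \<lesssim>\<^sub>s x"
  obtains y where "p = y * y\<^sup>\<star>" "y * x = y"
proof -
  have absorb: "x * z = z" if x_b: "x * b = b" and z: "z \<in> Her b" for z b
  proof -
    have "closed {z. x * z = z}" by (intro closed_Collect_eq continuous_intros)
    moreover have "{b * y * b | y. True} \<subseteq> {z. x * z = z}" using x_b by (auto simp flip: mult.assoc)
    ultimately have "Her b \<subseteq> {z. x * z = z}" unfolding Her_def by (rule closure_minimal[rotated])
    then show ?thesis using z by blast
  qed
  from below obtain a' y where a': "a' \<in> Her x" and y: "p = y * y\<^sup>\<star>" and her: "Her (y\<^sup>\<star> * y) = Her a'"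
    unfolding blackadar_below_def blackadar_equiv_def by blast
  have py: "p * y = y"
  proof -
    have "(p * y - y) * (p * y - y)\<^sup>\<star> = p * p * p - p * p - p * p + p"
      by (simp add: star_diff star_mult algebra_simps y[symmetric] projection_star[OF p])
        (simp add: y[symmetric] mult.assoc[symmetric])
    also have "\<dots> = 0" by (simp add: projection_mult[OF p])
    finally have "(norm (p * y - y))\<^sup>2 = 0" by (simp flip: norm_mult_star)
    then show ?thesis by simp
  qed
  let ?q = "y\<^sup>\<star> * y"
  have yq: "y * ?q = y" using py by (simp add: y mult.assoc)
  have qq: "?q * ?q = ?q" by (metis yq mult.assoc)
  have "?q = ?q * 1 * ?q" by (simp add: qq)
  then have "?q \<in> Her ?q" unfolding Her_def by (metis (mono_tags, lifting) closure_subset mem_Collect_eq subsetD)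
  then have "?q \<in> Her a'" by (simp only: her)
  moreover have "x * a' = a'" by (rule absorb[OF projection_mult[OF x] a'])
  ultimately have "x * ?q = ?q" by (rule absorb[rotated])
  then have "?q * x = ?q"
    by (metis star_mult star_star projection_star[OF x])
  then have "y * x = y" using yq by (metis mult.assoc)
  then show ?thesis using that y by blast
qed

context product_action
begin

definition chi :: "nat \<Rightarrow> nat \<Rightarrow> 'g \<Rightarrow> complex" where "chi m n g = mat_trace (\<rho> m n g) / of_nat (D m n)"

lemma chi_prod:
  assumes "m \<le> n" "g \<in> carrier G"
  shows "chi m n g = (\<Prod>i\<in>{m..<n}. mat_trace (\<pi> i g) / of_nat (d i))"
  unfolding chi_def \<rho>_def range_tensor_character[OF rep assms] D_def by (simp add: prod_dividef)

lemma chi_concat: "m \<le> n \<Longrightarrow> n \<le> l \<Longrightarrow> g \<in> carrier G \<Longrightarrow> chi m n g * chi n l g = chi m l g"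
  by (simp add: chi_prod prod.atLeastLessThan_concat)

lemma chi_norm_le:
  assumes "m \<le> n" "g \<in> carrier G"
  shows "cmod (chi m n g) \<le> 1"
proof -
  note U = mat_unitaryD[OF \<rho>_unitary[OF assms(2,1)]]
  have "cmod (mat_trace (\<rho> m n g * 1\<^sub>m (D m n))) \<le> Re (mat_trace (1\<^sub>m (D m n)))"
    by (rule norm_mat_trace_unitary_projection_le[OF _ U(1,4)]) simp
  then show ?thesis using U D_pos[of m n] by (simp add: chi_def norm_divide divide_le_eq)
qed

lemma chi_one: "m \<le> n \<Longrightarrow> chi m n \<one>\<^bsub>G\<^esub> = 1"
  using D_pos[of m n] by (simp add: chi_def unitary_rep_one[OF G(1) \<rho>_rep])

text \<open>
  Let \<open>V\<close> implement \<open>g\<close> on the factors from \<open>m\<close> to \<open>n - 1\<close>. Rokhlin projections that nearly commute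
  with the first \<open>m\<close> factors are nearly permuted by \<open>V\<close>, so that \<open>e h * V * e h\<close> is small for every \<open>h\<close>,
  and the part of the trace of \<open>V\<close> under the complement of their sum is bounded by the trace of the
  chosen projection \<open>x\<close>. Hence the trace of \<open>V\<close>, which is the normalized character, is small.
\<close>
lemma tracial_Rokhlin_imp_chi_small:
  assumes R: "tracial_Rokhlin G \<alpha>" and g: "g \<in> carrier G" "g \<noteq> \<one>\<^bsub>G\<^esub>" and \<delta>: "\<delta> > 0"
  obtains n where "n \<ge> m" "cmod (chi m n g) < \<delta>"
proof -
  interpret group G by (rule G(1))
  define N where "N = real (card (carrier G))"
  have N: "N > 0" using G(2) one_closed by (auto simp: N_def card_gt_0_iff)
  \<comment> \<open>Each of the \<open>N\<close> diagonal terms below is at most \<open>4 * \<epsilon>\<close>, together \<open>\<delta> / 2\<close>; the complement contributes the rest.\<close>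
  define \<epsilon> where "\<epsilon> = \<delta> / (8 * N)"
  have \<epsilon>: "\<epsilon> > 0" using N \<delta> by (simp add: \<epsilon>_def)
  obtain n0 where "nat \<lceil>2 / \<delta>\<rceil> < D 0 n0" using D_unbounded by blast
  then have n0: "real (D 0 n0) > 2 / \<delta>" using real_nat_ceiling_ge[of "2 / \<delta>"] by linarith
  interpret C: mat_hom "D 0 n0" "\<phi> n0" by (rule \<phi>_hom)
  let ?x = "\<phi> n0 (corner n0)"
  have x: "projection ?x" "norm ?x = 1"
    by (rule C.hom_projection[OF corner_projection], rule C.norm_hom_projection[OF corner_projection corner_nonzero])
  have x_pos: "cstar_positive ?x"
    unfolding cstar_positive_def by (rule exI[of _ ?x]) (simp add: projection_star[OF x(1)] projection_mult[OF x(1)])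
  define u where "u = \<phi> m (\<rho> 0 m g)"
  interpret Pm: mat_hom "D 0 m" "\<phi> m" by (rule \<phi>_hom)
  have um: "mat_unitary (D 0 m) (\<rho> 0 m g)" by (rule \<rho>_unitary[OF g(1) le0])
  have u: "u\<^sup>\<star> * u = 1" "norm u \<le> 1" "norm (u\<^sup>\<star>) \<le> 1" unfolding u_def using Pm.hom_unitary[OF um] by auto
  have "\<exists>e. orthogonal_projections (carrier G) e
     \<and> (\<forall>g\<in>carrier G. \<forall>h\<in>carrier G. norm (\<alpha> g (e h) - e (g \<otimes>\<^bsub>G\<^esub> h)) < \<epsilon>)
     \<and> (\<forall>g\<in>carrier G. \<forall>a\<in>{u}. norm (e g * a - a * e g) < \<epsilon>)
     \<and> 1 - (\<Sum>g\<in>carrier G. e g) \<lesssim>\<^sub>s ?x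
     \<and> norm ((\<Sum>g\<in>carrier G. e g) * ?x * (\<Sum>g\<in>carrier G. e g)) > 1 - \<epsilon>"
    using R \<epsilon> x_pos x(2) unfolding tracial_Rokhlin_def by blast
  then obtain e where e: "orthogonal_projections (carrier G) e"
    "\<And>g h. g \<in> carrier G \<Longrightarrow> h \<in> carrier G \<Longrightarrow> norm (\<alpha> g (e h) - e (g \<otimes>\<^bsub>G\<^esub> h)) < \<epsilon>"
    "\<And>g. g \<in> carrier G \<Longrightarrow> norm (e g * u - u * e g) < \<epsilon>"
    "1 - (\<Sum>g\<in>carrier G. e g) \<lesssim>\<^sub>s ?x"
    by blast
  have eproj: "projection (e h)" and enorm: "norm (e h) \<le> 1" if "h \<in> carrier G" for h
    using e(1) that norm_projection_le by (auto simp: orthogonal_projections_def)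
  define p where "p = 1 - (\<Sum>g\<in>carrier G. e g)"
  have p: "projection p" unfolding p_def by (rule projection_one_minus[OF projection_sum[OF e(1) G(2)]])
  obtain y where y: "p = y * y\<^sup>\<star>" "y * ?x = y"
    using blackadar_below_projection[OF p x(1)] e(4) unfolding p_def by blast
  have ynorm: "norm y \<le> 1"
    using norm_mult_star[of y] norm_projection_le[OF p] by (simp add: y(1)[symmetric] power_le_one_iff)
  have xy: "?x * y\<^sup>\<star> = y\<^sup>\<star>" using arg_cong[OF y(2), of star] by (simp add: star_mult projection_star[OF x(1)])
  obtain n1 where n1: "\<And>n a. n \<ge> n1 \<Longrightarrow> a \<in> e ` carrier G \<Longrightarrow> \<exists>x\<in>M 0 n. norm (a - \<phi> n x) < \<epsilon>"
    using dense_finite[of "e ` carrier G" \<epsilon>] G(2) \<epsilon> by auto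
  define n where "n = max m n1"
  have mn: "m \<le> n" "n1 \<le> n" by (auto simp: n_def)
  interpret Pn: mat_hom "D 0 n" "\<phi> n" by (rule \<phi>_hom)
  interpret I: mat_hom "D m n" "\<iota> m n" by (rule \<iota>_hom[OF mn(1)])
  define V where "V = \<iota> m n (\<rho> m n g)"
  define U where "U = \<phi> n (\<rho> 0 n g)"
  note Uu = \<rho>_unitary[OF g(1), of 0 n, simplified] and Vu = \<rho>_unitary[OF g(1) mn(1)]
  have V: "norm V \<le> 1" unfolding V_def by (rule I.hom_unitary(3)[OF Vu])
  have U: "U\<^sup>\<star> * U = 1" "norm U \<le> 1" "norm (U\<^sup>\<star>) \<le> 1" unfolding U_def using Pn.hom_unitary[OF Uu] by auto
  have U_eq: "U = u * V"
    unfolding U_def u_def V_def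
    using \<phi>_\<iota>(1)[OF mn(1) mat_unitaryD(1)[OF um] mat_unitaryD(1)[OF Vu]] \<rho>_concat[OF le0 mn(1)] by simp
  have covariant: "norm (U * e h * U\<^sup>\<star> - \<alpha> g (e h)) \<le> 2 * \<epsilon>" if h: "h \<in> carrier G" for h
  proof -
    obtain z where z: "z \<in> M 0 n" "norm (e h - \<phi> n z) < \<epsilon>" using n1[OF mn(2), of "e h"] h by blast
    have a: "mat_adjoint (\<rho> 0 n g) \<in> M 0 n" using mat_unitaryD[OF Uu] by (intro carrier_matI) simp_all
    have "\<alpha> g (\<phi> n z) = U * \<phi> n z * U\<^sup>\<star>"
      unfolding \<alpha>_\<phi>[OF g(1) z(1)] U_def using mat_unitaryD(1)[OF Uu] a z(1)
      by (simp only: Pn.hom_simps(3,4) mult_carrier_mat[OF mat_unitaryD(1)[OF Uu] z(1)])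
    then have eq: "U * e h * U\<^sup>\<star> - \<alpha> g (e h) = U * (e h - \<phi> n z) * U\<^sup>\<star> - \<alpha> g (e h - \<phi> n z)"
      by (simp add: \<alpha>_diff[OF g(1)] algebra_simps)
    have "norm (U * (e h - \<phi> n z) * U\<^sup>\<star>) \<le> norm (e h - \<phi> n z)"
      by (rule order_trans[OF norm_mult_le_right[OF U(3)] norm_mult_le_left[OF U(2)]])
    then show ?thesis
      unfolding eq using norm_triangle_ineq4[of "U * (e h - \<phi> n z) * U\<^sup>\<star>" "\<alpha> g (e h - \<phi> n z)"]
        norm_\<alpha>_le[OF g(1), of "e h - \<phi> n z"] z(2) by linarith
  qed
  have permuted: "norm (V * e h - e (g \<otimes>\<^bsub>G\<^esub> h) * V) \<le> 4 * \<epsilon>" if h: "h \<in> carrier G" for h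
  proof -
    let ?f = "e (g \<otimes>\<^bsub>G\<^esub> h)"
    let ?r = "U * e h * U\<^sup>\<star> - ?f" and ?s = "?f * u - u * ?f"
    have gh: "g \<otimes>\<^bsub>G\<^esub> h \<in> carrier G" using g h by simp
    have r: "norm ?r \<le> 3 * \<epsilon>"
      using norm_triangle_ineq[of "U * e h * U\<^sup>\<star> - \<alpha> g (e h)" "\<alpha> g (e h) - ?f"] covariant[OF h] e(2)[OF g(1) h] by simp
    have "?r * U = U * e h - ?f * U" by (simp add: left_diff_distrib mult.assoc U(1))
    then have "u\<^sup>\<star> * (?r * U) + u\<^sup>\<star> * (?s * V) = u\<^sup>\<star> * (u * (V * e h)) - u\<^sup>\<star> * (u * (?f * V))"
      by (simp add: U_eq algebra_simps)
    also have "\<dots> = V * e h - ?f * V" by (simp add: u(1) flip: mult.assoc)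
    finally have eq: "V * e h - ?f * V = u\<^sup>\<star> * (?r * U) + u\<^sup>\<star> * (?s * V)" by simp
    have "norm (u\<^sup>\<star> * (?r * U)) \<le> norm ?r"
      by (rule order_trans[OF norm_mult_le_left[OF u(3)] norm_mult_le_right[OF U(2)]])
    moreover have "norm (u\<^sup>\<star> * (?s * V)) \<le> norm ?s"
      by (rule order_trans[OF norm_mult_le_left[OF u(3)] norm_mult_le_right[OF V]])
    ultimately show ?thesis
      unfolding eq using norm_triangle_ineq[of "u\<^sup>\<star> * (?r * U)" "u\<^sup>\<star> * (?s * V)"] r e(3)[OF gh] by linarith
  qed
  have diag: "cmod (\<tau> (V * e h)) \<le> 4 * \<epsilon>" if h: "h \<in> carrier G" for h
  proof -
    let ?f = "e (g \<otimes>\<^bsub>G\<^esub> h)"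
    have "g \<otimes>\<^bsub>G\<^esub> h \<in> carrier G" "h \<noteq> g \<otimes>\<^bsub>G\<^esub> h" using g h by auto
    then have ef: "e h * ?f = 0" using e(1) h by (simp add: orthogonal_projections_def)
    have "\<tau> (V * e h) = \<tau> (e h * (V * e h))"
      using \<tau>_mult_commute[of "e h" "V * e h"] by (simp add: mult.assoc projection_mult[OF eproj[OF h]])
    also have "e h * (V * e h) = e h * (V * e h - ?f * V)"
      by (simp add: right_diff_distrib ef flip: mult.assoc)
    finally have "cmod (\<tau> (V * e h)) \<le> norm (e h * (V * e h - ?f * V))" using \<tau>_norm_le by simp
    also have "\<dots> \<le> norm (V * e h - ?f * V)" by (rule norm_mult_le_left[OF enorm[OF h]])
    finally show ?thesis using permuted[OF h] by linarith
  qed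
  have rest: "cmod (\<tau> (V * p)) < \<delta> / 2"
  proof -
    have "\<tau> (V * p) = \<tau> (y\<^sup>\<star> * (V * y))" unfolding y(1) using \<tau>_mult_commute[of "V * y" "y\<^sup>\<star>"] by (simp add: mult.assoc)
    also have "y\<^sup>\<star> * (V * y) = ?x * (y\<^sup>\<star> * (V * y)) * ?x" by (metis xy y(2) mult.assoc)
    finally have "cmod (\<tau> (V * p)) \<le> norm (y\<^sup>\<star> * (V * y)) / D 0 n0" using \<tau>_corner_le[of n0 "y\<^sup>\<star> * (V * y)"] by simp
    also have "norm (y\<^sup>\<star> * (V * y)) \<le> 1"
      using norm_mult_le_left[of "y\<^sup>\<star>" "V * y"] norm_mult_le_left[OF V, of y] ynorm by simp
    then have "norm (y\<^sup>\<star> * (V * y)) / D 0 n0 \<le> 1 / D 0 n0" by (rule divide_right_mono) simp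
    also have "1 / D 0 n0 < \<delta> / 2" using n0 \<delta> D_pos[of 0 n0] by (simp add: field_simps)
    finally show ?thesis .
  qed
  have "chi m n g = \<tau> V"
  proof -
    have c: "mat_tensor (1\<^sub>m (D 0 m)) (\<rho> m n g) \<in> M 0 n"
      using D_concat[of 0 m n] mn mat_unitaryD[OF Vu] by (intro carrier_matI) simp_all
    have "\<tau> V = mat_trace (mat_tensor (1\<^sub>m (D 0 m)) (\<rho> m n g)) / of_nat (D 0 n)"
      unfolding V_def \<iota>_def by (rule \<tau>_\<phi>[OF c])
    moreover have "D 0 n = D 0 m * D m n" using D_concat[of 0 m n] mn by simp
    moreover have "mat_trace (mat_tensor (1\<^sub>m (D 0 m)) (\<rho> m n g)) = of_nat (D 0 m) * mat_trace (\<rho> m n g)"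
      using mat_unitaryD(2,3)[OF Vu] by (simp add: mat_tensor_trace)
    ultimately show ?thesis using D_pos[of 0 m] by (simp add: chi_def)
  qed
  also have "V = (\<Sum>h\<in>carrier G. V * e h) + V * p"
    by (simp add: p_def right_diff_distrib sum_distrib_left)
  finally have "cmod (chi m n g) \<le> cmod (\<Sum>h\<in>carrier G. \<tau> (V * e h)) + cmod (\<tau> (V * p))"
    using norm_triangle_ineq by (simp add: \<tau>_add \<tau>_sum)
  also have "cmod (\<Sum>h\<in>carrier G. \<tau> (V * e h)) \<le> (\<Sum>h\<in>carrier G. 4 * \<epsilon>)"
    using diag by (rule sum_norm_le)
  also have "(\<Sum>h\<in>carrier G. 4 * \<epsilon>) = \<delta> / 2" using N by (simp add: \<epsilon>_def N_def)
  finally have "cmod (chi m n g) < \<delta>" using rest by linarith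
  then show ?thesis using that mn(1) by blast
qed

text \<open>
  If \<open>f * x * x * f\<close> is close to \<open>f\<close>, it is invertible in the corner of \<open>f\<close>, and with its inverse square root
  \<open>b\<close> the element \<open>b * f * x\<close> is a partial isometry from \<open>Her x\<close> onto \<open>f\<close>. It carries the comparison of
  \<open>s * s\<^sup>\<star>\<close> with \<open>f\<close> over to \<open>x\<close>. Using \<open>x\<close> in place of its square root avoids functional calculus for \<open>x\<close>.
\<close>
lemma partial_isometry_into_Her:
  fixes f x s :: "'b::unital_cstar_algebra"
  assumes f: "projection f" and x: "x\<^sup>\<star> = x" and near: "norm (f - f * x * x * f) < 1"
    and s: "s * f = s"
  shows "s * s\<^sup>\<star> \<lesssim>\<^sub>s x"
proof -
  define t where "t = f - f * x * x * f"
  note f' = projection_star[OF f] projection_mult[OF f]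
  have "t\<^sup>\<star> = t" by (simp add: t_def star_diff star_mult f' x mult.assoc)
  then obtain b where b: "b\<^sup>\<star> = b" "b * b * (1 - t) = 1" "\<And>z. z * t = t * z \<Longrightarrow> z * b = b * z"
    using inverse_sqrt_exists[of t] near unfolding t_def by metis
  have ft: "f * t = t" "t * f = t" by (simp_all add: t_def right_diff_distrib left_diff_distrib mult.assoc f' projection_mult2[OF f])
  have fb: "f * b = b * f" by (rule b(3)) (simp add: ft)
  have tb: "t * b = b * t" by (rule b(3)) simp
  have fxxf: "f * x * x * f = f * (1 - t)" by (simp add: right_diff_distrib ft) (simp add: t_def)
  define y where "y = s * b * f * x"
  have yy: "y * y\<^sup>\<star> = s * s\<^sup>\<star>"
  proof -
    have "y * y\<^sup>\<star> = s * (b * (f * x * x * f) * b) * s\<^sup>\<star>"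
      by (simp add: y_def star_mult x f' b(1) mult.assoc)
    also have "b * (f * x * x * f) * b = f * (b * b * (1 - t))"
    proof -
      have "(1 - t) * b = b * (1 - t)" by (simp add: left_diff_distrib right_diff_distrib tb)
      moreover have "b * (f * (1 - t)) * b = (b * f) * ((1 - t) * b)" by (simp only: mult.assoc)
      ultimately have "b * (f * (1 - t)) * b = (f * b) * (b * (1 - t))" by (simp only: fb)
      then show ?thesis unfolding fxxf by (simp only: mult.assoc)
    qed
    also have "\<dots> = f" by (simp add: b(2))
    finally show ?thesis by (simp add: s)
  qed
  have "y\<^sup>\<star> * y = x * (f * b * s\<^sup>\<star> * s * b * f) * x"
    by (simp add: y_def star_mult x f' b(1) mult.assoc)
  then have "y\<^sup>\<star> * y \<in> {x * z * x | z. True}" by blast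
  then have "y\<^sup>\<star> * y \<in> Her x" unfolding Her_def by (rule subsetD[OF closure_subset])
  moreover have "cstar_positive (y\<^sup>\<star> * y)" by (auto simp: cstar_positive_def)
  moreover have "s * s\<^sup>\<star> \<sim>\<^sub>s y\<^sup>\<star> * y" unfolding blackadar_equiv_def by (rule exI[of _ y]) (simp add: yy)
  ultimately show ?thesis unfolding blackadar_below_def by blast
qed

text \<open>
  When the characters of the later factors are small, these contain a tower that covers almost
  everything. It commutes with the first \<open>m\<close> factors, which nearly contain \<open>F\<close> and \<open>x\<close>; the uncovered
  projection \<open>1 - q\<close> has smaller trace than the eigenprojection \<open>f\<close> of a matrix near \<open>x\<close>, hence is
  subequivalent to \<open>f\<close> and through it to \<open>x\<close>. Because \<open>f\<close> and \<open>q\<close> sit in different tensor factors,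
  \<open>f * q\<close> is nonzero, so cutting \<open>x\<close> down by \<open>q\<close> does not diminish its norm by much.
\<close>
lemma tracial_Rokhlin_if_chi_tendsto:
  assumes chi: "\<And>m g. g \<in> carrier G \<Longrightarrow> g \<noteq> \<one>\<^bsub>G\<^esub> \<Longrightarrow> (\<lambda>n. chi m n g) \<longlonglongrightarrow> 0"
  shows "tracial_Rokhlin G \<alpha>"
  unfolding tracial_Rokhlin_def
proof (intro allI impI, elim conjE)
  fix F :: "'a set" and \<epsilon> :: real and x :: 'a
  assume F: "finite F" and \<epsilon>: "\<epsilon> > 0" and x_pos: "cstar_positive x" and x_norm: "norm x = 1"
  interpret group G by (rule G(1))
  define N where "N = card (carrier G)"
  have N: "N > 0" using G(2) one_closed by (auto simp: N_def card_gt_0_iff)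
  have x: "x\<^sup>\<star> = x" using x_pos by (auto simp: cstar_positive_def star_mult star_star)
  \<comment> \<open>With \<open>\<delta> \<le> 1 / 12\<close>, the compression \<open>f * x * x * f\<close> below is within \<open>6 * \<delta> < 1\<close> of \<open>f\<close>.\<close>
  define \<delta> where "\<delta> = min (\<epsilon> / 2) (1 / 12)"
  have \<delta>: "\<delta> > 0" "\<delta> \<le> \<epsilon> / 2" "\<delta> \<le> 1 / 12" using \<epsilon> by (auto simp: \<delta>_def)
  obtain m where m: "\<And>a. a \<in> insert x F \<Longrightarrow> \<exists>z\<in>M 0 m. norm (a - \<phi> m z) < \<delta>"
    using dense_finite[of "insert x F" \<delta>] F \<delta>(1) by (metis finite_insert order_refl)
  obtain X0 where X0: "X0 \<in> M 0 m" "norm (x - \<phi> m X0) < \<delta>" using m[of x] by blast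
  obtain X where X: "X \<in> M 0 m" "mat_adjoint X = X" "norm (x - \<phi> m X) < \<delta>" using hermitian_part[OF X0(1) x X0(2)] .
  define K where "K = D 0 m"
  have K: "K > 0" using D_pos by (simp add: K_def)
  interpret Pm: mat_hom K "\<phi> m" unfolding K_def by (rule \<phi>_hom)
  let ?x' = "\<phi> m X"
  obtain E c where E: "spectral_family K X E c" using spectral_family_exists[of X K] X by (auto simp: K_def)
  obtain i where i: "i < K" "norm ?x' = \<bar>c i\<bar>" using Pm.norm_hermitian(2)[OF _ X(2) E] X(1) by (auto simp: K_def)
  define f0 where "f0 = E i"
  have f0: "mat_projection K f0" "mat_trace f0 = 1" using spectral_familyD(1,2)[OF E i(1)] by (simp_all add: f0_def)
  have f0c: "f0 \<in> M 0 m" using mat_projectionD(1)[OF f0(1)] by (simp add: K_def)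
  define f where "f = \<phi> m f0"
  have f: "projection f" "norm f \<le> 1" unfolding f_def using Pm.hom_projection[OF f0(1)] norm_projection_le by auto
  have x'f: "?x' * f = complex_of_real (c i) *\<^sub>C f"
    unfolding f_def f0_def using X(1) by (intro Pm.hom_spectral_family(2)[OF _ E i(1)]) (simp add: K_def)
  have c: "1 - \<delta> < \<bar>c i\<bar>" "\<bar>c i\<bar> \<le> 1 + \<delta>"
    using norm_triangle_ineq2[of x "?x'"] norm_triangle_ineq3[of x "?x'"] X(3) x_norm unfolding i(2)[symmetric] by linarith+
  have near: "norm (f - f * x * x * f) < 1"
  proof -
    let ?r = "x - ?x'"
    have "f * ?x' * ?x' * f = complex_of_real (c i * c i) *\<^sub>C f"
      by (simp add: mult.assoc x'f mult_scaleC_right scaleC_scaleC projection_mult[OF f(1)])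
    then have eq: "f - f * x * x * f = complex_of_real (1 - c i * c i) *\<^sub>C f - f * (x * ?r + ?r * ?x') * f"
      by (simp add: algebra_simps scaleC_diff_left)
    have "\<bar>1 - c i * c i\<bar> \<le> 3 * \<delta>"
    proof -
      have "1 - c i * c i = (1 - \<bar>c i\<bar>) * (1 + \<bar>c i\<bar>)" by (simp add: algebra_simps)
      then have "\<bar>1 - c i * c i\<bar> = \<bar>1 - \<bar>c i\<bar>\<bar> * \<bar>1 + \<bar>c i\<bar>\<bar>" by (simp only: abs_mult)
      also have "\<bar>1 + \<bar>c i\<bar>\<bar> = 1 + \<bar>c i\<bar>" by simp
      also have "\<bar>1 - \<bar>c i\<bar>\<bar> * (1 + \<bar>c i\<bar>) \<le> \<delta> * 3" using c \<delta> by (intro mult_mono) auto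
      finally show ?thesis by simp
    qed
    then have "norm (complex_of_real (1 - c i * c i) *\<^sub>C f) \<le> 3 * \<delta>"
      using f(2) mult_left_le[of "norm f" "\<bar>1 - c i * c i\<bar>"] unfolding norm_scaleC norm_of_real by linarith
    moreover have "norm (f * (x * ?r + ?r * ?x') * f) \<le> 3 * \<delta>"
    proof -
      have "norm (f * (x * ?r + ?r * ?x') * f) \<le> norm (x * ?r + ?r * ?x')"
        by (rule order_trans[OF norm_mult_le_right[OF f(2)] norm_mult_le_left[OF f(2)]])
      also have "\<dots> \<le> norm (x * ?r) + norm (?r * ?x')" by (rule norm_triangle_ineq)
      also have "\<dots> \<le> \<delta> + \<delta> * 2"
      proof (rule add_mono)
        show "norm (x * ?r) \<le> \<delta>" using norm_mult_le_left[of x ?r] x_norm X(3) by simp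
        have "norm ?r * norm ?x' \<le> \<delta> * 2" using X(3) c(2) i(2) \<delta> by (intro mult_mono) auto
        then show "norm (?r * ?x') \<le> \<delta> * 2" using norm_mult_ineq[of ?r ?x'] by linarith
      qed
      finally show ?thesis by simp
    qed
    ultimately show ?thesis
      unfolding eq using norm_triangle_ineq4[of "complex_of_real (1 - c i * c i) *\<^sub>C f" "f * (x * ?r + ?r * ?x') * f"] \<delta> by linarith
  qed
  \<comment> \<open>So many further factors are taken that the tower leaves at most the fraction \<open>1 / (2 * K)\<close> of the
    trace uncovered, while \<open>f\<close> has trace \<open>1 / K\<close>.\<close>
  have "eventually (\<lambda>n. \<forall>g\<in>carrier G - {\<one>\<^bsub>G\<^esub>}. cmod (chi m n g) < 1 / (4 * real K * real N)) sequentially"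
  proof (rule eventually_ball_finite)
    show "\<forall>g\<in>carrier G - {\<one>\<^bsub>G\<^esub>}. \<forall>\<^sub>F n in sequentially. cmod (chi m n g) < 1 / (4 * real K * real N)"
    proof
      fix g assume "g \<in> carrier G - {\<one>\<^bsub>G\<^esub>}"
      then have "(\<lambda>n. chi m n g) \<longlonglongrightarrow> 0" using chi[of g m] by simp
      moreover have "0 < 1 / (4 * real K * real N)" using K N by simp
      ultimately show "\<forall>\<^sub>F n in sequentially. cmod (chi m n g) < 1 / (4 * real K * real N)"
        using tendstoD[of "\<lambda>n. chi m n g" 0 sequentially] by (simp add: dist_norm)
    qed
  qed (use G(2) in simp)
  then obtain n1 where n1: "\<And>n g. n \<ge> n1 \<Longrightarrow> g \<in> carrier G \<Longrightarrow> g \<noteq> \<one>\<^bsub>G\<^esub> \<Longrightarrow> cmod (chi m n g) < 1 / (4 * real K * real N)"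
    unfolding eventually_sequentially by blast
  obtain n2 where n2: "n2 \<ge> m" "\<And>l. l \<ge> n2 \<Longrightarrow> D m l \<ge> 4 * K * N" using D_tendsto[of m "4 * K * N"] by blast
  define n where "n = max n1 n2"
  have mn: "m \<le> n" "n1 \<le> n" "n2 \<le> n" using n2(1) by (auto simp: n_def)
  define k where "k = D m n"
  have k: "4 * K * N \<le> k" "k > 0" using n2(2)[OF mn(3)] D_pos by (simp_all add: k_def)
  interpret I: mat_hom k "\<iota> m n" unfolding k_def by (rule \<iota>_hom[OF mn(1)])
  interpret Pn: mat_hom "D 0 n" "\<phi> n" by (rule \<phi>_hom)
  have Kk: "D 0 n = K * k" using D_concat[of 0 m n] mn by (simp add: K_def k_def)
  have rep: "unitary_rep G k (\<rho> m n)" unfolding k_def by (rule \<rho>_rep[OF mn(1)])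
  define j where "j = nat \<lfloor>(real k - real k / (4 * real K)) / real N\<rfloor>"
  have quotient: "0 \<le> (real k - real k / (4 * real K)) / real N"
  proof -
    have "real k / (4 * real K) \<le> real k" using K by (simp add: divide_le_eq mult_le_cancel_left1)
    then show ?thesis by simp
  qed
  have j_le: "real (N * j) \<le> real k - real k / (4 * real K)"
  proof -
    have "real j \<le> (real k - real k / (4 * real K)) / real N" unfolding j_def using quotient by (simp add: of_nat_nat)
    then show ?thesis using N by (simp add: le_divide_eq mult.commute)
  qed
  have j_ge: "real k - real (N * j) \<le> real k / (2 * real K)"
  proof -
    have "(real k - real k / (4 * real K)) / real N < real j + 1" unfolding j_def using quotient by (simp add: of_nat_nat)
    then have "real k - real k / (4 * real K) < real (N * j) + real N" using N by (simp add: divide_less_eq algebra_simps)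
    moreover have "real N \<le> real k / (4 * real K)"
    proof -
      have "real (4 * K * N) \<le> real k" using k(1) by (simp only: of_nat_le_iff)
      then show ?thesis using K by (simp add: le_divide_eq mult_ac)
    qed
    moreover have "real k / (2 * real K) = real k / (4 * real K) + real k / (4 * real K)" by (simp add: field_simps)
    ultimately show ?thesis by linarith
  qed
  have "(\<Sum>g\<in>carrier G - {\<one>\<^bsub>G\<^esub>}. cmod (mat_trace (\<rho> m n g))) \<le> (\<Sum>g\<in>carrier G - {\<one>\<^bsub>G\<^esub>}. real k / (4 * real K * real N))"
  proof (rule sum_mono)
    fix g assume "g \<in> carrier G - {\<one>\<^bsub>G\<^esub>}"
    then have "cmod (chi m n g) < 1 / (4 * real K * real N)" using n1[OF mn(2), of g] by simp
    then have "cmod (mat_trace (\<rho> m n g)) / real k < 1 / (4 * real K * real N)" by (simp add: chi_def norm_divide k_def)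
    then have "cmod (mat_trace (\<rho> m n g)) < 1 / (4 * real K * real N) * real k" using k(2) by (simp only: pos_divide_less_eq of_nat_0_less_iff)
    then show "cmod (mat_trace (\<rho> m n g)) \<le> real k / (4 * real K * real N)" by simp
  qed
  also have "\<dots> \<le> (\<Sum>g\<in>carrier G. real k / (4 * real K * real N))"
    using G(2) by (intro sum_mono2) auto
  also have "\<dots> = real k / (4 * real K)" using N by (simp add: N_def)
  finally have "real (card (carrier G) * j) + (\<Sum>g\<in>carrier G - {\<one>\<^bsub>G\<^esub>}. cmod (mat_trace (\<rho> m n g))) \<le> real k"
    using j_le by (simp add: N_def)
  then obtain e where e: "equivariant_projections G k (\<rho> m n) e"
    and tr: "mat_trace (mat_sum k k e (carrier G)) = of_nat (N * j)"
    using equivariant_projections_exist[OF G rep] unfolding N_def by blast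
  note T = tower_in_later_factors[OF mn(1) e[unfolded k_def]]
  define Q where "Q = mat_sum k k e (carrier G)"
  have Q: "mat_projection k Q" unfolding Q_def by (rule equivariant_projections_sum[OF e G(2)])
  have Qc: "Q \<in> M m n" using mat_projectionD(1)[OF Q] by (simp add: k_def)
  define q where "q = \<iota> m n Q"
  have q_sum: "(\<Sum>g\<in>carrier G. \<iota> m n (e g)) = q" using T(4) by (simp add: q_def Q_def k_def)
  have q: "projection q" "norm q \<le> 1" unfolding q_def using I.hom_projection[OF Q] norm_projection_le by auto
  have comparison: "1 - q \<lesssim>\<^sub>s x"
  proof -
    let ?P = "mat_tensor f0 (1\<^sub>m k)" and ?S = "mat_tensor (1\<^sub>m K) (1\<^sub>m k - Q)"
    have P: "mat_projection (D 0 n) ?P" unfolding Kk by (rule mat_tensor_projection[OF f0(1)]) simp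
    have S: "mat_projection (D 0 n) ?S" unfolding Kk by (rule mat_tensor_projection[OF _ mat_projection_one_minus[OF Q]]) simp
    have "Re (mat_trace ?S) \<le> Re (mat_trace ?P)"
    proof -
      have "Re (mat_trace ?S) = real K * (real k - real (N * j))"
        using mat_projectionD(2,3)[OF Q] tr by (simp add: mat_tensor_trace Q_def)
      also have "\<dots> \<le> real K * (real k / (2 * real K))" using j_ge by (intro mult_left_mono) auto
      also have "\<dots> \<le> real k" using K by simp
      also have "\<dots> = Re (mat_trace ?P)" using mat_projectionD(2,3)[OF f0(1)] f0(2) by (simp add: mat_tensor_trace)
      finally show ?thesis .
    qed
    then obtain s0 where s0: "s0 \<in> M 0 n" "s0 * mat_adjoint s0 = ?S" "s0 * ?P = s0"
      by (rule mat_projection_compare[OF P S])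
    let ?s = "\<phi> n s0"
    have fP: "\<phi> n ?P = f" unfolding f_def k_def by (rule \<phi>_extend[OF mn(1) f0c])
    have sf: "?s * f = ?s" using Pn.hom_simps(3)[OF s0(1) mat_projectionD(1)[OF P]] by (simp add: s0(3) fP)
    have s0a: "mat_adjoint s0 \<in> M 0 n" using s0(1) by (auto intro!: carrier_matI)
    have ss: "?s * ?s\<^sup>\<star> = 1 - q"
    proof -
      have "?s * ?s\<^sup>\<star> = \<phi> n ?S" using Pn.hom_simps(3)[OF s0(1) s0a] by (simp add: Pn.hom_simps(4)[OF s0(1)] s0(2))
      also have "\<dots> = \<iota> m n (1\<^sub>m k - Q)" by (simp add: \<iota>_def K_def)
      also have "\<dots> = 1 - q" using I.hom_diff[of "1\<^sub>m k" Q] mat_projectionD(1)[OF Q] by (simp add: I.hom_simps q_def)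
      finally show ?thesis .
    qed
    have "?s * ?s\<^sup>\<star> \<lesssim>\<^sub>s x"
      by (rule partial_isometry_into_Her[OF f(1) x near sf])
    then show ?thesis by (simp add: ss)
  qed
  have large: "norm (q * x * q) > 1 - \<epsilon>"
  proof -
    have commute: "z * q = q * z" if "z = ?x' \<or> z = f" for z
      using that \<phi>_commute_\<iota>[OF mn(1) X(1) Qc] \<phi>_commute_\<iota>[OF mn(1) f0c Qc] by (auto simp: f_def q_def)
    have fq: "f * q = \<phi> n (mat_tensor f0 Q)" unfolding f_def q_def by (rule \<phi>_\<iota>(1)[OF mn(1) f0c Qc])
    have "mat_projection (D 0 n) (mat_tensor f0 Q)" unfolding Kk by (rule mat_tensor_projection[OF f0(1) Q])
    moreover have "mat_tensor f0 Q \<noteq> 0\<^sub>m (D 0 n) (D 0 n)"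
    proof
      assume zero: "mat_tensor f0 Q = 0\<^sub>m (D 0 n) (D 0 n)"
      have "mat_trace (mat_tensor f0 Q) = of_nat (N * j)"
        using mat_projectionD(2,3)[OF f0(1)] mat_projectionD(2,3)[OF Q] f0(2) tr by (simp add: mat_tensor_trace Q_def)
      then have "(of_nat (N * j) :: complex) = 0" unfolding zero by simp
      then have "real (N * j) = 0" by (simp only: of_nat_eq_0_iff)
      then have "real k \<le> real k / (2 * real K)" using j_ge by linarith
      then show False using k(2) K by (simp add: le_divide_eq)
    qed
    ultimately have fq_norm: "norm (f * q) = 1" unfolding fq by (rule Pn.norm_hom_projection)
    have "(q * ?x' * q) * f = complex_of_real (c i) *\<^sub>C (f * q)"
    proof -
      have "(q * ?x' * q) * f = q * (?x' * f) * q" using commute[of f] by (simp add: mult.assoc)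
      also have "\<dots> = complex_of_real (c i) *\<^sub>C (q * f * q)" by (simp add: x'f mult_scaleC_left mult_scaleC_right)
      also have "q * f * q = f * q" using commute[of f] projection_mult2[OF q(1), of f] by (simp add: mult.assoc)
      finally show ?thesis .
    qed
    from arg_cong[OF this, of norm] have "\<bar>c i\<bar> = norm ((q * ?x' * q) * f)" by (simp add: norm_scaleC fq_norm)
    also have "\<dots> \<le> norm (q * ?x' * q)" by (rule norm_mult_le_right[OF f(2)])
    finally have "1 - \<delta> < norm (q * ?x' * q)" using c(1) by linarith
    moreover have "norm (q * ?x' * q) \<le> norm (q * x * q) + norm (x - ?x')"
    proof -
      have eq: "q * ?x' * q = q * x * q - q * (x - ?x') * q" by (simp add: algebra_simps)
      have "norm (q * (x - ?x') * q) \<le> norm (x - ?x')"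
        by (rule order_trans[OF norm_mult_le_right[OF q(2)] norm_mult_le_left[OF q(2)]])
      then show ?thesis unfolding eq using norm_triangle_ineq4[of "q * x * q" "q * (x - ?x') * q"] by linarith
    qed
    ultimately show ?thesis using X(3) \<delta>(2) by linarith
  qed
  show "\<exists>e. orthogonal_projections (carrier G) e
     \<and> (\<forall>g\<in>carrier G. \<forall>h\<in>carrier G. norm (\<alpha> g (e h) - e (g \<otimes>\<^bsub>G\<^esub> h)) < \<epsilon>)
     \<and> (\<forall>g\<in>carrier G. \<forall>a\<in>F. norm (e g * a - a * e g) < \<epsilon>)
     \<and> 1 - (\<Sum>g\<in>carrier G. e g) \<lesssim>\<^sub>s x
     \<and> norm ((\<Sum>g\<in>carrier G. e g) * x * (\<Sum>g\<in>carrier G. e g)) > 1 - \<epsilon>"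
  proof (intro exI[of _ "\<lambda>g. \<iota> m n (e g)"] conjI ballI T(1), goal_cases)
    case (1 g h)
    then show ?case using T(2)[OF 1] \<epsilon> by simp
  next
    case (2 g a)
    then obtain z where "z \<in> M 0 m" "norm (a - \<phi> m z) < \<delta>" using m[of a] by blast
    then show ?case using T(3)[OF 2(1)] \<delta>(2) by fastforce
  next
    case 3
    show ?case unfolding q_sum by (rule comparison)
  next
    case 4
    show ?case unfolding q_sum by (rule large)
  qed
qed

end

section \<open>Telescopes\<close>

context product_action
begin

lemma telescope_mono: "telescope \<nu> \<Longrightarrow> m \<le> n \<Longrightarrow> \<nu> m \<le> \<nu> n"
  by (simp add: telescope_def strict_mono_less_eq)

lemma telescope_ge: "telescope \<nu> \<Longrightarrow> n \<le> \<nu> n"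
  by (simp add: telescope_def strict_mono_imp_increasing)

lemma telescope_chi:
  "1 / of_nat (telescope_dim \<nu> d n) * character (telescope_rep \<nu> \<pi> n) g = chi (\<nu> n) (\<nu> (Suc n)) g"
  by (simp add: telescope_dim_def telescope_rep_def character_def chi_def D_def \<rho>_def)

lemma telescope_chi_prod:
  assumes "telescope \<nu>" "n \<le> k" "g \<in> carrier G"
  shows "(\<Prod>i\<in>{n..<k}. 1 / of_nat (telescope_dim \<nu> d i) * character (telescope_rep \<nu> \<pi> i) g) = chi (\<nu> n) (\<nu> k) g"
  using assms(2)
proof (induction k rule: dec_induct)
  case base
  then show ?case using assms(3) by (simp add: chi_prod)
next
  case (step k)
  have "chi (\<nu> n) (\<nu> k) g * chi (\<nu> k) (\<nu> (Suc k)) g = chi (\<nu> n) (\<nu> (Suc k)) g"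
    using telescope_mono[OF assms(1), of n k] telescope_mono[OF assms(1), of k "Suc k"] assms(3) step(1)
    by (intro chi_concat) auto
  then show ?case by (simp only: prod.atLeastLessThan_Suc[OF step(1)] step(3)[unfolded telescope_chi] telescope_chi)
qed

theorem strict_Rokhlin_iff:
  "strict_Rokhlin G \<alpha> \<longleftrightarrow> (\<exists>\<nu>. telescope \<nu> \<and> (\<forall>n. \<forall>g\<in>carrier G.
     1 / of_nat (telescope_dim \<nu> d n) * character (telescope_rep \<nu> \<pi> n) g = indicator {\<one>\<^bsub>G\<^esub>} g))"
  (is "_ \<longleftrightarrow> (\<exists>\<nu>. telescope \<nu> \<and> ?P \<nu>)")
proof
  assume R: "strict_Rokhlin G \<alpha>"
  have "\<exists>n. n > m \<and> (\<forall>g\<in>carrier G. g \<noteq> \<one>\<^bsub>G\<^esub> \<longrightarrow> mat_trace (\<rho> m n g) = 0)" for m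
    by (rule strict_Rokhlin_imp_character_eq_0[OF R, of m]) auto
  then obtain later where nxt: "\<And>m. later m > m"
    "\<And>m g. g \<in> carrier G \<Longrightarrow> g \<noteq> \<one>\<^bsub>G\<^esub> \<Longrightarrow> mat_trace (\<rho> m (later m) g) = 0"
    by metis
  define \<nu> where "\<nu> n = (later ^^ n) 0" for n
  have Suc: "\<nu> (Suc n) = later (\<nu> n)" for n by (simp add: \<nu>_def)
  have "telescope \<nu>" unfolding telescope_def strict_mono_Suc_iff using nxt(1) by (auto simp: Suc) (simp add: \<nu>_def)
  moreover have "?P \<nu>"
    unfolding telescope_chi
  proof (intro allI ballI)
    fix n g assume g: "g \<in> carrier G"
    show "chi (\<nu> n) (\<nu> (Suc n)) g = indicator {\<one>\<^bsub>G\<^esub>} g"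
    proof (cases "g = \<one>\<^bsub>G\<^esub>")
      case True
      then show ?thesis using chi_one[of "\<nu> n" "\<nu> (Suc n)"] nxt(1)[of "\<nu> n"] by (simp add: Suc)
    next
      case False
      then show ?thesis using nxt(2)[OF g] by (simp add: Suc chi_def)
    qed
  qed
  ultimately show "\<exists>\<nu>. telescope \<nu> \<and> ?P \<nu>" by blast
next
  assume "\<exists>\<nu>. telescope \<nu> \<and> ?P \<nu>"
  then obtain \<nu> where \<nu>: "telescope \<nu>" and P: "?P \<nu>" by blast
  show "strict_Rokhlin G \<alpha>"
  proof (rule strict_Rokhlin_if_character_eq_0)
    fix l
    have "mat_trace (\<rho> (\<nu> l) (\<nu> (Suc l)) g) = 0" if g: "g \<in> carrier G" "g \<noteq> \<one>\<^bsub>G\<^esub>" for g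
    proof -
      have "chi (\<nu> l) (\<nu> (Suc l)) g = indicator {\<one>\<^bsub>G\<^esub>} g" using P g(1) unfolding telescope_chi by blast
      then show ?thesis using g(2) D_pos[of "\<nu> l" "\<nu> (Suc l)"] by (simp add: chi_def)
    qed
    then show "\<exists>m n. l \<le> m \<and> m \<le> n \<and> (\<forall>g\<in>carrier G. g \<noteq> \<one>\<^bsub>G\<^esub> \<longrightarrow> mat_trace (\<rho> m n g) = 0)"
      using telescope_ge[OF \<nu>] telescope_mono[OF \<nu>, of l "Suc l"] by (intro exI[of _ "\<nu> l"] exI[of _ "\<nu> (Suc l)"]) simp
  qed
qed

text \<open>The absolute values of the partial products decrease, so one small value is enough.\<close>
lemma chi_tendsto_if_small:
  assumes g: "g \<in> carrier G" and small: "\<And>\<delta>. \<delta> > 0 \<Longrightarrow> \<exists>n\<ge>m. cmod (chi m n g) < \<delta>"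
  shows "(\<lambda>n. chi m n g) \<longlonglongrightarrow> 0"
proof (rule LIMSEQ_I)
  fix \<delta> :: real assume "\<delta> > 0"
  then obtain n where n: "n \<ge> m" "cmod (chi m n g) < \<delta>" using small by blast
  have "cmod (chi m l g) < \<delta>" if l: "l \<ge> n" for l
  proof -
    have "cmod (chi m l g) = cmod (chi m n g) * cmod (chi n l g)"
      using chi_concat[OF n(1) l g] by (simp flip: norm_mult)
    also have "\<dots> \<le> cmod (chi m n g)" using chi_norm_le[OF l g] by (simp add: mult_left_le)
    finally show ?thesis using n(2) by linarith
  qed
  then show "\<exists>n0. \<forall>l\<ge>n0. norm (chi m l g - 0) < \<delta>" by auto
qed

theorem tracial_Rokhlin_iff:
  "tracial_Rokhlin G \<alpha> \<longleftrightarrow> (\<exists>\<nu>. telescope \<nu> \<and> (\<forall>n. \<forall>g\<in>carrier G.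
     (\<lambda>k. \<Prod>i\<in>{n..<k}. 1 / of_nat (telescope_dim \<nu> d i) * character (telescope_rep \<nu> \<pi> i) g)
       \<longlonglongrightarrow> indicator {\<one>\<^bsub>G\<^esub>} g))"
  (is "_ \<longleftrightarrow> (\<exists>\<nu>. telescope \<nu> \<and> (\<forall>n. \<forall>g\<in>carrier G. ?f \<nu> n g \<longlonglongrightarrow> _))")
proof
  assume R: "tracial_Rokhlin G \<alpha>"
  have id: "telescope (\<lambda>n. n)" by (simp add: telescope_def strict_mono_def)
  have "?f (\<lambda>n. n) n g \<longlonglongrightarrow> indicator {\<one>\<^bsub>G\<^esub>} g" if g: "g \<in> carrier G" for n g
  proof -
    have "(\<lambda>k. chi n k g) \<longlonglongrightarrow> indicator {\<one>\<^bsub>G\<^esub>} g"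
    proof (cases "g = \<one>\<^bsub>G\<^esub>")
      case True
      have "eventually (\<lambda>k. chi n k g = 1) sequentially"
        unfolding eventually_sequentially using chi_one True by blast
      then show ?thesis using True by (simp add: tendsto_eventually)
    next
      case False
      have "(\<lambda>k. chi n k g) \<longlonglongrightarrow> 0"
      proof (rule chi_tendsto_if_small[OF g])
        fix \<delta> :: real assume "\<delta> > 0"
        then show "\<exists>k\<ge>n. cmod (chi n k g) < \<delta>" using tracial_Rokhlin_imp_chi_small[OF R g False] by metis
      qed
      then show ?thesis using False by simp
    qed
    moreover have "eventually (\<lambda>k. chi n k g = ?f (\<lambda>n. n) n g k) sequentially"
      unfolding eventually_sequentially using telescope_chi_prod[OF id _ g, of n] by (intro exI[of _ n]) simp
    ultimately show ?thesis by (rule Lim_transform_eventually)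
  qed
  with id show "\<exists>\<nu>. telescope \<nu> \<and> (\<forall>n. \<forall>g\<in>carrier G. ?f \<nu> n g \<longlonglongrightarrow> indicator {\<one>\<^bsub>G\<^esub>} g)" by blast
next
  assume "\<exists>\<nu>. telescope \<nu> \<and> (\<forall>n. \<forall>g\<in>carrier G. ?f \<nu> n g \<longlonglongrightarrow> indicator {\<one>\<^bsub>G\<^esub>} g)"
  then obtain \<nu> where \<nu>: "telescope \<nu>" and lim: "\<And>n g. g \<in> carrier G \<Longrightarrow> ?f \<nu> n g \<longlonglongrightarrow> indicator {\<one>\<^bsub>G\<^esub>} g" by blast
  show "tracial_Rokhlin G \<alpha>"
  proof (rule tracial_Rokhlin_if_chi_tendsto)
    fix m g assume g: "g \<in> carrier G" "g \<noteq> \<one>\<^bsub>G\<^esub>"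
    show "(\<lambda>n. chi m n g) \<longlonglongrightarrow> 0"
    proof (rule chi_tendsto_if_small[OF g(1)])
      fix \<delta> :: real assume "\<delta> > 0"
      moreover have "?f \<nu> m g \<longlonglongrightarrow> 0" using lim[OF g(1), of m] g(2) by simp
      ultimately obtain k0 where k0: "\<And>k. k \<ge> k0 \<Longrightarrow> cmod (?f \<nu> m g k) < \<delta>"
        unfolding LIMSEQ_iff diff_zero by blast
      define k where "k = max k0 m"
      have k: "k \<ge> m" "k \<ge> k0" by (simp_all add: k_def)
      have le: "m \<le> \<nu> m" "\<nu> m \<le> \<nu> k" using telescope_ge[OF \<nu>] telescope_mono[OF \<nu> k(1)] by auto
      have "cmod (chi (\<nu> m) (\<nu> k) g) < \<delta>" using k0[OF k(2)] telescope_chi_prod[OF \<nu> k(1) g(1)] by simp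
      moreover have "cmod (chi m (\<nu> k) g) \<le> cmod (chi (\<nu> m) (\<nu> k) g)"
        using chi_concat[OF le g(1)] chi_norm_le[OF le(1) g(1)]
        by (metis mult_left_le_one_le norm_ge_zero norm_mult)
      ultimately show "\<exists>n\<ge>m. cmod (chi m n g) < \<delta>" using le by (intro exI[of _ "\<nu> k"]) auto
    qed
  qed
qed

end

theorem theorem3p3:
  fixes G :: "('g, 'm) monoid_scheme"
    and d :: "nat \<Rightarrow> nat"
    and \<phi> :: "nat \<Rightarrow> complex mat \<Rightarrow> 'a::unital_cstar_algebra"
    and \<pi> :: "nat \<Rightarrow> 'g \<Rightarrow> complex mat"
    and \<alpha> :: "'g \<Rightarrow> 'a \<Rightarrow> 'a"
  assumes "group G" and "finite (carrier G)"
    and "infinite_tensor_product d \<phi>"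
    and "infinite_dimensional TYPE('a)"
    and "product_type_action G d \<phi> \<pi> \<alpha>"
  shows
    "(strict_Rokhlin G \<alpha> \<longleftrightarrow>
       (\<exists>\<nu>. telescope \<nu> \<and>
         (\<forall>n. \<forall>g\<in>carrier G.
            1 / of_nat (telescope_dim \<nu> d n) * character (telescope_rep \<nu> \<pi> n) g
              = indicator {\<one>\<^bsub>G\<^esub>} g)))
     \<and>
     (tracial_Rokhlin G \<alpha> \<longleftrightarrow>
       (\<exists>\<nu>. telescope \<nu> \<and>
         (\<forall>n. \<forall>g\<in>carrier G.
            (\<lambda>N. \<Prod>i\<in>{n..<N}.
               1 / of_nat (telescope_dim \<nu> d i) * character (telescope_rep \<nu> \<pi> i) g)
              \<longlonglongrightarrow> indicator {\<one>\<^bsub>G\<^esub>} g)))"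
proof -
  interpret product_action G d \<phi> \<pi> \<alpha> by (rule product_action.intro) (fact assms)+
  show ?thesis using strict_Rokhlin_iff tracial_Rokhlin_iff by (rule conjI)
qed

end
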